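(* Let $\mu,\lambda,\sigma,\theta,W,q$ be the parameters of the continuum kernel equations (K1)–(K2) with boundary conditions (B1)–(B2) given in the context. Suppose that these parameters are analytic on polydisks with radii larger than one, that $|\lambda(x,y)|>0$ for all $x,y\in[0,1]$, and that $|\mu(x)|>0$ for all $x\in[0,1]$. Let $(k,\bar k)$ be the exact solution to (K1), (K2), (B1), (B2), given by convergent power series $$k(x,\xi,y)=\sum_{\ell=0}^\infty\sum_{i=0}^\infty\sum_{j=0}^iK_{ij\ell}x^{i-j}\xi^jy^\ell,\qquad \bar k(x,\xi)=\sum_{i=0}^\infty\sum_{j=0}^i\bar K_{ij}x^{i-j}\xi^j .$$ For each $N$, let $(k^{\mathrm a},\bar k^{\mathrm a})$ be the approximate solution of order $N$ produced by the least-squares power series algorithm described in the context. Then $(k^{\mathrm a},\bar k^{\mathrm a})$ converges to the exact solution $(k,\bar k)$ as $N\to\infty$, pointwise on $\mathcal{P}$ and $\mathcal{T}$, respectively.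
   Context: Let $\mathcal{T}=\{(x,\xi)\in[0,1]^2:0\le\xi\le x\le1\}$ and $\mathcal{P}=\{(x,\xi,y)\in[0,1]^3:(x,\xi)\in\mathcal{T}\}$. The continuum kernel equations for the unknowns $k$ on $\mathcal{P}$ and $\bar k$ on $\mathcal{T}$ are (K1) $\mu(x)\partial_xk(x,\xi,y)-\lambda(\xi,y)\partial_\xi k(x,\xi,y)-\theta(\xi,y)\bar k(x,\xi)=k(x,\xi,y)\,\partial_\xi\lambda(\xi,y)+\int_0^1\sigma(\xi,\eta,y)k(x,\xi,\eta)\,d\eta$, (K2) $\mu(x)\partial_x\bar k(x,\xi)+\mu(\xi)\partial_\xi\bar k(x,\xi)=-\mu'(\xi)\bar k(x,\xi)+\int_0^1W(\xi,y)k(x,\xi,y)\,dy$, with boundary conditions, for all $x\in[0,1]$ and almost every $y\in[0,1]$, (B1) $k(x,x,y)=-\dfrac{\theta(x,y)}{\lambda(x,y)+\mu(x)}$, (B2) $\mu(0)\bar k(x,0)=\int_0^1q(y)\lambda(0,y)k(x,0,y)\,dy$. The parameters $\mu,\lambda,\sigma,\theta,W,q$ are given, with the standing assumption $\mu>0$ and $\lambda>0$ on $[0,1]$ and $[0,1]^2$, respectively. For the power series, the parameters and the kernels are regarded as complex-valued functions of complex variables. A polydisk of radius $L$ means $\mathcal{D}_L\times\mathcal{D}_L\times\mathcal{D}_L$ (or $\mathcal{D}_L\times\mathcal{D}_L$, or $\mathcal{D}_L$, according to the number of variables), where $\mathcal{D}_L=\{z\in\mathbb{C}:|z|<L\}$.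 Algorithm of order $N$. Write the Taylor series of the parameters at the origin as $\lambda(x,y)=\sum_{i\ge0}\sum_{j=0}^i\lambda_{ij}x^{i-j}y^j$, $\mu(x)=\sum_{i\ge0}\mu_ix^i$, $\theta(\xi,y)=\sum_{i\ge0}\sum_{j=0}^i\theta_{ij}\xi^{i-j}y^j$, $W(\xi,y)=\sum_{i\ge0}\sum_{j=0}^iW_{ij}\xi^{i-j}y^j$, $\sigma(x,\eta,y)=\sum_{\ell\ge0}\sum_{i\ge0}\sum_{j=0}^i\sigma_{ij\ell}x^{i-j}\eta^jy^\ell$, $q(y)=\sum_{i\ge0}q_iy^i$. Truncate them: in the series for $\lambda,\mu,\theta,W,q$ keep only $i\le N$, and in the series for $\sigma$ keep only $0\le\ell\le N$, $0\le i\le N-\ell$; denote the truncations by $\lambda^{\mathrm a},\mu^{\mathrm a},\theta^{\mathrm a},W^{\mathrm a},\sigma^{\mathrm a},q^{\mathrm a}$. Set $$k^{\mathrm a}(x,\xi,y)=\sum_{\ell=0}^N\sum_{i=0}^{N-\ell}\sum_{j=0}^iK^{\mathrm a}_{ij\ell}x^{i-j}\xi^jy^\ell,\qquad \bar k^{\mathrm a}(x,\xi)=\sum_{i=0}^N\sum_{j=0}^i\bar K^{\mathrm a}_{ij}x^{i-j}\xi^j$$ with unknown coefficients $K^{\mathrm a}_{ij\ell},\bar K^{\mathrm a}_{ij}$. Insert the truncated parameters and $(k^{\mathrm a},\bar k^{\mathrm a})$ in place of the parameters and $(k,\bar k)$ into (K1), (K2), (B2) and, for (B1), into its equivalent form $(\lambda(x,y)+\mu(x))k(x,x,y)=-\theta(x,y)$.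 Each of these becomes an identity between polynomials in $x,\xi,y$ whose coefficients are affine in the unknowns. Equating the coefficients of every monomial appearing (including all monomials of degree greater than $N$ arising from products) gives a finite, in general over-determined, linear system $\mathbf{A}_N\mathbf{x}_N=\mathbf{b}_N$ for the vector $\mathbf{x}_N$ of all unknown coefficients. The algorithm takes a least-squares solution $\mathbf{x}_N^{\mathrm a}$, i.e. a minimizer of $\|\mathbf{A}_N\mathbf{x}_N-\mathbf{b}_N\|_2$, and returns $(k^{\mathrm a},\bar k^{\mathrm a})$ with these coefficients. *)

theory Defs
  imports "HOL-Complex_Analysis.Complex_Analysis"
begin

text \<open>
  A function is analytic on an open set if around every point of the set it is the sum of a power
  series.  The unordered sum \<open>has_sum\<close> expresses the usual (absolute) convergence of a
  power series in several variables.  For one variable the library's \<open>analytic_on\<close> is used.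
\<close>

definition analytic2_on ::
  "(complex \<Rightarrow> complex \<Rightarrow> complex) \<Rightarrow> (complex \<times> complex) set \<Rightarrow> bool" where
  "analytic2_on f S \<longleftrightarrow> (\<forall>(a, b)\<in>S. \<exists>r>0. \<exists>c. \<forall>x\<in>ball a r. \<forall>y\<in>ball b r.
     ((\<lambda>(m, n). c m n * (x - a) ^ m * (y - b) ^ n) has_sum f x y) UNIV)"

definition analytic3_on ::
  "(complex \<Rightarrow> complex \<Rightarrow> complex \<Rightarrow> complex) \<Rightarrow> (complex \<times> complex \<times> complex) set \<Rightarrow> bool" where
  "analytic3_on f S \<longleftrightarrow> (\<forall>(a, b, d)\<in>S. \<exists>r>0. \<exists>c. \<forall>x\<in>ball a r. \<forall>y\<in>ball b r. \<forall>z\<in>ball d r.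
     ((\<lambda>(m, n, p). c m n p * (x - a) ^ m * (y - b) ^ n * (z - d) ^ p) has_sum f x y z) UNIV)"

definition taylor1 :: "(complex \<Rightarrow> complex) \<Rightarrow> nat \<Rightarrow> complex" where
  "taylor1 f m = (deriv ^^ m) f 0 / fact m"

definition taylor2 :: "(complex \<Rightarrow> complex \<Rightarrow> complex) \<Rightarrow> nat \<Rightarrow> nat \<Rightarrow> complex" where
  "taylor2 f m n = (deriv ^^ m) (\<lambda>x. (deriv ^^ n) (\<lambda>y. f x y) 0) 0 / (fact m * fact n)"

definition taylor3 ::
  "(complex \<Rightarrow> complex \<Rightarrow> complex \<Rightarrow> complex) \<Rightarrow> nat \<Rightarrow> nat \<Rightarrow> nat \<Rightarrow> complex" where
  "taylor3 f m n p =
     (deriv ^^ m) (\<lambda>x. (deriv ^^ n) (\<lambda>y. (deriv ^^ p) (\<lambda>z. f x y z) 0) 0) 0 /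
     (fact m * fact n * fact p)"

text \<open>
  The coefficient arrays are indexed as in the triangular summation scheme: entry \<open>i j\<close>
  (with \<open>j \<le> i\<close>) belongs to \<open>x ^ (i - j) * y ^ j\<close>.  Entries outside the summation
  range play no role.
\<close>

definition tpoly1 :: "nat \<Rightarrow> (nat \<Rightarrow> complex) \<Rightarrow> complex \<Rightarrow> complex" where
  "tpoly1 N C x = (\<Sum>i\<le>N. C i * x ^ i)"

definition tpoly2 :: "nat \<Rightarrow> (nat \<Rightarrow> nat \<Rightarrow> complex) \<Rightarrow> complex \<Rightarrow> complex \<Rightarrow> complex" where
  "tpoly2 N C x y = (\<Sum>i\<le>N. \<Sum>j\<le>i. C i j * x ^ (i - j) * y ^ j)"

definition tpoly3 ::
  "nat \<Rightarrow> (nat \<Rightarrow> nat \<Rightarrow> nat \<Rightarrow> complex) \<Rightarrow> complex \<Rightarrow> complex \<Rightarrow> complex \<Rightarrow> complex" where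
  "tpoly3 N C x y z = (\<Sum>l\<le>N. \<Sum>i\<le>N - l. \<Sum>j\<le>i. C i j l * x ^ (i - j) * y ^ j * z ^ l)"

definition trunc1 :: "nat \<Rightarrow> (complex \<Rightarrow> complex) \<Rightarrow> complex \<Rightarrow> complex" where
  "trunc1 N f = tpoly1 N (taylor1 f)"

definition trunc2 ::
  "nat \<Rightarrow> (complex \<Rightarrow> complex \<Rightarrow> complex) \<Rightarrow> complex \<Rightarrow> complex \<Rightarrow> complex" where
  "trunc2 N f = tpoly2 N (\<lambda>i j. taylor2 f (i - j) j)"

definition trunc3 ::
  "nat \<Rightarrow> (complex \<Rightarrow> complex \<Rightarrow> complex \<Rightarrow> complex) \<Rightarrow>
   complex \<Rightarrow> complex \<Rightarrow> complex \<Rightarrow> complex" where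
  "trunc3 N f = tpoly3 N (\<lambda>i j l. taylor3 f (i - j) j l)"

definition domT :: "(real \<times> real) set" where
  "domT = {(x, \<xi>). 0 \<le> \<xi> \<and> \<xi> \<le> x \<and> x \<le> 1}"

definition domP :: "(real \<times> real \<times> real) set" where
  "domP = {(x, \<xi>, y). (x, \<xi>) \<in> domT \<and> 0 \<le> y \<and> y \<le> 1}"

text \<open>
  Left-hand side minus right-hand side of each equation.  The first boundary condition is taken in
  the form multiplied by its denominator, which is the form used by the algorithm; the exact
  solution is required to satisfy the original form, see \<open>kernel_solution\<close>.
\<close>

definition K1_defect ::
  "(complex \<Rightarrow> complex) \<Rightarrow> (complex \<Rightarrow> complex \<Rightarrow> complex) \<Rightarrow>
   (complex \<Rightarrow> complex \<Rightarrow> complex \<Rightarrow> complex) \<Rightarrow> (complex \<Rightarrow> complex \<Rightarrow> complex) \<Rightarrow>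
   (complex \<Rightarrow> complex \<Rightarrow> complex \<Rightarrow> complex) \<Rightarrow> (complex \<Rightarrow> complex \<Rightarrow> complex) \<Rightarrow>
   complex \<Rightarrow> complex \<Rightarrow> complex \<Rightarrow> complex" where
  "K1_defect \<mu> \<Lambda> \<sigma> \<theta> k kb x \<xi> y =
     (\<mu> x * deriv (\<lambda>s. k s \<xi> y) x - \<Lambda> \<xi> y * deriv (\<lambda>s. k x s y) \<xi> - \<theta> \<xi> y * kb x \<xi>)
     - (k x \<xi> y * deriv (\<lambda>s. \<Lambda> s y) \<xi>
        + integral {0..1} (\<lambda>\<eta>. \<sigma> \<xi> (complex_of_real \<eta>) y * k x \<xi> (complex_of_real \<eta>)))"

definition K2_defect ::
  "(complex \<Rightarrow> complex) \<Rightarrow> (complex \<Rightarrow> complex \<Rightarrow> complex) \<Rightarrow>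
   (complex \<Rightarrow> complex \<Rightarrow> complex \<Rightarrow> complex) \<Rightarrow> (complex \<Rightarrow> complex \<Rightarrow> complex) \<Rightarrow>
   complex \<Rightarrow> complex \<Rightarrow> complex" where
  "K2_defect \<mu> W k kb x \<xi> =
     (\<mu> x * deriv (\<lambda>s. kb s \<xi>) x + \<mu> \<xi> * deriv (\<lambda>s. kb x s) \<xi>)
     - (- deriv \<mu> \<xi> * kb x \<xi>
        + integral {0..1} (\<lambda>y. W \<xi> (complex_of_real y) * k x \<xi> (complex_of_real y)))"

definition B1_defect ::
  "(complex \<Rightarrow> complex) \<Rightarrow> (complex \<Rightarrow> complex \<Rightarrow> complex) \<Rightarrow>
   (complex \<Rightarrow> complex \<Rightarrow> complex) \<Rightarrow> (complex \<Rightarrow> complex \<Rightarrow> complex \<Rightarrow> complex) \<Rightarrow>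
   complex \<Rightarrow> complex \<Rightarrow> complex" where
  "B1_defect \<mu> \<Lambda> \<theta> k x y = (\<Lambda> x y + \<mu> x) * k x x y - (- \<theta> x y)"

definition B2_defect ::
  "(complex \<Rightarrow> complex) \<Rightarrow> (complex \<Rightarrow> complex \<Rightarrow> complex) \<Rightarrow> (complex \<Rightarrow> complex) \<Rightarrow>
   (complex \<Rightarrow> complex \<Rightarrow> complex \<Rightarrow> complex) \<Rightarrow> (complex \<Rightarrow> complex \<Rightarrow> complex) \<Rightarrow>
   complex \<Rightarrow> complex" where
  "B2_defect \<mu> \<Lambda> q k kb x =
     \<mu> 0 * kb x 0
     - integral {0..1} (\<lambda>y. q (complex_of_real y) * \<Lambda> 0 (complex_of_real y)
                            * k x 0 (complex_of_real y))"

definition kernel_solution ::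
  "(complex \<Rightarrow> complex) \<Rightarrow> (complex \<Rightarrow> complex \<Rightarrow> complex) \<Rightarrow>
   (complex \<Rightarrow> complex \<Rightarrow> complex \<Rightarrow> complex) \<Rightarrow> (complex \<Rightarrow> complex \<Rightarrow> complex) \<Rightarrow>
   (complex \<Rightarrow> complex \<Rightarrow> complex) \<Rightarrow> (complex \<Rightarrow> complex) \<Rightarrow>
   (complex \<Rightarrow> complex \<Rightarrow> complex \<Rightarrow> complex) \<Rightarrow> (complex \<Rightarrow> complex \<Rightarrow> complex) \<Rightarrow> bool" where
  "kernel_solution \<mu> \<Lambda> \<sigma> \<theta> W q k kb \<longleftrightarrow>
     (\<forall>(x, \<xi>, y)\<in>domP.
        K1_defect \<mu> \<Lambda> \<sigma> \<theta> k kb (complex_of_real x) (complex_of_real \<xi>) (complex_of_real y) = 0) \<and>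
     (\<forall>(x, \<xi>)\<in>domT.
        K2_defect \<mu> W k kb (complex_of_real x) (complex_of_real \<xi>) = 0) \<and>
     (\<forall>x\<in>{0..1}. AE y in lborel. y \<in> {0..1} \<longrightarrow>
        k (complex_of_real x) (complex_of_real x) (complex_of_real y) =
          - (\<theta> (complex_of_real x) (complex_of_real y) /
             (\<Lambda> (complex_of_real x) (complex_of_real y) + \<mu> (complex_of_real x)))) \<and>
     (\<forall>x\<in>{0..1}. B2_defect \<mu> \<Lambda> q k kb (complex_of_real x) = 0)"

text \<open>
  The coefficients of a polynomial function of three complex variables (well defined by
  \<open>poly_coeffs_eqI\<close> below).  A polynomial in fewer variables is treated as one in three
  variables that does not depend on the remaining ones; its coefficients are the same, up to
  additional zeros.
\<close>

definition poly_coeffs ::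
  "(complex \<Rightarrow> complex \<Rightarrow> complex \<Rightarrow> complex) \<Rightarrow> nat \<times> nat \<times> nat \<Rightarrow> complex" where
  "poly_coeffs F = (THE c. finite {m. c m \<noteq> 0} \<and>
     (\<forall>x y z. F x y z = (\<Sum>m\<in>{m. c m \<noteq> 0}. case m of (a, b, d) \<Rightarrow> c m * x ^ a * y ^ b * z ^ d)))"

definition coeff_norm_sq :: "(complex \<Rightarrow> complex \<Rightarrow> complex \<Rightarrow> complex) \<Rightarrow> real" where
  "coeff_norm_sq F = (\<Sum>m\<in>{m. poly_coeffs F m \<noteq> 0}. (cmod (poly_coeffs F m))\<^sup>2)"

text \<open>
  For coefficient arrays \<open>K\<close>, \<open>Kb\<close> forming the vector $x$ of unknowns, the vector
  $A_N x - b_N$ consists of all coefficients of the four defects obtained by inserting the truncated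
  parameters and the polynomial ansatz; \<open>ls_residual\<close> is its Euclidean norm.
\<close>

definition ls_residual ::
  "nat \<Rightarrow> (complex \<Rightarrow> complex) \<Rightarrow> (complex \<Rightarrow> complex \<Rightarrow> complex) \<Rightarrow>
   (complex \<Rightarrow> complex \<Rightarrow> complex \<Rightarrow> complex) \<Rightarrow> (complex \<Rightarrow> complex \<Rightarrow> complex) \<Rightarrow>
   (complex \<Rightarrow> complex \<Rightarrow> complex) \<Rightarrow> (complex \<Rightarrow> complex) \<Rightarrow>
   (nat \<Rightarrow> nat \<Rightarrow> nat \<Rightarrow> complex) \<Rightarrow> (nat \<Rightarrow> nat \<Rightarrow> complex) \<Rightarrow> real" where
  "ls_residual N \<mu> \<Lambda> \<sigma> \<theta> W q K Kb =
     (let \<mu>a = trunc1 N \<mu>; \<Lambda>a = trunc2 N \<Lambda>; \<sigma>a = trunc3 N \<sigma>;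
          \<theta>a = trunc2 N \<theta>; Wa = trunc2 N W; qa = trunc1 N q;
          ka = tpoly3 N K; kba = tpoly2 N Kb
      in sqrt (coeff_norm_sq (\<lambda>x \<xi> y. K1_defect \<mu>a \<Lambda>a \<sigma>a \<theta>a ka kba x \<xi> y)
             + coeff_norm_sq (\<lambda>x \<xi> y. K2_defect \<mu>a Wa ka kba x \<xi>)
             + coeff_norm_sq (\<lambda>x \<xi> y. B1_defect \<mu>a \<Lambda>a \<theta>a ka x y)
             + coeff_norm_sq (\<lambda>x \<xi> y. B2_defect \<mu>a \<Lambda>a qa ka kba x)))"

definition ls_solution ::
  "nat \<Rightarrow> (complex \<Rightarrow> complex) \<Rightarrow> (complex \<Rightarrow> complex \<Rightarrow> complex) \<Rightarrow>
   (complex \<Rightarrow> complex \<Rightarrow> complex \<Rightarrow> complex) \<Rightarrow> (complex \<Rightarrow> complex \<Rightarrow> complex) \<Rightarrow>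
   (complex \<Rightarrow> complex \<Rightarrow> complex) \<Rightarrow> (complex \<Rightarrow> complex) \<Rightarrow>
   (nat \<Rightarrow> nat \<Rightarrow> nat \<Rightarrow> complex) \<Rightarrow> (nat \<Rightarrow> nat \<Rightarrow> complex) \<Rightarrow> bool" where
  "ls_solution N \<mu> \<Lambda> \<sigma> \<theta> W q K Kb \<longleftrightarrow>
     (\<forall>K' Kb'. ls_residual N \<mu> \<Lambda> \<sigma> \<theta> W q K Kb \<le> ls_residual N \<mu> \<Lambda> \<sigma> \<theta> W q K' Kb')"

lemma poly_function_zero_coeffs:
  fixes c :: "nat \<times> nat \<times> nat \<Rightarrow> complex"
  assumes zero: "\<And>x y z. (\<Sum>a\<le>n. \<Sum>b\<le>n. \<Sum>d\<le>n. c (a, b, d) * x ^ a * y ^ b * z ^ d) = 0"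
    and le: "a \<le> n" "b \<le> n" "d \<le> n"
  shows "c (a, b, d) = 0"
proof -
  have 1: "(\<Sum>b\<le>n. \<Sum>d\<le>n. c (a, b, d) * y ^ b * z ^ d) = 0" if "a \<le> n" for a y z
  proof -
    have "\<forall>x. (\<Sum>a\<le>n. (\<Sum>b\<le>n. \<Sum>d\<le>n. c (a, b, d) * y ^ b * z ^ d) * x ^ a) = 0"
      using zero by (simp add: sum_distrib_left sum_distrib_right mult_ac)
    then show ?thesis using that
      by (subst (asm) polyfun_eq_0) auto
  qed
  have 2: "(\<Sum>d\<le>n. c (a, b, d) * z ^ d) = 0" if "a \<le> n" "b \<le> n" for a b z
  proof -
    have "\<forall>y. (\<Sum>b\<le>n. (\<Sum>d\<le>n. c (a, b, d) * z ^ d) * y ^ b) = 0"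
      using 1[OF that(1)] by (simp add: sum_distrib_left sum_distrib_right mult_ac)
    then show ?thesis using that
      by (subst (asm) polyfun_eq_0) auto
  qed
  have "\<forall>z. (\<Sum>d\<le>n. c (a, b, d) * z ^ d) = 0" using 2 le by auto
  then show ?thesis using le by (subst (asm) polyfun_eq_0) auto
qed

lemma poly_coeffs_eqI:
  assumes fin: "finite {m. c m \<noteq> 0}"
    and F: "\<And>x y z. F x y z =
      (\<Sum>m\<in>{m. c m \<noteq> 0}. case m of (a, b, d) \<Rightarrow> c m * x ^ a * y ^ b * z ^ d)"
  shows "poly_coeffs F = c"
  unfolding poly_coeffs_def
proof (rule the_equality)
  show "finite {m. c m \<noteq> 0} \<and> (\<forall>x y z. F x y z =
      (\<Sum>m\<in>{m. c m \<noteq> 0}. case m of (a, b, d) \<Rightarrow> c m * x ^ a * y ^ b * z ^ d))"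
    using assms by blast
next
  fix c' :: "nat \<times> nat \<times> nat \<Rightarrow> complex"
  assume c': "finite {m. c' m \<noteq> 0} \<and> (\<forall>x y z. F x y z =
      (\<Sum>m\<in>{m. c' m \<noteq> 0}. case m of (a, b, d) \<Rightarrow> c' m * x ^ a * y ^ b * z ^ d))"
  have "finite ({m. c m \<noteq> 0} \<union> {m. c' m \<noteq> 0})" (is "finite ?S") using fin c' by auto
  then have "finite ((\<lambda>(a, b, d). a + b + d) ` ?S)" by blast
  then obtain n where n: "\<And>m. m \<in> ?S \<Longrightarrow> (case m of (a, b, d) \<Rightarrow> a + b + d) \<le> n"
    by (meson finite_nat_set_iff_bounded_le imageI)
  let ?B = "{..n} \<times> {..n} \<times> {..n}"
  have sub: "?S \<subseteq> ?B"
    using n by force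
  have box: "(\<Sum>m\<in>{m. g m \<noteq> 0}. case m of (a, b, d) \<Rightarrow> g m * x ^ a * y ^ b * z ^ d)
      = (\<Sum>a\<le>n. \<Sum>b\<le>n. \<Sum>d\<le>n. g (a, b, d) * x ^ a * y ^ b * z ^ d)"
    if "{m. g m \<noteq> 0} \<subseteq> ?B" for g :: "nat \<times> nat \<times> nat \<Rightarrow> complex" and x y z
  proof -
    have "(\<Sum>m\<in>{m. g m \<noteq> 0}. case m of (a, b, d) \<Rightarrow> g m * x ^ a * y ^ b * z ^ d)
        = (\<Sum>m\<in>?B. case m of (a, b, d) \<Rightarrow> g m * x ^ a * y ^ b * z ^ d)"
      by (rule sum.mono_neutral_left) (use that in auto)
    also have "\<dots> = (\<Sum>(a, b, d)\<in>?B. g (a, b, d) * x ^ a * y ^ b * z ^ d)"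
      by (rule sum.cong) auto
    also have "\<dots> = (\<Sum>a\<le>n. \<Sum>b\<le>n. \<Sum>d\<le>n. g (a, b, d) * x ^ a * y ^ b * z ^ d)"
      by (simp add: sum.cartesian_product)
    finally show ?thesis .
  qed
  have eq: "(\<Sum>a\<le>n. \<Sum>b\<le>n. \<Sum>d\<le>n. (c' (a, b, d) - c (a, b, d)) * x ^ a * y ^ b * z ^ d) = 0"
    for x y z
    using box[of c x y z] box[of c' x y z] sub c' F[of x y z]
    by (simp add: left_diff_distrib sum_subtractf)
  show "c' = c"
  proof
    fix m :: "nat \<times> nat \<times> nat"
    obtain a b d where m: "m = (a, b, d)" by (cases m)
    show "c' m = c m"
    proof (cases "m \<in> ?B")
      case True
      then show ?thesis
        using poly_function_zero_coeffs[where c = "\<lambda>m. c' m - c m" and n = n, OF eq] m by auto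
    next
      case False
      then have "m \<notin> ?S" using sub by blast
      then show ?thesis by simp
    qed
  qed
qed

end

theory Submission
  imports Defs
begin

text \<open>
  All parameters and the exact kernels are sums of power series on a polydisk of radius larger than
  one, so their truncations converge there at a geometric rate, together with derivatives and
  integrals.  The defects of the exact solution vanish on a real set of uniqueness, hence on the
  polydisk; Cauchy's inequalities on a radius larger than one then bound the coefficients of the
  defects of the truncated exact solution, and its least-squares residual decays geometrically.
  The residual of the minimizer is at most that.  The defects have degree
  of order \<open>N\<close>, so their sup norm on the unit polydisk exceeds the coefficient norm by at most a cubic
  factor in \<open>N\<close>, which the geometric decay absorbs.  The difference of the two polynomial solutions thus
  solves the homogeneous equations with truncated parameters up to defects tending to zero
  uniformly, and a maximum principle with constants independent of \<open>N\<close> shows that it tends to zero.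
\<close>

section \<open>Polynomials in three variables\<close>

text \<open>The obstacle is that nothing is known in advance about the size of the least-squares
  coefficients or of the derivatives of the approximants. Replacing truncated by exact parameters in
  their equations would leave terms such as \<open>\<mu> - trunc1 N \<mu>\<close> times an
  uncontrolled derivative. The approximant is therefore compared with the truncated series of the
  exact kernels under the same truncated parameters: the equations subtract linearly and only two
  sets of defects remain. The price is a stability estimate for operators that vary with
  \<open>N\<close>. Their coefficients are bounded uniformly in \<open>N\<close>, and for large
  \<open>N\<close> the truncated \<open>\<mu>\<close> stays above a positive constant and the
  truncated \<open>\<Lambda>\<close> stays nonnegative on the real domain. Both truncations are real
  there because their Taylor coefficients are real, so the characteristic directions are real
  vectors. Least squares measures coefficients while stability measures values; degrees are tracked
  along with errors to pass from one to the other.\<close>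

inductive poly3 :: "nat \<Rightarrow> (complex \<Rightarrow> complex \<Rightarrow> complex \<Rightarrow> complex) \<Rightarrow> bool" for n where
  poly3_monom: "a \<le> n \<Longrightarrow> b \<le> n \<Longrightarrow> d \<le> n \<Longrightarrow> poly3 n (\<lambda>x y z. c * x ^ a * y ^ b * z ^ d)"
| poly3_add: "poly3 n F \<Longrightarrow> poly3 n G \<Longrightarrow> poly3 n (\<lambda>x y z. F x y z + G x y z)"

lemma poly3_mono:
  assumes "poly3 n F" "n \<le> m"
  shows "poly3 m F"
  using assms(1)
proof induction
  case (poly3_monom a b d c)
  then show ?case using assms(2) by (intro poly3.poly3_monom) auto
qed (rule poly3.poly3_add)

lemma poly3_const: "poly3 n (\<lambda>x y z. c)"
  using poly3_monom[of 0 n 0 0 c] by simp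

lemma poly3_vars: "poly3 1 (\<lambda>x y z. x)" "poly3 1 (\<lambda>x y z. y)" "poly3 1 (\<lambda>x y z. z)"
  using poly3_monom[of 1 1 0 0 1] poly3_monom[of 0 1 1 0 1] poly3_monom[of 0 1 0 1 1]
  by simp_all

lemma poly3_mult_monom:
  assumes "poly3 m G" "a \<le> n" "b \<le> n" "d \<le> n"
  shows "poly3 (n + m) (\<lambda>x y z. (c * x ^ a * y ^ b * z ^ d) * G x y z)"
  using assms(1)
proof induction
  case (poly3_monom a' b' d' c')
  have "poly3 (n + m) (\<lambda>x y z. (c * c') * x ^ (a + a') * y ^ (b + b') * z ^ (d + d'))"
    using poly3_monom assms by (intro poly3.poly3_monom) auto
  then show ?case by (simp add: power_add mult_ac)
next
  case (poly3_add F G)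
  show ?case
    using poly3.poly3_add[OF poly3_add.IH] by (simp add: distrib_left)
qed

lemma poly3_mult:
  assumes "poly3 n F" "poly3 m G"
  shows "poly3 (n + m) (\<lambda>x y z. F x y z * G x y z)"
  using assms(1)
proof induction
  case (poly3_monom a b d c)
  then show ?case using poly3_mult_monom[OF assms(2)] by blast
next
  case (poly3_add F G)
  show ?case
    using poly3.poly3_add[OF poly3_add.IH] by (simp add: distrib_right)
qed

lemma poly3_uminus: "poly3 n F \<Longrightarrow> poly3 n (\<lambda>x y z. - F x y z)"
  using poly3_mult[OF poly3_const[of 0 "-1"], of n F] by simp

lemma poly3_diff: "poly3 n F \<Longrightarrow> poly3 n G \<Longrightarrow> poly3 n (\<lambda>x y z. F x y z - G x y z)"
  using poly3_add[OF _ poly3_uminus, of n F G] by simp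

lemma poly3_sum: "(\<And>i. i \<in> I \<Longrightarrow> poly3 n (F i)) \<Longrightarrow> poly3 n (\<lambda>x y z. \<Sum>i\<in>I. F i x y z)"
  by (induction I rule: infinite_finite_induct) (auto intro: poly3_const poly3_add)

lemma poly3_power: "poly3 n F \<Longrightarrow> poly3 (k * n) (\<lambda>x y z. F x y z ^ k)"
proof (induction k)
  case (Suc k)
  then show ?case using poly3_mult[of n F "k * n" "\<lambda>x y z. F x y z ^ k"] by simp
qed (use poly3_const in simp)

text \<open>A substitution may merge all three variables into one, which turns the exponents
  \<open>a\<close>, \<open>b\<close>, \<open>d\<close> into \<open>a + b + d\<close>; hence the
  factor \<open>3\<close>. The diagonal values \<open>k x x y\<close> merge two of them.\<close>

lemma poly3_compose:
  assumes "poly3 n F" and s: "poly3 1 s1" "poly3 1 s2" "poly3 1 s3"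
  shows "poly3 (3 * n) (\<lambda>x y z. F (s1 x y z) (s2 x y z) (s3 x y z))"
  using assms(1)
proof induction
  case (poly3_monom a b d c)
  have "poly3 (0 + a * 1 + b * 1 + d * 1) (\<lambda>x y z. c * s1 x y z ^ a * s2 x y z ^ b * s3 x y z ^ d)"
    using poly3_mult[OF poly3_mult[OF poly3_mult[OF poly3_const[of 0 c] poly3_power[OF s(1)]]
        poly3_power[OF s(2)]] poly3_power[OF s(3)]] .
  then show ?case using poly3_monom by (elim poly3_mono) auto
qed (rule poly3.poly3_add)

text \<open>The chain rule along a complex line; it turns the derivative in a characteristic
  direction into the transport terms of (K1) and (K2). The partial differentiability statements
  share the induction because \<open>deriv\<close> of a sum splits only if both summands are
  differentiable.\<close>

lemma poly3_has_derivative: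
  assumes "poly3 n F"
  shows "((\<lambda>t. F (x + t * a) (y + t * b) (z + t * c)) has_field_derivative
    a * deriv (\<lambda>s. F s y z) x + b * deriv (\<lambda>s. F x s z) y + c * deriv (\<lambda>s. F x y s) z) (at 0)"
    and poly3_differentiable1: "(\<lambda>s. F s y z) field_differentiable at x"
    and poly3_differentiable2: "(\<lambda>s. F x s z) field_differentiable at y"
    and poly3_differentiable3: "(\<lambda>s. F x y s) field_differentiable at z"
  using assms
proof induction
  case (poly3_monom i j k c')
  have *: "deriv (\<lambda>s. c' * s ^ i * y ^ j * z ^ k) x = c' * (of_nat i * x ^ (i - 1)) * y ^ j * z ^ k"
    "deriv (\<lambda>s. c' * x ^ i * s ^ j * z ^ k) y = c' * x ^ i * (of_nat j * y ^ (j - 1)) * z ^ k"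
    "deriv (\<lambda>s. c' * x ^ i * y ^ j * s ^ k) z = c' * x ^ i * y ^ j * (of_nat k * z ^ (k - 1))"
    by (rule DERIV_imp_deriv, auto intro!: derivative_eq_intros)+
  { case 1 show ?case unfolding * by (auto intro!: derivative_eq_intros simp: algebra_simps) }
  { case 2 show ?case by (intro derivative_intros) }
  { case 3 show ?case by (intro derivative_intros) }
  { case 4 show ?case by (intro derivative_intros) }
next
  case (poly3_add F G)
  { case 1 show ?case
      using DERIV_add[OF poly3_add.IH(1) poly3_add.IH(5)] poly3_add.IH(2-4,6-8)
      by (simp add: algebra_simps deriv_add) }
  { case 2 show ?case by (intro derivative_intros poly3_add.IH) }
  { case 3 show ?case by (intro derivative_intros poly3_add.IH) }
  { case 4 show ?case by (intro derivative_intros poly3_add.IH) }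
qed

lemma poly3_deriv:
  assumes "poly3 n F"
  shows "poly3 n (\<lambda>x y z. deriv (\<lambda>s. F s y z) x)"
  using assms
proof induction
  case (poly3_monom a b d c)
  have "deriv (\<lambda>s. c * s ^ a * y ^ b * z ^ d) x = (c * of_nat a) * x ^ (a - 1) * y ^ b * z ^ d" for x y z
    by (rule DERIV_imp_deriv) (auto intro!: derivative_eq_intros)
  then show ?case using poly3_monom poly3.poly3_monom[of "a - 1" n b d "c * of_nat a"] by simp
next
  case (poly3_add F G)
  show ?case
    using poly3.poly3_add[OF poly3_add.IH]
    by (simp add: deriv_add poly3_differentiable1[OF poly3_add.hyps(1)] poly3_differentiable1[OF poly3_add.hyps(2)])
qed

lemma poly3_continuous:
  assumes "poly3 n F"
  shows "continuous_on S (\<lambda>(x, y, z). F x y z)"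
  using assms
  by induction (auto simp: case_prod_beta intro!: continuous_intros)

lemma poly3_continuous':
  assumes "poly3 n F" "continuous_on S f" "continuous_on S g" "continuous_on S h"
  shows "continuous_on S (\<lambda>x. F (f x) (g x) (h x))"
proof -
  have "continuous_on S (\<lambda>x. case (f x, g x, h x) of (x, y, z) \<Rightarrow> F x y z)"
    by (rule continuous_on_compose2[OF poly3_continuous[OF assms(1), of UNIV]])
      (use assms in \<open>auto intro!: continuous_intros\<close>)
  then show ?thesis by simp
qed

text \<open>The integral is bilinear in \<open>A\<close> and \<open>B\<close>, so an induction over
  \<open>A\<close> with one over \<open>B\<close> inside reduces it to monomials, where the powers
  of \<open>\<eta>\<close> integrate to a constant. The argument pattern is that of (K1); the
  integrals in (K2) and (B2) are instances with functions that ignore some arguments.\<close>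

lemma poly3_integral:
  assumes A: "poly3 n A" and B: "poly3 m B"
  shows "poly3 (n + m) (\<lambda>x \<xi> y. integral {0..1} (\<lambda>\<eta>. A \<xi> (complex_of_real \<eta>) y * B x \<xi> (complex_of_real \<eta>)))"
  using A
proof induction
  case (poly3_monom a b d c)
  note m = poly3_monom
  show ?case using B
  proof induction
    case (poly3_monom a' b' d' c')
    have "integral {0..1} (\<lambda>\<eta>. c * \<xi> ^ a * complex_of_real \<eta> ^ b * y ^ d * (c' * x ^ a' * \<xi> ^ b' * complex_of_real \<eta> ^ d'))
      = (c * c' * integral {0..1} (\<lambda>\<eta>. complex_of_real \<eta> ^ (b + d'))) * x ^ a' * \<xi> ^ (a + b') * y ^ d" for x \<xi> y
    proof -
      have "integral {0..1} (\<lambda>\<eta>. c * \<xi> ^ a * complex_of_real \<eta> ^ b * y ^ d * (c' * x ^ a' * \<xi> ^ b' * complex_of_real \<eta> ^ d'))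
        = integral {0..1} (\<lambda>\<eta>. (c * c' * x ^ a' * \<xi> ^ (a + b') * y ^ d) * complex_of_real \<eta> ^ (b + d'))"
        by (simp add: power_add mult_ac)
      also have "\<dots> = (c * c' * x ^ a' * \<xi> ^ (a + b') * y ^ d) * integral {0..1} (\<lambda>\<eta>. complex_of_real \<eta> ^ (b + d'))"
        by (rule integral_mult_right)
      finally show ?thesis by (simp add: mult_ac)
    qed
    then show ?case using m poly3_monom by (simp, intro poly3.poly3_monom) auto
  next
    case (poly3_add F G)
    have "integral {0..1} (\<lambda>\<eta>. c * \<xi> ^ a * complex_of_real \<eta> ^ b * y ^ d * (F x \<xi> (complex_of_real \<eta>) + G x \<xi> (complex_of_real \<eta>)))
      = integral {0..1} (\<lambda>\<eta>. c * \<xi> ^ a * complex_of_real \<eta> ^ b * y ^ d * F x \<xi> (complex_of_real \<eta>)) +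
        integral {0..1} (\<lambda>\<eta>. c * \<xi> ^ a * complex_of_real \<eta> ^ b * y ^ d * G x \<xi> (complex_of_real \<eta>))" for x \<xi> y
      unfolding distrib_left
      by (intro integral_add integrable_continuous_real continuous_intros
          poly3_continuous'[OF poly3_add.hyps(1)] poly3_continuous'[OF poly3_add.hyps(2)])
    then show ?case using poly3.poly3_add[OF poly3_add.IH] by simp
  qed
next
  case (poly3_add F G)
  have "integral {0..1} (\<lambda>\<eta>. (F \<xi> (complex_of_real \<eta>) y + G \<xi> (complex_of_real \<eta>) y) * B x \<xi> (complex_of_real \<eta>))
    = integral {0..1} (\<lambda>\<eta>. F \<xi> (complex_of_real \<eta>) y * B x \<xi> (complex_of_real \<eta>)) +
      integral {0..1} (\<lambda>\<eta>. G \<xi> (complex_of_real \<eta>) y * B x \<xi> (complex_of_real \<eta>))" for x \<xi> y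
    unfolding distrib_right
    by (intro integral_add integrable_continuous_real continuous_intros poly3_continuous'[OF B]
        poly3_continuous'[OF poly3_add.hyps(1)] poly3_continuous'[OF poly3_add.hyps(2)])
  then show ?case using poly3.poly3_add[OF poly3_add.IH] by simp
qed

lemma poly3_expansion:
  assumes "poly3 n F"
  shows "\<exists>c. {m. c m \<noteq> 0} \<subseteq> {..n} \<times> {..n} \<times> {..n} \<and>
    (\<forall>x y z. F x y z = (\<Sum>(a, b, d)\<in>{..n} \<times> {..n} \<times> {..n}. c (a, b, d) * x ^ a * y ^ b * z ^ d))"
  using assms
proof induction
  case (poly3_monom a b d c)
  let ?c = "\<lambda>m. if m = (a, b, d) then c else 0"
  have "(\<Sum>(a', b', d')\<in>{..n} \<times> {..n} \<times> {..n}. ?c (a', b', d') * x ^ a' * y ^ b' * z ^ d')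
    = (\<Sum>m\<in>{..n} \<times> {..n} \<times> {..n}. if m = (a, b, d) then c * x ^ a * y ^ b * z ^ d else 0)" for x y z
  proof (rule sum.cong)
    fix m :: "nat \<times> nat \<times> nat"
    show "(case m of (a', b', d') \<Rightarrow> ?c (a', b', d') * x ^ a' * y ^ b' * z ^ d') =
      (if m = (a, b, d) then c * x ^ a * y ^ b * z ^ d else 0)"
      by (cases m) (cases "m = (a, b, d)", auto)
  qed simp
  note eq = this
  have delta: "(\<Sum>m\<in>{..n} \<times> {..n} \<times> {..n}. if m = (a, b, d) then c * x ^ a * y ^ b * z ^ d else 0)
    = c * x ^ a * y ^ b * z ^ d" for x y z
    using poly3_monom by (subst sum.delta) auto
  have "c * x ^ a * y ^ b * z ^ d =
    (\<Sum>(a', b', d')\<in>{..n} \<times> {..n} \<times> {..n}. ?c (a', b', d') * x ^ a' * y ^ b' * z ^ d')" for x y z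
    unfolding eq delta ..
  moreover have "{m. ?c m \<noteq> 0} \<subseteq> {..n} \<times> {..n} \<times> {..n}"
    using poly3_monom by (auto split: if_splits)
  ultimately show ?case by (intro exI[of _ ?c] conjI allI)
next
  case (poly3_add F G)
  obtain c where c: "{m. c m \<noteq> 0} \<subseteq> {..n} \<times> {..n} \<times> {..n}"
    "\<And>x y z. F x y z = (\<Sum>(a, b, d)\<in>{..n} \<times> {..n} \<times> {..n}. c (a, b, d) * x ^ a * y ^ b * z ^ d)"
    using poly3_add.IH(1) by blast
  obtain c' where c': "{m. c' m \<noteq> 0} \<subseteq> {..n} \<times> {..n} \<times> {..n}"
    "\<And>x y z. G x y z = (\<Sum>(a, b, d)\<in>{..n} \<times> {..n} \<times> {..n}. c' (a, b, d) * x ^ a * y ^ b * z ^ d)"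
    using poly3_add.IH(2) by blast
  have "{m. c m + c' m \<noteq> 0} \<subseteq> {m. c m \<noteq> 0} \<union> {m. c' m \<noteq> 0}"
    by auto
  then have "{m. c m + c' m \<noteq> 0} \<subseteq> {..n} \<times> {..n} \<times> {..n}"
    using c(1) c'(1) by (meson Un_least order_trans)
  moreover have "F x y z + G x y z =
    (\<Sum>(a, b, d)\<in>{..n} \<times> {..n} \<times> {..n}. (c (a, b, d) + c' (a, b, d)) * x ^ a * y ^ b * z ^ d)" for x y z
    unfolding c(2) c'(2) case_prod_beta distrib_right sum.distrib ..
  ultimately show ?case
    by (intro exI[of _ "\<lambda>m. c m + c' m"] conjI allI)
qed

text \<open>Whatever array the expansion supplies, \<open>poly_coeffs_eqI\<close> identifies it with
  \<open>poly_coeffs F\<close>. Summing over the full box instead of the support gives an index set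
  that depends on the degree bound only.\<close>

lemma poly3_coeffs:
  assumes "poly3 n F"
  shows "{m. poly_coeffs F m \<noteq> 0} \<subseteq> {..n} \<times> {..n} \<times> {..n}"
    and "F x y z = (\<Sum>(a, b, d)\<in>{..n} \<times> {..n} \<times> {..n}. poly_coeffs F (a, b, d) * x ^ a * y ^ b * z ^ d)"
proof -
  obtain c where c: "{m. c m \<noteq> 0} \<subseteq> {..n} \<times> {..n} \<times> {..n}" "\<And>x y z. F x y z =
    (\<Sum>(a, b, d)\<in>{..n} \<times> {..n} \<times> {..n}. c (a, b, d) * x ^ a * y ^ b * z ^ d)"
    using poly3_expansion[OF assms] by blast
  have fin: "finite {m. c m \<noteq> 0}" using c(1) by (rule finite_subset) auto
  have "poly_coeffs F = c"
  proof (rule poly_coeffs_eqI[OF fin])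
    fix x y z
    have "(\<Sum>m\<in>{m. c m \<noteq> 0}. case m of (a, b, d) \<Rightarrow> c m * x ^ a * y ^ b * z ^ d)
       = (\<Sum>m\<in>{..n} \<times> {..n} \<times> {..n}. case m of (a, b, d) \<Rightarrow> c m * x ^ a * y ^ b * z ^ d)"
      by (rule sum.mono_neutral_left) (use c(1) in auto)
    also have "\<dots> = F x y z" unfolding c(2) by (rule sum.cong) auto
    finally show "F x y z = (\<Sum>m\<in>{m. c m \<noteq> 0}. case m of (a, b, d) \<Rightarrow> c m * x ^ a * y ^ b * z ^ d)" ..
  qed
  then show "{m. poly_coeffs F m \<noteq> 0} \<subseteq> {..n} \<times> {..n} \<times> {..n}"
    "F x y z = (\<Sum>(a, b, d)\<in>{..n} \<times> {..n} \<times> {..n}. poly_coeffs F (a, b, d) * x ^ a * y ^ b * z ^ d)"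
    using c by auto
qed

section \<open>Geometrically convergent polynomial sequences\<close>

text \<open>Only linear growth in \<open>N\<close> matters, so the factor \<open>c\<close> is left
  existential and every closure rule may enlarge it. \<open>Suc N\<close> leaves room for fixed
  polynomials at \<open>N = 0\<close>.\<close>

definition poly3_seq :: "(nat \<Rightarrow> complex \<Rightarrow> complex \<Rightarrow> complex \<Rightarrow> complex) \<Rightarrow> bool" where
  "poly3_seq P \<longleftrightarrow> (\<exists>c. \<forall>N. poly3 (c * Suc N) (P N))"

text \<open>The constants may depend on the radius \<open>r\<close>, because differentiation
  consumes a little radius. The class is closed under all operations that occur in the defects, so
  each defect is handled by composing rules rather than by an estimate of its own.\<close>

definition geo_approx :: "real \<Rightarrow> (nat \<Rightarrow> complex \<Rightarrow> complex \<Rightarrow> complex \<Rightarrow> complex) \<Rightarrow>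
    (complex \<Rightarrow> complex \<Rightarrow> complex \<Rightarrow> complex) \<Rightarrow> bool" where
  "geo_approx L P F \<longleftrightarrow> poly3_seq P \<and> (\<forall>r. 0 < r \<longrightarrow> r < L \<longrightarrow> (\<exists>C \<rho>. 0 < \<rho> \<and> \<rho> < 1 \<and>
     (\<forall>N. \<forall>x\<in>cball 0 r. \<forall>y\<in>cball 0 r. \<forall>z\<in>cball 0 r. cmod (P N x y z - F x y z) \<le> C * \<rho> ^ N)))"

lemma poly3_seqI: "(\<And>N. poly3 (c * Suc N) (P N)) \<Longrightarrow> poly3_seq P"
  unfolding poly3_seq_def by blast

lemma poly3_seq_const: "poly3 n F \<Longrightarrow> poly3_seq (\<lambda>N. F)"
  by (rule poly3_seqI[of n]) (erule poly3_mono, simp)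

lemma poly3_seq_add:
  assumes "poly3_seq P" "poly3_seq Q"
  shows "poly3_seq (\<lambda>N x y z. P N x y z + Q N x y z)"
proof -
  obtain c d where c: "\<And>N. poly3 (c * Suc N) (P N)" and d: "\<And>N. poly3 (d * Suc N) (Q N)"
    using assms unfolding poly3_seq_def by blast
  have "poly3 ((c + d) * Suc N) (P N)" "poly3 ((c + d) * Suc N) (Q N)" for N
    by (rule poly3_mono[OF c] poly3_mono[OF d], rule mult_le_mono1, simp)+
  then show ?thesis
    by (intro poly3_seqI[of "c + d"] poly3_add)
qed

lemma poly3_seq_mult:
  assumes "poly3_seq P" "poly3_seq Q"
  shows "poly3_seq (\<lambda>N x y z. P N x y z * Q N x y z)"
proof -
  obtain c d where c: "\<And>N. poly3 (c * Suc N) (P N)" and d: "\<And>N. poly3 (d * Suc N) (Q N)"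
    using assms unfolding poly3_seq_def by blast
  show ?thesis
    using poly3_mult[OF c d] by (intro poly3_seqI[of "c + d"]) (simp only: distrib_right)
qed

lemma poly3_seq_integral:
  assumes "poly3_seq P" "poly3_seq Q"
  shows "poly3_seq (\<lambda>N x \<xi> y. integral {0..1} (\<lambda>\<eta>. P N \<xi> (complex_of_real \<eta>) y * Q N x \<xi> (complex_of_real \<eta>)))"
proof -
  obtain c d where c: "\<And>N. poly3 (c * Suc N) (P N)" and d: "\<And>N. poly3 (d * Suc N) (Q N)"
    using assms unfolding poly3_seq_def by blast
  show ?thesis
    using poly3_integral[OF c d] by (intro poly3_seqI[of "c + d"]) (simp only: distrib_right)
qed

lemma poly3_seq_compose:
  assumes "poly3_seq P" "poly3 1 s1" "poly3 1 s2" "poly3 1 s3"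
  shows "poly3_seq (\<lambda>N x y z. P N (s1 x y z) (s2 x y z) (s3 x y z))"
proof -
  obtain c where c: "\<And>N. poly3 (c * Suc N) (P N)"
    using assms unfolding poly3_seq_def by blast
  show ?thesis
    using poly3_compose[OF c assms(2-4)] by (intro poly3_seqI[of "3 * c"]) (simp only: mult.assoc)
qed

lemma poly3_seq_deriv: "poly3_seq P \<Longrightarrow> poly3_seq (\<lambda>N x y z. deriv (\<lambda>s. P N s y z) x)"
  unfolding poly3_seq_def using poly3_deriv by blast

lemma geo_approx_poly3_seq: "geo_approx L P F \<Longrightarrow> poly3_seq P"
  by (simp add: geo_approx_def)

lemma geo_approx_poly3: "geo_approx L P F \<Longrightarrow> \<exists>n. poly3 n (P N)"
  by (auto simp: geo_approx_def poly3_seq_def)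

lemma geo_approx_mono: "geo_approx L P F \<Longrightarrow> L' \<le> L \<Longrightarrow> geo_approx L' P F"
  unfolding geo_approx_def by auto

text \<open>The constants at one radius, with a common bound \<open>B\<close> for the limit and all
  approximants. In a product or an integral of a product, \<open>B\<close> absorbs the factor that
  is held fixed.\<close>

definition geo_bound :: "real \<Rightarrow> (nat \<Rightarrow> complex \<Rightarrow> complex \<Rightarrow> complex \<Rightarrow> complex) \<Rightarrow>
    (complex \<Rightarrow> complex \<Rightarrow> complex \<Rightarrow> complex) \<Rightarrow> real \<Rightarrow> real \<Rightarrow> real \<Rightarrow> bool" where
  "geo_bound r P F C \<rho> B \<longleftrightarrow> 0 \<le> C \<and> 0 < \<rho> \<and> \<rho> < 1 \<and> 0 \<le> B \<and>
    (\<forall>x\<in>cball 0 r. \<forall>y\<in>cball 0 r. \<forall>z\<in>cball 0 r. cmod (F x y z) \<le> B \<and>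
      (\<forall>N. cmod (P N x y z) \<le> B \<and> cmod (P N x y z - F x y z) \<le> C * \<rho> ^ N))"

lemma geo_boundD:
  assumes "geo_bound r P F C \<rho> B"
  shows "0 \<le> C" "0 < \<rho>" "\<rho> < 1" "0 \<le> B"
    "\<And>N x y z. x \<in> cball 0 r \<Longrightarrow> y \<in> cball 0 r \<Longrightarrow> z \<in> cball 0 r \<Longrightarrow> cmod (P N x y z - F x y z) \<le> C * \<rho> ^ N"
    "\<And>N x y z. x \<in> cball 0 r \<Longrightarrow> y \<in> cball 0 r \<Longrightarrow> z \<in> cball 0 r \<Longrightarrow> cmod (P N x y z) \<le> B"
    "\<And>x y z. x \<in> cball 0 r \<Longrightarrow> y \<in> cball 0 r \<Longrightarrow> z \<in> cball 0 r \<Longrightarrow> cmod (F x y z) \<le> B"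
  using assms unfolding geo_bound_def by blast+

lemma geo_approxE:
  assumes "geo_approx L P F" "0 < r" "r < L"
  obtains C \<rho> B where "geo_bound r P F C \<rho> B"
proof -
  obtain C \<rho> where \<rho>: "0 < \<rho>" "\<rho> < 1" and
    "\<forall>N. \<forall>x\<in>cball 0 r. \<forall>y\<in>cball 0 r. \<forall>z\<in>cball 0 r. cmod (P N x y z - F x y z) \<le> C * \<rho> ^ N"
    using assms(1)[unfolded geo_approx_def, THEN conjunct2, THEN spec, THEN mp, THEN mp, OF assms(2,3)]
    by (elim exE conjE)
  then have C: "cmod (P N x y z - F x y z) \<le> C * \<rho> ^ N"
    if "x \<in> cball 0 r" "y \<in> cball 0 r" "z \<in> cball 0 r" for N x y z
    using that by blast
  have C0: "0 \<le> C"
    using order_trans[OF norm_ge_zero C[of 0 0 0 0]] assms(2) by simp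
  let ?S = "cball 0 r \<times> cball 0 r \<times> cball (0::complex) r"
  \<comment> \<open>Compactness is used for the single polynomial \<open>P 0\<close>. The error at
    \<open>N = 0\<close> is at most \<open>C\<close>, so its bound passes to \<open>F\<close> at
    cost \<open>C\<close>, and from \<open>F\<close> to every \<open>P N\<close> at cost
    \<open>C\<close> again.\<close>
  obtain n where "poly3 n (P 0)" using geo_approx_poly3[OF assms(1)] by blast
  then have "bounded ((\<lambda>(x, y, z). P 0 x y z) ` ?S)"
    by (intro compact_imp_bounded compact_continuous_image poly3_continuous compact_Times compact_cball)
  then obtain B where "\<forall>w\<in>(\<lambda>(x, y, z). P 0 x y z) ` ?S. cmod w \<le> B"
    by (elim bounded_iff[THEN iffD1, elim_format] exE)
  then have B: "cmod (P 0 x y z) \<le> B" if "x \<in> cball 0 r" "y \<in> cball 0 r" "z \<in> cball 0 r" for x y z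
    using that by force
  have B0: "0 \<le> B"
    using order_trans[OF norm_ge_zero B[of 0 0 0]] assms(2) by simp
  have F: "cmod (F x y z) \<le> B + C" if "x \<in> cball 0 r" "y \<in> cball 0 r" "z \<in> cball 0 r" for x y z
    using norm_triangle_ineq4[of "P 0 x y z" "P 0 x y z - F x y z"] B[OF that] C[OF that, of 0] by simp
  have P: "cmod (P N x y z) \<le> B + C + C" if "x \<in> cball 0 r" "y \<in> cball 0 r" "z \<in> cball 0 r" for N x y z
  proof -
    have "C * \<rho> ^ N \<le> C * 1" using C0 \<rho> by (intro mult_left_mono power_le_one) auto
    then show ?thesis
      using norm_triangle_ineq[of "F x y z" "P N x y z - F x y z"] F[OF that] C[OF that, of N] by simp
  qed
  have "cmod (F x y z) \<le> B + C + C" if "x \<in> cball 0 r" "y \<in> cball 0 r" "z \<in> cball 0 r" for x y z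
    using F[OF that] C0 by simp
  then have "geo_bound r P F C \<rho> (B + C + C)"
    unfolding geo_bound_def using C0 B0 \<rho> P C by auto
  then show ?thesis by (rule that)
qed

lemma geo_approxI:
  assumes "poly3_seq P"
    and "\<And>r. 0 < r \<Longrightarrow> r < L \<Longrightarrow> \<exists>C \<rho>. 0 < \<rho> \<and> \<rho> < 1 \<and>
     (\<forall>N. \<forall>x\<in>cball 0 r. \<forall>y\<in>cball 0 r. \<forall>z\<in>cball 0 r. cmod (P N x y z - F x y z) \<le> C * \<rho> ^ N)"
  shows "geo_approx L P F"
  using assms unfolding geo_approx_def by blast

lemma geo_sum_bound:
  fixes C D \<rho> \<tau> :: real
  assumes "0 \<le> C" "0 \<le> D" "0 < \<rho>" "0 < \<tau>"
  shows "C * \<rho> ^ N + D * \<tau> ^ N \<le> (C + D) * max \<rho> \<tau> ^ N"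
proof -
  have "C * \<rho> ^ N \<le> C * max \<rho> \<tau> ^ N" "D * \<tau> ^ N \<le> D * max \<rho> \<tau> ^ N"
    using assms by (auto intro!: mult_left_mono power_mono)
  then show ?thesis by (simp add: distrib_right)
qed

lemma geo_approx_poly: "poly3 n F \<Longrightarrow> geo_approx L (\<lambda>N. F) F"
  by (intro geo_approxI poly3_seq_const) (auto intro!: exI[of _ 0] exI[of _ "1/2"])

lemma geo_approx_add:
  assumes P: "geo_approx L P F" and Q: "geo_approx L Q G"
  shows "geo_approx L (\<lambda>N x y z. P N x y z + Q N x y z) (\<lambda>x y z. F x y z + G x y z)"
proof (rule geo_approxI)
  show "poly3_seq (\<lambda>N x y z. P N x y z + Q N x y z)"
    using P Q by (intro poly3_seq_add geo_approx_poly3_seq)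
  fix r :: real assume r: "0 < r" "r < L"
  obtain C \<rho> B where b1: "geo_bound r P F C \<rho> B"
    by (rule geo_approxE[OF P r])
  note * = geo_boundD[OF b1]
  obtain D \<tau> B' where b2: "geo_bound r Q G D \<tau> B'"
    by (rule geo_approxE[OF Q r])
  note ** = geo_boundD[OF b2]
  have "cmod (P N x y z + Q N x y z - (F x y z + G x y z)) \<le> (C + D) * max \<rho> \<tau> ^ N"
    if "x \<in> cball 0 r" "y \<in> cball 0 r" "z \<in> cball 0 r" for N x y z
    using norm_diff_triangle_ineq[of "P N x y z" "Q N x y z" "F x y z" "G x y z"]
      *(5)[OF that, of N] **(5)[OF that, of N] geo_sum_bound[OF *(1) **(1) *(2) **(2), of N]
    by linarith
  then show "\<exists>C \<rho>. 0 < \<rho> \<and> \<rho> < 1 \<and> (\<forall>N. \<forall>x\<in>cball 0 r. \<forall>y\<in>cball 0 r. \<forall>z\<in>cball 0 r.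
      cmod (P N x y z + Q N x y z - (F x y z + G x y z)) \<le> C * \<rho> ^ N)"
    using *(1-4) **(1-4) by (intro exI[of _ "C + D"] exI[of _ "max \<rho> \<tau>"]) auto
qed

lemma geo_approx_mult:
  assumes P: "geo_approx L P F" and Q: "geo_approx L Q G"
  shows "geo_approx L (\<lambda>N x y z. P N x y z * Q N x y z) (\<lambda>x y z. F x y z * G x y z)"
proof (rule geo_approxI)
  show "poly3_seq (\<lambda>N x y z. P N x y z * Q N x y z)"
    using P Q by (intro poly3_seq_mult geo_approx_poly3_seq)
  fix r :: real assume r: "0 < r" "r < L"
  obtain C \<rho> B where b1: "geo_bound r P F C \<rho> B"
    by (rule geo_approxE[OF P r])
  note * = geo_boundD[OF b1]
  obtain D \<tau> B' where b2: "geo_bound r Q G D \<tau> B'"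
    by (rule geo_approxE[OF Q r])
  note ** = geo_boundD[OF b2]
  have "cmod (P N x y z * Q N x y z - F x y z * G x y z) \<le> (B' * C + B * D) * max \<rho> \<tau> ^ N"
    if "x \<in> cball 0 r" "y \<in> cball 0 r" "z \<in> cball 0 r" for N x y z
  proof -
    have "P N x y z * Q N x y z - F x y z * G x y z =
      G x y z * (P N x y z - F x y z) + P N x y z * (Q N x y z - G x y z)"
      by (simp add: algebra_simps)
    also have "cmod \<dots> \<le> B' * (C * \<rho> ^ N) + B * (D * \<tau> ^ N)"
      using *(5,6)[OF that, of N] **(5)[OF that, of N] **(7)[OF that] *(4) **(4)
      by (intro norm_triangle_le add_mono) (auto simp: norm_mult intro!: mult_mono)
    also have "\<dots> \<le> (B' * C + B * D) * max \<rho> \<tau> ^ N"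
      using geo_sum_bound[of "B' * C" "B * D" \<rho> \<tau> N] *(1-4) **(1-4) by (simp add: mult.assoc)
    finally show ?thesis .
  qed
  then show "\<exists>C \<rho>. 0 < \<rho> \<and> \<rho> < 1 \<and> (\<forall>N. \<forall>x\<in>cball 0 r. \<forall>y\<in>cball 0 r. \<forall>z\<in>cball 0 r.
      cmod (P N x y z * Q N x y z - F x y z * G x y z) \<le> C * \<rho> ^ N)"
    using *(1-4) **(1-4) by (intro exI[of _ "B' * C + B * D"] exI[of _ "max \<rho> \<tau>"]) auto
qed

lemma geo_approx_uminus: "geo_approx L P F \<Longrightarrow> geo_approx L (\<lambda>N x y z. - P N x y z) (\<lambda>x y z. - F x y z)"
  using geo_approx_mult[OF geo_approx_poly[OF poly3_const[of 0 "-1"]], of L P F] by simp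

lemma geo_approx_diff:
  "geo_approx L P F \<Longrightarrow> geo_approx L Q G \<Longrightarrow>
    geo_approx L (\<lambda>N x y z. P N x y z - Q N x y z) (\<lambda>x y z. F x y z - G x y z)"
  using geo_approx_add[OF _ geo_approx_uminus, of L P F Q G] by simp

text \<open>The substitutions map every closed polydisk about the origin into itself, so neither the
  radius nor the constants change.\<close>

lemma geo_approx_compose:
  assumes P: "geo_approx L P F" and s: "poly3 1 s1" "poly3 1 s2" "poly3 1 s3"
    and ball: "\<And>r x y z. x \<in> cball 0 r \<Longrightarrow> y \<in> cball 0 r \<Longrightarrow> z \<in> cball 0 r \<Longrightarrow>
      s1 x y z \<in> cball 0 r \<and> s2 x y z \<in> cball 0 r \<and> s3 x y z \<in> cball 0 r"
  shows "geo_approx L (\<lambda>N x y z. P N (s1 x y z) (s2 x y z) (s3 x y z))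
    (\<lambda>x y z. F (s1 x y z) (s2 x y z) (s3 x y z))"
proof (rule geo_approxI)
  show "poly3_seq (\<lambda>N x y z. P N (s1 x y z) (s2 x y z) (s3 x y z))"
    by (rule poly3_seq_compose[OF geo_approx_poly3_seq[OF P] s])
  fix r :: real assume r: "0 < r" "r < L"
  obtain C \<rho> B where b1: "geo_bound r P F C \<rho> B"
    by (rule geo_approxE[OF P r])
  note * = geo_boundD[OF b1]
  have "cmod (P N (s1 x y z) (s2 x y z) (s3 x y z) - F (s1 x y z) (s2 x y z) (s3 x y z)) \<le> C * \<rho> ^ N"
    if "x \<in> cball 0 r" "y \<in> cball 0 r" "z \<in> cball 0 r" for N x y z
    using ball[OF that] by (intro *(5)) auto
  then show "\<exists>C \<rho>. 0 < \<rho> \<and> \<rho> < 1 \<and> (\<forall>N. \<forall>x\<in>cball 0 r. \<forall>y\<in>cball 0 r. \<forall>z\<in>cball 0 r.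
      cmod (P N (s1 x y z) (s2 x y z) (s3 x y z) - F (s1 x y z) (s2 x y z) (s3 x y z)) \<le> C * \<rho> ^ N)"
    using *(2,3) by blast
qed

lemma geo_uniform_limit:
  fixes \<rho> :: real
  assumes "0 < \<rho>" "\<rho> < 1" "\<And>N x. x \<in> S \<Longrightarrow> norm (f N x - g x) \<le> C * \<rho> ^ N"
  shows "uniform_limit S f g sequentially"
proof (rule uniform_limitI)
  fix e :: real assume "0 < e"
  have "(\<lambda>N. C * \<rho> ^ N) \<longlonglongrightarrow> C * 0"
    using assms by (intro tendsto_intros LIMSEQ_power_zero) auto
  then have "\<forall>\<^sub>F N in sequentially. C * \<rho> ^ N < e"
    using \<open>0 < e\<close> order_tendstoD(2) by fastforce
  then show "\<forall>\<^sub>F N in sequentially. \<forall>x\<in>S. dist (f N x) (g x) < e"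
    by eventually_elim (simp add: dist_norm le_less_trans[OF assms(3)])
qed

lemma geo_approx_continuous:
  assumes P: "geo_approx L P F" and r: "0 < r" "r < L"
  shows "continuous_on (cball 0 r \<times> cball 0 r \<times> cball 0 r) (\<lambda>(x, y, z). F x y z)"
proof -
  let ?S = "cball 0 r \<times> cball 0 r \<times> cball (0::complex) r"
  obtain C \<rho> B where b1: "geo_bound r P F C \<rho> B"
    by (rule geo_approxE[OF P r])
  note * = geo_boundD[OF b1]
  have "uniform_limit ?S (\<lambda>N (x, y, z). P N x y z) (\<lambda>(x, y, z). F x y z) sequentially"
    by (rule geo_uniform_limit[OF *(2,3)]) (use *(5) in auto)
  moreover have "continuous_on ?S (\<lambda>(x, y, z). P N x y z)" for N
    using geo_approx_poly3[OF P] poly3_continuous by blast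
  ultimately show ?thesis
    by (intro uniform_limit_theorem[of _ "\<lambda>N (x, y, z). P N x y z" sequentially]) auto
qed

lemma geo_approx_continuous':
  assumes P: "geo_approx L P F" and r: "0 < r" "r < L"
    and "continuous_on S f" "continuous_on S g" "continuous_on S h"
    and "\<And>t. t \<in> S \<Longrightarrow> f t \<in> cball 0 r \<and> g t \<in> cball 0 r \<and> h t \<in> cball 0 r"
  shows "continuous_on S (\<lambda>t. F (f t) (g t) (h t))"
proof -
  have "continuous_on S (\<lambda>t. case (f t, g t, h t) of (x, y, z) \<Rightarrow> F x y z)"
    by (rule continuous_on_compose2[OF geo_approx_continuous[OF P r]])
      (use assms in \<open>auto intro!: continuous_intros\<close>)
  then show ?thesis by simp
qed

text \<open>Locally uniform limits of polynomials are holomorphic. Holomorphy in the other arguments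
  follows by permuting them with \<open>geo_approx_shift\<close>.\<close>

lemma geo_approx_holomorphic:
  assumes P: "geo_approx L P F" and yz: "y \<in> ball 0 L" "z \<in> ball 0 L"
  shows "(\<lambda>s. F s y z) holomorphic_on ball 0 L"
proof -
  have "(\<lambda>s. F s y z) field_differentiable at x" if x: "x \<in> ball 0 L" for x
  proof -
    obtain r where r: "cmod x < r" "cmod y < r" "cmod z < r" "r < L"
      using dense[of "Max {cmod x, cmod y, cmod z}" L] yz x by auto
    have r0: "0 < r" using r(1) by (meson le_less_trans norm_ge_zero)
    obtain C \<rho> B where b1: "geo_bound r P F C \<rho> B"
      by (rule geo_approxE[OF P r0 r(4)])
    note * = geo_boundD[OF b1]
    have lim: "uniform_limit (cball 0 r) (\<lambda>N s. P N s y z) (\<lambda>s. F s y z) sequentially"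
      by (rule geo_uniform_limit[OF *(2,3)], rule *(5)) (use r in auto)
    have P': "(\<lambda>s. P N s y z) holomorphic_on S" for N S
    proof -
      obtain n where "poly3 n (P N)" using geo_approx_poly3[OF P] by blast
      from poly3_differentiable1[OF this] show ?thesis
        by (simp add: holomorphic_on_def field_differentiable_at_within)
    qed
    then have ev: "\<forall>\<^sub>F N in sequentially. continuous_on (cball 0 r) (\<lambda>s. P N s y z) \<and>
        (\<lambda>s. P N s y z) holomorphic_on ball 0 r"
      by (intro always_eventually allI conjI holomorphic_on_imp_continuous_on)
    have "(\<lambda>s. F s y z) holomorphic_on ball 0 r"
      by (rule holomorphic_uniform_limit[OF ev lim trivial_limit_sequentially])
    then show ?thesis
      using r(1) by (simp add: holomorphic_on_imp_differentiable_at)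
  qed
  then show ?thesis
    by (simp add: field_differentiable_at_within holomorphic_on_def)
qed

lemma geo_approx_deriv:
  assumes P: "geo_approx L P F"
  shows "geo_approx L (\<lambda>N x y z. deriv (\<lambda>s. P N s y z) x) (\<lambda>x y z. deriv (\<lambda>s. F s y z) x)"
proof (rule geo_approxI)
  show "poly3_seq (\<lambda>N x y z. deriv (\<lambda>s. P N s y z) x)"
    using P by (intro poly3_seq_deriv geo_approx_poly3_seq)
  fix r :: real assume r: "0 < r" "r < L"
  \<comment> \<open>Cauchy's inequality on the disk of radius \<open>r' - r\<close> about
    \<open>x\<close>, which stays inside radius \<open>r'\<close>, costs the factor
    \<open>1 / (r' - r)\<close> and keeps the rate \<open>\<rho>\<close> of the larger
    radius.\<close>
  obtain r' where r': "r < r'" "r' < L" using r dense by blast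
  have "0 < r'" using r r' by simp
  then obtain C \<rho> B where b1: "geo_bound r' P F C \<rho> B"
    using r'(2) by (rule geo_approxE[OF P])
  note * = geo_boundD[OF b1]
  have "cmod (deriv (\<lambda>s. P N s y z) x - deriv (\<lambda>s. F s y z) x) \<le> (C / (r' - r)) * \<rho> ^ N"
    if xyz: "x \<in> cball 0 r" "y \<in> cball 0 r" "z \<in> cball 0 r" for N x y z
  proof -
    have sub: "cball x (r' - r) \<subseteq> cball 0 r'" "cball 0 r' \<subseteq> ball 0 L"
      using xyz(1) r r' by (auto simp: cball_subset_cball_iff cball_subset_ball_iff dist_norm)
    have yz: "y \<in> ball 0 L" "z \<in> ball 0 L" using xyz r by auto
    obtain n where n: "poly3 n (P N)" using geo_approx_poly3[OF P] by blast
    have Fd: "(\<lambda>s. F s y z) field_differentiable at x"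
      using geo_approx_holomorphic[OF P yz] xyz(1) r by (intro holomorphic_on_imp_differentiable_at) auto
    have Pd: "(\<lambda>s. P N s y z) field_differentiable at s" for s
      using poly3_differentiable1[OF n] .
    have hol: "(\<lambda>s. P N s y z - F s y z) holomorphic_on cball x (r' - r)"
      using holomorphic_on_subset[OF geo_approx_holomorphic[OF P yz] order_trans[OF sub]] Pd
      by (intro holomorphic_intros) (auto simp: holomorphic_on_def field_differentiable_at_within)
    have "cmod ((deriv ^^ 1) (\<lambda>s. P N s y z - F s y z) x) \<le> fact 1 * (C * \<rho> ^ N) / (r' - r) ^ 1"
    proof (rule Cauchy_inequality)
      show "(\<lambda>s. P N s y z - F s y z) holomorphic_on ball x (r' - r)"
        using hol ball_subset_cball holomorphic_on_subset by blast
      show "continuous_on (cball x (r' - r)) (\<lambda>s. P N s y z - F s y z)"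
        using hol holomorphic_on_imp_continuous_on by blast
      fix w assume "cmod (x - w) = r' - r"
      then have "w \<in> cball x (r' - r)" by (simp add: dist_norm)
      then show "cmod (P N w y z - F w y z) \<le> C * \<rho> ^ N"
        using sub(1) xyz r' by (intro *(5)) auto
    qed (use r' in auto)
    then show ?thesis using deriv_diff[OF Pd Fd] by simp
  qed
  then show "\<exists>C \<rho>. 0 < \<rho> \<and> \<rho> < 1 \<and> (\<forall>N. \<forall>x\<in>cball 0 r. \<forall>y\<in>cball 0 r. \<forall>z\<in>cball 0 r.
      cmod (deriv (\<lambda>s. P N s y z) x - deriv (\<lambda>s. F s y z) x) \<le> C * \<rho> ^ N)"
    using *(2,3) by blast
qed

text \<open>The argument patterns of the equations: parameters evaluated at
  \<open>(\<xi>, y)\<close>, \<open>(x, y)\<close> or \<open>\<xi>\<close> inside functions of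
  \<open>(x, \<xi>, y)\<close>, the diagonal of \<open>k\<close>, and values with first or second
  argument \<open>0\<close>. Exchanging the first and third argument serves to obtain holomorphy in
  the last one.\<close>

lemma geo_approx_shift:
  assumes "geo_approx L P F"
  shows "geo_approx L (\<lambda>N x y z. P N y z x) (\<lambda>x y z. F y z x)"
    and "geo_approx L (\<lambda>N x y z. P N x z y) (\<lambda>x y z. F x z y)"
    and "geo_approx L (\<lambda>N x y z. P N y x z) (\<lambda>x y z. F y x z)"
    and "geo_approx L (\<lambda>N x y z. P N z y x) (\<lambda>x y z. F z y x)"
    and "geo_approx L (\<lambda>N x y z. P N x x z) (\<lambda>x y z. F x x z)"
    and "geo_approx L (\<lambda>N x y z. P N x 0 z) (\<lambda>x y z. F x 0 z)"
    and "geo_approx L (\<lambda>N x y z. P N 0 y z) (\<lambda>x y z. F 0 y z)"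
proof -
  note v = poly3_vars and z = poly3_const[of 1 0]
  show "geo_approx L (\<lambda>N x y z. P N y z x) (\<lambda>x y z. F y z x)"
    by (rule geo_approx_compose[OF assms v(2,3,1)]) auto
  show "geo_approx L (\<lambda>N x y z. P N x z y) (\<lambda>x y z. F x z y)"
    by (rule geo_approx_compose[OF assms v(1,3,2)]) auto
  show "geo_approx L (\<lambda>N x y z. P N y x z) (\<lambda>x y z. F y x z)"
    by (rule geo_approx_compose[OF assms v(2,1,3)]) auto
  show "geo_approx L (\<lambda>N x y z. P N z y x) (\<lambda>x y z. F z y x)"
    by (rule geo_approx_compose[OF assms v(3,2,1)]) auto
  show "geo_approx L (\<lambda>N x y z. P N x x z) (\<lambda>x y z. F x x z)"
    by (rule geo_approx_compose[OF assms v(1,1,3)]) auto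
  show "geo_approx L (\<lambda>N x y z. P N x 0 z) (\<lambda>x y z. F x 0 z)"
    by (rule geo_approx_compose[OF assms v(1) z v(3)]) (auto intro: order_trans[OF norm_ge_zero])
  show "geo_approx L (\<lambda>N x y z. P N 0 y z) (\<lambda>x y z. F 0 y z)"
    by (rule geo_approx_compose[OF assms z v(2,3)]) (auto intro: order_trans[OF norm_ge_zero])
qed

lemma geo_approx_deriv2:
  assumes P: "geo_approx L P F"
  shows "geo_approx L (\<lambda>N x y z. deriv (\<lambda>s. P N x s z) y) (\<lambda>x y z. deriv (\<lambda>s. F x s z) y)"
  by (rule geo_approx_shift(3)[OF geo_approx_deriv[OF geo_approx_shift(3)[OF P]]])

lemma geo_approx_integral:
  assumes P: "geo_approx L P F" and Q: "geo_approx L Q G" and L: "L \<le> 0 \<or> 1 < L"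
  shows "geo_approx L
    (\<lambda>N x \<xi> y. integral {0..1} (\<lambda>\<eta>. P N \<xi> (complex_of_real \<eta>) y * Q N x \<xi> (complex_of_real \<eta>)))
    (\<lambda>x \<xi> y. integral {0..1} (\<lambda>\<eta>. F \<xi> (complex_of_real \<eta>) y * G x \<xi> (complex_of_real \<eta>)))"
proof (rule geo_approxI)
  show "poly3_seq (\<lambda>N x \<xi> y. integral {0..1} (\<lambda>\<eta>. P N \<xi> (complex_of_real \<eta>) y * Q N x \<xi> (complex_of_real \<eta>)))"
    using P Q by (intro poly3_seq_integral geo_approx_poly3_seq)
  fix s :: real assume s: "0 < s" "s < L"
  \<comment> \<open>The integration variable reaches modulus \<open>1\<close>, so the constants are
    taken at a radius of at least \<open>1\<close>. It lies below \<open>L\<close> if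
    \<open>1 < L\<close>; for \<open>L \<le> 0\<close> there is no radius \<open>s\<close> to
    consider.\<close>
  define r where "r = max s 1"
  have r: "0 < r" "r < L" "s \<le> r" "1 \<le> r" using s L by (auto simp: r_def)
  obtain C \<rho> B where b1: "geo_bound r P F C \<rho> B"
    by (rule geo_approxE[OF P r(1,2)])
  note * = geo_boundD[OF b1]
  obtain D \<tau> B' where b2: "geo_bound r Q G D \<tau> B'"
    by (rule geo_approxE[OF Q r(1,2)])
  note ** = geo_boundD[OF b2]
  have "cmod (integral {0..1} (\<lambda>\<eta>. P N \<xi> (complex_of_real \<eta>) y * Q N x \<xi> (complex_of_real \<eta>)) -
      integral {0..1} (\<lambda>\<eta>. F \<xi> (complex_of_real \<eta>) y * G x \<xi> (complex_of_real \<eta>)))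
      \<le> (B' * C + B * D) * max \<rho> \<tau> ^ N"
    if xyz: "x \<in> cball 0 s" "\<xi> \<in> cball 0 s" "y \<in> cball 0 s" for N x \<xi> y
  proof -
    have xyz: "x \<in> cball 0 r" "\<xi> \<in> cball 0 r" "y \<in> cball 0 r"
      using xyz r by auto
    have \<eta>: "complex_of_real \<eta> \<in> cball 0 r" if "\<eta> \<in> {0..1}" for \<eta>
      using that r by auto
    obtain n m where n: "poly3 n (P N)" "poly3 m (Q N)"
      using geo_approx_poly3[OF P] geo_approx_poly3[OF Q] by blast
    have cont1: "continuous_on {0..1} (\<lambda>\<eta>. P N \<xi> (complex_of_real \<eta>) y * Q N x \<xi> (complex_of_real \<eta>))"
      by (intro continuous_intros poly3_continuous'[OF n(1)] poly3_continuous'[OF n(2)])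
    have cont2: "continuous_on {0..1} (\<lambda>\<eta>. F \<xi> (complex_of_real \<eta>) y * G x \<xi> (complex_of_real \<eta>))"
      by (intro continuous_intros geo_approx_continuous'[OF P r(1,2)] geo_approx_continuous'[OF Q r(1,2)])
        (use xyz \<eta> in auto)
    have "cmod (integral {0..1} (\<lambda>\<eta>. P N \<xi> (complex_of_real \<eta>) y * Q N x \<xi> (complex_of_real \<eta>) -
      F \<xi> (complex_of_real \<eta>) y * G x \<xi> (complex_of_real \<eta>))) \<le> ((B' * C + B * D) * max \<rho> \<tau> ^ N) * (1 - 0)"
    proof (rule integral_bound)
      fix t :: real assume "t \<in> {0..1}"
      note t = \<eta>[OF this]
      define \<eta> where "\<eta> = complex_of_real t"
      have "P N \<xi> \<eta> y * Q N x \<xi> \<eta> - F \<xi> \<eta> y * G x \<xi> \<eta> =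
        G x \<xi> \<eta> * (P N \<xi> \<eta> y - F \<xi> \<eta> y) + P N \<xi> \<eta> y * (Q N x \<xi> \<eta> - G x \<xi> \<eta>)"
        by (simp add: algebra_simps)
      also have "cmod \<dots> \<le> B' * (C * \<rho> ^ N) + B * (D * \<tau> ^ N)"
        using *(5,6)[OF xyz(2) t xyz(3), of N] **(5)[OF xyz(1,2) t, of N] **(7)[OF xyz(1,2) t] *(4) **(4)
        by (intro norm_triangle_le add_mono) (auto simp: norm_mult \<eta>_def intro!: mult_mono)
      also have "\<dots> \<le> (B' * C + B * D) * max \<rho> \<tau> ^ N"
        using geo_sum_bound[of "B' * C" "B * D" \<rho> \<tau> N] *(1-4) **(1-4) by (simp add: mult.assoc)
      finally show "cmod (P N \<xi> (complex_of_real t) y * Q N x \<xi> (complex_of_real t) -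
        F \<xi> (complex_of_real t) y * G x \<xi> (complex_of_real t)) \<le> (B' * C + B * D) * max \<rho> \<tau> ^ N"
        by (simp add: \<eta>_def)
    qed (use cont1 cont2 in \<open>auto intro!: continuous_intros\<close>)
    then show ?thesis
      using integral_diff[OF integrable_continuous_real[OF cont1] integrable_continuous_real[OF cont2]]
      by simp
  qed
  then show "\<exists>C \<rho>. 0 < \<rho> \<and> \<rho> < 1 \<and> (\<forall>N. \<forall>x\<in>cball 0 s. \<forall>\<xi>\<in>cball 0 s. \<forall>y\<in>cball 0 s.
      cmod (integral {0..1} (\<lambda>\<eta>. P N \<xi> (complex_of_real \<eta>) y * Q N x \<xi> (complex_of_real \<eta>)) -
      integral {0..1} (\<lambda>\<eta>. F \<xi> (complex_of_real \<eta>) y * G x \<xi> (complex_of_real \<eta>))) \<le> C * \<rho> ^ N)"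
    using *(1-4) **(1-4) by (intro exI[of _ "B' * C + B * D"] exI[of _ "max \<rho> \<tau>"]) auto
qed

section \<open>Taylor expansion on polydisks\<close>

lemma higher_deriv_power_sums:
  assumes "0 < r" "\<And>y. y \<in> ball 0 r \<Longrightarrow> (\<lambda>n. g n * y ^ n) sums F y"
  shows "(deriv ^^ n) F 0 = fact n * (g n :: complex)"
proof -
  have "eventually (\<lambda>y. y \<in> ball 0 r) (nhds (0::complex))"
    using assms(1) by (intro eventually_nhds_in_open) auto
  then have "eventually (\<lambda>y. (\<lambda>n. fps_nth (Abs_fps g) n * y ^ n) sums F y) (nhds 0)"
    by eventually_elim (simp add: assms(2))
  then have "fps_nth (Abs_fps g) n = (deriv ^^ n) F 0 / fact n"
    by (intro fps_nth_fps_expansion has_fps_expansionI)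
  then show ?thesis by simp
qed

text \<open>The unordered sum over pairs \<open>(q, n)\<close> can be regrouped by \<open>n\<close>,
  which leaves a power series in one variable with coefficients
  \<open>\<Sum>\<^sub>\<infinity>q. h q n\<close>. The index \<open>q\<close> stands for the
  exponents of all other variables, so the same statement gives termwise differentiation for two and
  for three variables.\<close>

lemma power_series_family:
  fixes h :: "'q \<Rightarrow> nat \<Rightarrow> complex"
  assumes r: "0 < r" and S: "\<And>y. y \<in> ball b r \<Longrightarrow> ((\<lambda>(q, n). h q n * (y - b) ^ n) has_sum F y) UNIV"
  shows power_series_family_holomorphic: "F holomorphic_on ball b r"
    and power_series_family_summable: "(\<lambda>q. h q n) summable_on UNIV"
    and power_series_family_deriv: "b = 0 \<Longrightarrow> (deriv ^^ n) F 0 = fact n * (\<Sum>\<^sub>\<infinity>q. h q n)"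
proof -
  have swap: "((\<lambda>(n, q). h q n * (y - b) ^ n) has_sum F y) (UNIV \<times> UNIV)" if "y \<in> ball b r" for y
    using S[OF that] has_sum_swap[where f = "\<lambda>(q, n). h q n * (y - b) ^ n" and S = "F y" and A = UNIV and B = UNIV]
    by (simp add: case_prod_unfold)
  have summable: "(\<lambda>q. h q n) summable_on UNIV" for n
  proof -
    \<comment> \<open>At this point \<open>y - b\<close> is nonzero, so its power can be divided out
      of the summable family.\<close>
    have "b + of_real (r / 2) \<in> ball b r" using r by (simp add: dist_norm)
    then have "(\<lambda>(n, q). h q n * (of_real (r / 2)) ^ n) summable_on (UNIV \<times> UNIV)"
      using swap has_sum_imp_summable by fastforce
    then have "(\<lambda>q. h q n * (of_real (r / 2)) ^ n) summable_on UNIV"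
      by (rule summable_on_SigmaD1) simp
    then show ?thesis
      using r summable_on_cmult_left'[of "complex_of_real (r / 2) ^ n" "\<lambda>q. h q n" UNIV] by simp
  qed
  then show "(\<lambda>q. h q n) summable_on UNIV" .
  have sums: "(\<lambda>n. (\<Sum>\<^sub>\<infinity>q. h q n) * (y - b) ^ n) sums F y" if "y \<in> ball b r" for y
  proof -
    have "((\<lambda>q. h q n * (y - b) ^ n) has_sum (\<Sum>\<^sub>\<infinity>q. h q n) * (y - b) ^ n) UNIV" for n
      using summable by (intro has_sum_cmult_left has_sum_infsum)
    then have "((\<lambda>n. (\<Sum>\<^sub>\<infinity>q. h q n) * (y - b) ^ n) has_sum F y) UNIV"
      by (intro has_sum_SigmaD[OF swap[OF that]]) simp
    then show ?thesis by (rule has_sum_imp_sums)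
  qed
  then show "F holomorphic_on ball b r"
    by (rule power_series_holomorphic)
  show "(deriv ^^ n) F 0 = fact n * (\<Sum>\<^sub>\<infinity>q. h q n)" if "b = 0"
    using sums that by (intro higher_deriv_power_sums[OF r]) auto
qed

lemma holomorphic_on_local:
  assumes "\<And>b. b \<in> S \<Longrightarrow> \<exists>r>0. F holomorphic_on ball b r"
  shows "F holomorphic_on S"
  unfolding holomorphic_on_def
proof
  fix b assume "b \<in> S"
  then obtain r where "0 < r" "F holomorphic_on ball b r" using assms by blast
  then have "F field_differentiable at b"
    by (intro holomorphic_on_imp_differentiable_at[of _ "ball b r"]) auto
  then show "F field_differentiable at b within S"
    by (rule field_differentiable_at_within)
qed

lemma analytic2_onE:
  assumes "analytic2_on f S" "(a, b) \<in> S"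
  obtains r c where "r > 0" "\<And>x y. x \<in> ball a r \<Longrightarrow> y \<in> ball b r \<Longrightarrow>
    ((\<lambda>(m, n). c m n * (x - a) ^ m * (y - b) ^ n) has_sum f x y) UNIV"
  using assms unfolding analytic2_on_def by fast

lemma analytic3_onE:
  assumes "analytic3_on f S" "(a, b, d) \<in> S"
  obtains r c where "r > 0" "\<And>x y z. x \<in> ball a r \<Longrightarrow> y \<in> ball b r \<Longrightarrow> z \<in> ball d r \<Longrightarrow>
    ((\<lambda>(m, n, p). c m n p * (x - a) ^ m * (y - b) ^ n * (z - d) ^ p) has_sum f x y z) UNIV"
  using assms unfolding analytic3_on_def by fast

lemma analytic2_on_holomorphic:
  assumes "analytic2_on f (A \<times> B)" "x \<in> A"
  shows "f x holomorphic_on B"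
proof (rule holomorphic_on_local)
  fix b assume "b \<in> B"
  then obtain r c where r: "r > 0" and c: "\<And>x' y. x' \<in> ball x r \<Longrightarrow> y \<in> ball b r \<Longrightarrow>
      ((\<lambda>(m, n). c m n * (x' - x) ^ m * (y - b) ^ n) has_sum f x' y) UNIV"
    using analytic2_onE[OF assms(1), of x b] assms(2) by blast
  have "f x holomorphic_on ball b r"
    by (rule power_series_family_holomorphic[where h = "\<lambda>m n. c m n * (x - x) ^ m", OF r c])
      (use r in auto)
  then show "\<exists>r>0. f x holomorphic_on ball b r" using r by blast
qed

text \<open>Expanding around \<open>(a, 0)\<close> and differentiating termwise in the second
  variable leaves a power series in \<open>x - a\<close>. The outer derivatives in
  \<open>taylor2\<close> are thus derivatives of a holomorphic function.\<close>

lemma analytic2_on_holomorphic_higher_deriv: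
  assumes "analytic2_on f (A \<times> B)" "0 \<in> B"
  shows "(\<lambda>x. (deriv ^^ n) (f x) 0) holomorphic_on A"
proof (rule holomorphic_on_local)
  fix a assume "a \<in> A"
  then obtain r c where r: "r > 0" and c: "\<And>x y. x \<in> ball a r \<Longrightarrow> y \<in> ball 0 r \<Longrightarrow>
      ((\<lambda>(m, n). c m n * (x - a) ^ m * (y - 0) ^ n) has_sum f x y) UNIV"
    using analytic2_onE[OF assms(1), of a 0] assms(2) by blast
  have "(\<lambda>m. (fact n * c m n) * (x - a) ^ m) sums (deriv ^^ n) (f x) 0" if x: "x \<in> ball a r" for x
  proof -
    have "((\<lambda>m. fact n * (c m n * (x - a) ^ m)) has_sum fact n * (\<Sum>\<^sub>\<infinity>m. c m n * (x - a) ^ m)) UNIV"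
      by (intro has_sum_cmult_right has_sum_infsum power_series_family_summable[OF r c[OF x]])
    moreover have "(deriv ^^ n) (f x) 0 = fact n * (\<Sum>\<^sub>\<infinity>m. c m n * (x - a) ^ m)"
      by (rule power_series_family_deriv[OF r c[OF x] refl])
    ultimately show ?thesis
      by (simp add: mult.assoc has_sum_imp_sums)
  qed
  then have "(\<lambda>x. (deriv ^^ n) (f x) 0) holomorphic_on ball a r"
    by (rule power_series_holomorphic)
  then show "\<exists>r>0. (\<lambda>x. (deriv ^^ n) (f x) 0) holomorphic_on ball a r"
    using r by blast
qed

lemma has_sum_assoc:
  "((\<lambda>(q, p). case q of (m, n) \<Rightarrow> t m n p) has_sum s) UNIV \<longleftrightarrow> ((\<lambda>(m, n, p). t m n p) has_sum s) UNIV"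
  by (rule has_sum_reindex_bij_witness[of _ "\<lambda>(m, n, p). ((m, n), p)" "\<lambda>((m, n), p). (m, n, p)"]) auto

lemma analytic3_on_holomorphic:
  assumes "analytic3_on f (A \<times> B \<times> D)" "x \<in> A" "y \<in> B"
  shows "f x y holomorphic_on D"
proof (rule holomorphic_on_local)
  fix d assume "d \<in> D"
  then obtain r c where r: "r > 0" and c: "\<And>x' y' z. x' \<in> ball x r \<Longrightarrow> y' \<in> ball y r \<Longrightarrow> z \<in> ball d r \<Longrightarrow>
      ((\<lambda>(m, n, p). c m n p * (x' - x) ^ m * (y' - y) ^ n * (z - d) ^ p) has_sum f x' y' z) UNIV"
    using analytic3_onE[OF assms(1), of x y d] assms(2,3) by blast
  have "((\<lambda>(q, p). (case q of (m, n) \<Rightarrow> c m n p * (x - x) ^ m * (y - y) ^ n) * (z - d) ^ p) has_sum f x y z) UNIV"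
    if "z \<in> ball d r" for z
    using c[of x y z] r that
      has_sum_assoc[of "\<lambda>m n p. c m n p * (x - x) ^ m * (y - y) ^ n * (z - d) ^ p" "f x y z"]
    by (simp add: case_prod_unfold)
  then have "f x y holomorphic_on ball d r"
    by (rule power_series_family_holomorphic[OF r])
  then show "\<exists>r>0. f x y holomorphic_on ball d r" using r by blast
qed

text \<open>Through this, \<open>taylor3\<close> becomes \<open>taylor2\<close> of the
  \<open>p\<close>-th derivative in the last argument, and three variables are reduced to
  two.\<close>

lemma analytic3_on_analytic2_higher_deriv:
  assumes "analytic3_on f (A \<times> B \<times> D)" "0 \<in> D"
  shows "analytic2_on (\<lambda>x y. (deriv ^^ p) (f x y) 0) (A \<times> B)"
  unfolding analytic2_on_def
proof (safe)
  fix a b assume "a \<in> A" "b \<in> B"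
  then obtain r c where r: "r > 0" and c: "\<And>x y z. x \<in> ball a r \<Longrightarrow> y \<in> ball b r \<Longrightarrow> z \<in> ball 0 r \<Longrightarrow>
      ((\<lambda>(m, n, p). c m n p * (x - a) ^ m * (y - b) ^ n * (z - 0) ^ p) has_sum f x y z) UNIV"
    using analytic3_onE[OF assms(1), of a b 0] assms(2) by blast
  have "((\<lambda>(m, n). fact p * c m n p * (x - a) ^ m * (y - b) ^ n) has_sum (deriv ^^ p) (f x y) 0) UNIV"
    if x: "x \<in> ball a r" and y: "y \<in> ball b r" for x y
  proof -
    let ?h = "\<lambda>q p. case q of (m, n) \<Rightarrow> c m n p * (x - a) ^ m * (y - b) ^ n"
    have c': "((\<lambda>(q, p). ?h q p * (z - 0) ^ p) has_sum f x y z) UNIV" if "z \<in> ball 0 r" for z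
      using c[OF x y that]
        has_sum_assoc[of "\<lambda>m n p. c m n p * (x - a) ^ m * (y - b) ^ n * z ^ p" "f x y z"]
      by (simp add: case_prod_unfold)
    have "((\<lambda>q. fact p * ?h q p) has_sum fact p * (\<Sum>\<^sub>\<infinity>q. ?h q p)) UNIV"
      by (intro has_sum_cmult_right has_sum_infsum power_series_family_summable[OF r c'])
    moreover have "(deriv ^^ p) (f x y) 0 = fact p * (\<Sum>\<^sub>\<infinity>q. ?h q p)"
      by (rule power_series_family_deriv[OF r c' refl])
    ultimately show ?thesis
      by (simp add: case_prod_unfold mult.assoc)
  qed
  then show "\<exists>r>0. \<exists>c. \<forall>x\<in>ball a r. \<forall>y\<in>ball b r.
      ((\<lambda>(m, n). c m n * (x - a) ^ m * (y - b) ^ n) has_sum (deriv ^^ p) (f x y) 0) UNIV"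
    using r by (intro exI[of _ r] conjI exI[of _ "\<lambda>m n. fact p * c m n p"] ballI)
qed

section \<open>Cauchy estimates and the global Taylor series\<close>

lemma bounded_image_local:
  assumes "compact S" "\<And>p. p \<in> S \<Longrightarrow> \<exists>U. open U \<and> p \<in> U \<and> bounded (f ` (U \<inter> S))"
  shows "bounded (f ` S)"
proof -
  let ?T = "{U. open U \<and> bounded (f ` (U \<inter> S))}"
  have "S \<subseteq> \<Union>?T" using assms(2) by auto
  then obtain T where T: "T \<subseteq> ?T" "finite T" "S \<subseteq> \<Union>T"
    using compactE[OF assms(1), of ?T] by blast
  then have "f ` S \<subseteq> (\<Union>U\<in>T. f ` (U \<inter> S))" by blast
  moreover have "bounded (\<Union>U\<in>T. f ` (U \<inter> S))" using T by (intro bounded_UN) auto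
  ultimately show ?thesis by (rule bounded_subset[rotated])
qed

lemma has_sum_norm_le:
  fixes f :: "'a \<Rightarrow> complex"
  assumes "(f has_sum F) A" "g summable_on A" "\<And>x. x \<in> A \<Longrightarrow> cmod (f x) \<le> g x"
  shows "cmod F \<le> (\<Sum>\<^sub>\<infinity>x\<in>A. g x)"
proof -
  have f: "(\<lambda>x. cmod (f x)) summable_on A"
    using assms(1) has_sum_imp_summable summable_on_iff_abs_summable_on_complex by blast
  have "cmod F = cmod (infsum f A)" using assms(1) by (simp add: infsumI)
  also have "\<dots> \<le> (\<Sum>\<^sub>\<infinity>x\<in>A. cmod (f x))" by (rule norm_infsum_bound[OF f])
  also have "\<dots> \<le> (\<Sum>\<^sub>\<infinity>x\<in>A. g x)" by (rule infsum_mono[OF f assms(2,3)])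
  finally show ?thesis .
qed

lemma has_sum_imp_norm_summable:
  fixes f :: "'a \<Rightarrow> complex"
  shows "(f has_sum F) A \<Longrightarrow> (\<lambda>x. cmod (f x)) summable_on A"
  using has_sum_imp_summable summable_on_iff_abs_summable_on_complex by blast

text \<open>For offsets of modulus at most \<open>r / 2\<close> the local series is dominated
  termwise by its absolutely convergent value at offset \<open>r / 2\<close>. Compactness combines
  the local bounds.\<close>

lemma analytic2_on_bounded:
  assumes "analytic2_on f (A \<times> B)" "compact S" "S \<subseteq> A \<times> B"
  shows "bounded ((\<lambda>(x, y). f x y) ` S)"
proof (rule bounded_image_local[OF assms(2)], clarify)
  fix a b assume "(a, b) \<in> S"
  then obtain r c where r: "r > 0" and c: "\<And>x y. x \<in> ball a r \<Longrightarrow> y \<in> ball b r \<Longrightarrow>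
      ((\<lambda>(m, n). c m n * (x - a) ^ m * (y - b) ^ n) has_sum f x y) UNIV"
    using analytic2_onE[OF assms(1), of a b] assms(3) by blast
  let ?s = "complex_of_real (r / 2)"
  let ?U = "ball a (r / 2) \<times> ball b (r / 2)"
  have s: "a + ?s \<in> ball a r" "b + ?s \<in> ball b r" using r by (auto simp: dist_norm)
  define M where "M = (\<Sum>\<^sub>\<infinity>(m, n). cmod (c m n * ?s ^ m * ?s ^ n))"
  have "cmod (f x y) \<le> M"
    if "(x, y) \<in> ?U" for x y
  proof -
    have xy: "x \<in> ball a r" "y \<in> ball b r" "cmod (x - a) \<le> r / 2" "cmod (y - b) \<le> r / 2"
      using that r by (auto simp: dist_norm norm_minus_commute)
    have "cmod (f x y) \<le> (\<Sum>\<^sub>\<infinity>p. cmod (case p of (m, n) \<Rightarrow> c m n * (a + ?s - a) ^ m * (b + ?s - b) ^ n))"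
      by (rule has_sum_norm_le[OF c[OF xy(1,2)] has_sum_imp_norm_summable[OF c[OF s]]])
        (use xy r in \<open>auto simp: norm_mult norm_power mult.assoc intro!: mult_left_mono mult_mono power_mono\<close>)
    then show ?thesis by (simp add: M_def case_prod_unfold)
  qed
  then have "bounded ((\<lambda>(x, y). f x y) ` (?U \<inter> S))"
    by (auto intro!: boundedI[where B = M])
  then show "\<exists>U. open U \<and> (a, b) \<in> U \<and> bounded ((\<lambda>(x, y). f x y) ` (U \<inter> S))"
    using r by (intro exI[of _ ?U]) (auto intro!: open_Times)
qed

lemma analytic3_on_bounded:
  assumes "analytic3_on f (A \<times> B \<times> D)" "compact S" "S \<subseteq> A \<times> B \<times> D"
  shows "bounded ((\<lambda>(x, y, z). f x y z) ` S)"
proof (rule bounded_image_local[OF assms(2)], clarify)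
  fix a b d assume "(a, b, d) \<in> S"
  then obtain r c where r: "r > 0" and c: "\<And>x y z. x \<in> ball a r \<Longrightarrow> y \<in> ball b r \<Longrightarrow> z \<in> ball d r \<Longrightarrow>
      ((\<lambda>(m, n, p). c m n p * (x - a) ^ m * (y - b) ^ n * (z - d) ^ p) has_sum f x y z) UNIV"
    using analytic3_onE[OF assms(1), of a b d] assms(3) by blast
  let ?s = "complex_of_real (r / 2)"
  let ?U = "ball a (r / 2) \<times> ball b (r / 2) \<times> ball d (r / 2)"
  have s: "a + ?s \<in> ball a r" "b + ?s \<in> ball b r" "d + ?s \<in> ball d r" using r by (auto simp: dist_norm)
  define M where "M = (\<Sum>\<^sub>\<infinity>(m, n, p). cmod (c m n p * ?s ^ m * ?s ^ n * ?s ^ p))"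
  have "cmod (f x y z) \<le> M"
    if "(x, y, z) \<in> ?U" for x y z
  proof -
    have xy: "x \<in> ball a r" "y \<in> ball b r" "z \<in> ball d r"
      "cmod (x - a) \<le> r / 2" "cmod (y - b) \<le> r / 2" "cmod (z - d) \<le> r / 2"
      using that r by (auto simp: dist_norm norm_minus_commute)
    have "cmod (f x y z) \<le> (\<Sum>\<^sub>\<infinity>q. cmod (case q of (m, n, p) \<Rightarrow>
        c m n p * (a + ?s - a) ^ m * (b + ?s - b) ^ n * (d + ?s - d) ^ p))"
      by (rule has_sum_norm_le[OF c[OF xy(1-3)] has_sum_imp_norm_summable[OF c[OF s]]])
        (use xy r in \<open>auto simp: norm_mult norm_power mult.assoc intro!: mult_left_mono mult_mono power_mono\<close>)
    then show ?thesis by (simp add: M_def case_prod_unfold)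
  qed
  then have "bounded ((\<lambda>(x, y, z). f x y z) ` (?U \<inter> S))"
    by (auto intro!: boundedI[where B = M])
  then show "\<exists>U. open U \<and> (a, b, d) \<in> U \<and> bounded ((\<lambda>(x, y, z). f x y z) ` (U \<inter> S))"
    using r by (intro exI[of _ ?U]) (auto intro!: open_Times)
qed

lemma higher_deriv_bound:
  assumes "F holomorphic_on ball 0 L" "0 < r" "r < L" "\<And>y. y \<in> cball 0 r \<Longrightarrow> cmod (F y) \<le> B"
  shows "cmod ((deriv ^^ n) F 0) \<le> fact n * B / r ^ n"
proof (rule Cauchy_inequality)
  show "F holomorphic_on ball 0 r" "continuous_on (cball 0 r) F"
    using assms by (auto intro!: holomorphic_on_imp_continuous_on elim!: holomorphic_on_subset)
  show "cmod (F x) \<le> B" if "cmod (0 - x) = r" for x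
    using that by (intro assms(4)) auto
qed fact

text \<open>Cauchy's inequality in \<open>y\<close> for fixed \<open>x\<close>, followed by Cauchy's
  inequality in \<open>x\<close> for the holomorphic function of \<open>x\<close> so
  obtained.\<close>

lemma taylor2_bound:
  assumes f: "analytic2_on f (ball 0 L \<times> ball 0 L)" and r: "0 < r" "r < L"
    and B: "\<And>x y. x \<in> cball 0 r \<Longrightarrow> y \<in> cball 0 r \<Longrightarrow> cmod (f x y) \<le> B"
  shows "cmod (taylor2 f m n) \<le> B / r ^ (m + n)"
proof -
  have "cmod ((deriv ^^ m) (\<lambda>x. (deriv ^^ n) (f x) 0) 0) \<le> fact m * (fact n * B / r ^ n) / r ^ m"
  proof (rule higher_deriv_bound[OF _ r])
    show "(\<lambda>x. (deriv ^^ n) (f x) 0) holomorphic_on ball 0 L"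
      using r by (intro analytic2_on_holomorphic_higher_deriv[OF f]) auto
    show "cmod ((deriv ^^ n) (f x) 0) \<le> fact n * B / r ^ n" if x: "x \<in> cball 0 r" for x
      using x r by (intro higher_deriv_bound[OF analytic2_on_holomorphic[OF f] r B[OF x]]) auto
  qed
  then show ?thesis
    by (simp add: taylor2_def norm_divide norm_mult power_add field_simps)
qed

lemma sums_imp_has_sum:
  fixes f :: "nat \<Rightarrow> complex"
  assumes "f summable_on UNIV" "f sums s"
  shows "(f has_sum s) UNIV"
  using assms has_sum_infsum has_sum_imp_sums sums_unique2 by metis

text \<open>Domination shows that a double series is summable but not what its value is. The value
  is that of the iterated sum, which one-variable Taylor expansions compute.\<close>

lemma has_sum_iterated_sums:
  fixes f :: "nat \<Rightarrow> 'q \<Rightarrow> complex"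
  assumes "(\<lambda>(n, q). f n q) summable_on UNIV" "\<And>n. (f n has_sum g n) UNIV" "g sums s"
  shows "((\<lambda>(n, q). f n q) has_sum s) UNIV"
proof -
  have "((\<lambda>(n, q). f n q) has_sum infsum (\<lambda>(n, q). f n q) UNIV) (UNIV \<times> UNIV)"
    using assms(1) by simp
  then have "(g has_sum infsum (\<lambda>(n, q). f n q) UNIV) UNIV"
    by (rule has_sum_SigmaD) (use assms(2) in auto)
  then have "s = infsum (\<lambda>(n, q). f n q) UNIV"
    using assms(3) has_sum_imp_sums sums_unique2 by blast
  then show ?thesis using assms(1) by simp
qed

lemma summable_on_times_nonneg:
  fixes f :: "'a \<Rightarrow> real" and g :: "'b \<Rightarrow> real"
  assumes "f summable_on A" "g summable_on B" "\<And>x. x \<in> A \<Longrightarrow> 0 \<le> f x" "\<And>y. y \<in> B \<Longrightarrow> 0 \<le> g y"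
  shows "(\<lambda>(x, y). f x * g y) summable_on A \<times> B"
proof (rule summable_on_SigmaI)
  show "((\<lambda>y. case (x, y) of (x, y) \<Rightarrow> f x * g y) has_sum f x * infsum g B) B" for x
    using assms(2) by (auto intro: has_sum_cmult_right)
  show "(\<lambda>x. f x * infsum g B) summable_on A"
    by (rule summable_on_cmult_left) (fact assms(1))
qed (use assms in auto)

lemma summable_on_geometric: "0 \<le> a \<Longrightarrow> a < 1 \<Longrightarrow> (\<lambda>n. (a::real) ^ n) summable_on UNIV"
  using norm_summable_imp_has_sum[OF _ geometric_sums[of a]] summable_geometric[of a]
  by (auto simp: summable_on_def)

text \<open>Analyticity supplies a separate local series around each point, whereas the algorithm
  uses the one at the origin. That series represents \<open>f\<close> on the whole polydisk: Cauchy
  bounds dominate it by a double geometric series, and expanding in \<open>y\<close> first and each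
  coefficient in \<open>x\<close> afterwards identifies its value.\<close>

lemma taylor2_has_sum:
  assumes f: "analytic2_on f (ball 0 L \<times> ball 0 L)" and xy: "x \<in> ball 0 L" "y \<in> ball 0 L"
  shows "((\<lambda>(m, n). taylor2 f m n * x ^ m * y ^ n) has_sum f x y) UNIV"
proof -
  obtain r where r: "cmod x < r" "cmod y < r" "r < L"
    using dense[of "max (cmod x) (cmod y)" L] xy by auto
  have r0: "0 < r" using r(1) by (meson le_less_trans norm_ge_zero)
  have "bounded ((\<lambda>(x, y). f x y) ` (cball 0 r \<times> cball 0 r))"
    using r by (intro analytic2_on_bounded[OF f] compact_Times) auto
  then obtain B where B: "\<And>x y. x \<in> cball 0 r \<Longrightarrow> y \<in> cball 0 r \<Longrightarrow> cmod (f x y) \<le> B"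
    unfolding bounded_iff by fastforce
  let ?t = "\<lambda>n m. taylor2 f m n * x ^ m * y ^ n"
  have summable: "(\<lambda>(n, m). ?t n m) summable_on UNIV \<times> UNIV"
  proof (rule abs_summable_summable, rule Infinite_Sum.abs_summable_on_comparison_test')
    have "(\<lambda>(n, m). (cmod y / r) ^ n * (cmod x / r) ^ m) summable_on UNIV \<times> UNIV"
      using r r0 by (intro summable_on_times_nonneg summable_on_geometric) auto
    then show "(\<lambda>p. B * (case p of (n, m) \<Rightarrow> (cmod y / r) ^ n * (cmod x / r) ^ m)) summable_on UNIV \<times> UNIV"
      by (rule summable_on_cmult_right)
    fix p :: "nat \<times> nat"
    obtain n m where p: "p = (n, m)" by (cases p)
    have "cmod (?t n m) \<le> B / r ^ (m + n) * cmod x ^ m * cmod y ^ n"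
      unfolding norm_mult norm_power using taylor2_bound[OF f r0 r(3) B, of m n]
      by (intro mult_right_mono) auto
    also have "\<dots> = B * ((cmod y / r) ^ n * (cmod x / r) ^ m)"
      by (simp add: power_add power_divide mult_ac)
    finally show "cmod (case p of (n, m) \<Rightarrow> ?t n m) \<le> B * (case p of (n, m) \<Rightarrow> (cmod y / r) ^ n * (cmod x / r) ^ m)"
      by (simp add: p)
  qed
  have "((\<lambda>(n, m). ?t n m) has_sum f x y) UNIV"
  proof (rule has_sum_iterated_sums)
    show "(?t n has_sum (deriv ^^ n) (f x) 0 / fact n * y ^ n) UNIV" for n
    proof (rule sums_imp_has_sum)
      show "?t n summable_on UNIV"
        by (rule summable_on_SigmaD1[OF summable]) simp
      have "(\<lambda>m. (deriv ^^ m) (\<lambda>x. (deriv ^^ n) (f x) 0) 0 / fact m * (x - 0) ^ m) sums (deriv ^^ n) (f x) 0"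
        using r0 r by (intro holomorphic_power_series[OF analytic2_on_holomorphic_higher_deriv[OF f] xy(1)]) auto
      then have "(\<lambda>m. (y ^ n / fact n) * ((deriv ^^ m) (\<lambda>x. (deriv ^^ n) (f x) 0) 0 / fact m * x ^ m))
        sums ((y ^ n / fact n) * (deriv ^^ n) (f x) 0)"
        by (intro sums_mult) simp
      then show "?t n sums ((deriv ^^ n) (f x) 0 / fact n * y ^ n)"
        by (simp add: taylor2_def field_simps)
    qed
    show "(\<lambda>n. (deriv ^^ n) (f x) 0 / fact n * y ^ n) sums f x y"
      using holomorphic_power_series[OF analytic2_on_holomorphic[OF f xy(1)] xy(2)] by simp
  qed (use summable in simp)
  then show ?thesis
    using has_sum_swap[where f = "\<lambda>(n, m). ?t n m" and A = UNIV and B = UNIV] by simp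
qed

text \<open>For each power \<open>p\<close> of \<open>z\<close> the inner double series is that of
  the \<open>p\<close>-th derivative in \<open>z\<close>. The index of \<open>z\<close> is placed
  outermost, as in \<open>tpoly3\<close>.\<close>

lemma taylor3_has_sum:
  assumes f: "analytic3_on f (ball 0 L \<times> ball 0 L \<times> ball 0 L)"
    and xyz: "x \<in> ball 0 L" "y \<in> ball 0 L" "z \<in> ball 0 L"
  shows "((\<lambda>(p, m, n). taylor3 f m n p * x ^ m * y ^ n * z ^ p) has_sum f x y z) UNIV"
proof -
  obtain r where r: "cmod x < r" "cmod y < r" "cmod z < r" "r < L"
    using dense[of "Max {cmod x, cmod y, cmod z}" L] xyz by auto
  have r0: "0 < r" using r(1) by (meson le_less_trans norm_ge_zero)
  have "bounded ((\<lambda>(x, y, z). f x y z) ` (cball 0 r \<times> cball 0 r \<times> cball 0 r))"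
    using r by (intro analytic3_on_bounded[OF f] compact_Times) auto
  then obtain B where "\<forall>w\<in>(\<lambda>(x, y, z). f x y z) ` (cball 0 r \<times> cball 0 r \<times> cball 0 r). cmod w \<le> B"
    unfolding bounded_iff ..
  then have B: "cmod (f x y z) \<le> B" if "x \<in> cball 0 r" "y \<in> cball 0 r" "z \<in> cball 0 r" for x y z
    using that by force
  let ?H = "\<lambda>p x y. (deriv ^^ p) (f x y) 0"
  have H: "analytic2_on (?H p) (ball 0 L \<times> ball 0 L)" for p
    using r0 r by (intro analytic3_on_analytic2_higher_deriv[OF f]) auto
  have T: "taylor3 f m n p = taylor2 (?H p) m n / fact p" for m n p
    by (simp add: taylor3_def taylor2_def)
  have bound: "cmod (taylor3 f m n p) \<le> B / r ^ p / r ^ (m + n)" for m n p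
  proof -
    have "cmod (?H p x y) \<le> fact p * B / r ^ p" if "x \<in> cball 0 r" "y \<in> cball 0 r" for x y
      using that r by (intro higher_deriv_bound[OF analytic3_on_holomorphic[OF f] r0 r(4)] B) auto
    from taylor2_bound[OF H r0 r(4) this, of m n] show ?thesis
      unfolding T by (simp add: norm_divide field_simps)
  qed
  let ?t = "\<lambda>p q. case q of (m, n) \<Rightarrow> taylor3 f m n p * x ^ m * y ^ n * z ^ p"
  have summable: "(\<lambda>(p, q). ?t p q) summable_on UNIV \<times> UNIV"
  proof (rule abs_summable_summable, rule Infinite_Sum.abs_summable_on_comparison_test')
    have "(\<lambda>(m, n). (cmod x / r) ^ m * (cmod y / r) ^ n) summable_on UNIV \<times> UNIV"
      using r r0 by (intro summable_on_times_nonneg summable_on_geometric) auto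
    then have "(\<lambda>(p, q). (cmod z / r) ^ p * (case q of (m, n) \<Rightarrow> (cmod x / r) ^ m * (cmod y / r) ^ n))
        summable_on UNIV \<times> (UNIV \<times> UNIV)"
      using r r0 by (intro summable_on_times_nonneg summable_on_geometric) auto
    then show "(\<lambda>w. B * (case w of (p, q) \<Rightarrow>
        (cmod z / r) ^ p * (case q of (m, n) \<Rightarrow> (cmod x / r) ^ m * (cmod y / r) ^ n))) summable_on UNIV \<times> UNIV"
      by (intro summable_on_cmult_right) simp
    fix w :: "nat \<times> nat \<times> nat"
    obtain p m n where w: "w = (p, m, n)" by (cases w)
    have "cmod (?t p (m, n)) \<le> B / r ^ p / r ^ (m + n) * cmod x ^ m * cmod y ^ n * cmod z ^ p"
      unfolding norm_mult norm_power prod.case using bound[of m n p]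
      by (intro mult_right_mono) auto
    also have "\<dots> = B * ((cmod z / r) ^ p * ((cmod x / r) ^ m * (cmod y / r) ^ n))"
      by (simp add: power_add power_divide mult_ac)
    finally show "cmod (case w of (p, q) \<Rightarrow> ?t p q) \<le> B * (case w of (p, q) \<Rightarrow>
        (cmod z / r) ^ p * (case q of (m, n) \<Rightarrow> (cmod x / r) ^ m * (cmod y / r) ^ n))"
      by (simp add: w)
  qed
  have "((\<lambda>(p, q). ?t p q) has_sum f x y z) UNIV"
  proof (rule has_sum_iterated_sums)
    show "(?t p has_sum z ^ p / fact p * ?H p x y) UNIV" for p
    proof -
      have "((\<lambda>q. z ^ p / fact p * (case q of (m, n) \<Rightarrow> taylor2 (?H p) m n * x ^ m * y ^ n)) has_sum
        z ^ p / fact p * ?H p x y) UNIV"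
        by (intro has_sum_cmult_right taylor2_has_sum[OF H xyz(1,2)])
      then show ?thesis by (simp add: T case_prod_unfold field_simps)
    qed
    show "(\<lambda>p. z ^ p / fact p * ?H p x y) sums f x y z"
      using holomorphic_power_series[OF analytic3_on_holomorphic[OF f xyz(1,2)] xyz(3)]
      by (simp add: field_simps)
  qed (use summable in simp)
  then show ?thesis by simp
qed

section \<open>Zeros on the real interval and real Taylor coefficients\<close>

lemma holomorphic_zero_on_reals:
  assumes F: "F holomorphic_on ball 0 L" and L: "1 < L"
    and inf: "infinite {t \<in> {0..1}. F (complex_of_real t) = 0}" and z: "z \<in> ball 0 L"
  shows "F z = 0"
proof -
  let ?U = "complex_of_real ` {t \<in> {0..1}. F (complex_of_real t) = 0}"
  \<comment> \<open>An infinite subset of the compact interval accumulates in it, and the interval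
    lies inside the disk because \<open>1 < L\<close>. Asking for infinitely many zeros rather than
    a full interval of them makes room for the almost-everywhere condition (B1).\<close>
  have "compact (complex_of_real ` {0..1})"
    by (intro compact_continuous_image continuous_intros compact_Icc)
  moreover have "infinite ?U"
    using inf by (simp add: finite_image_iff inj_on_def)
  moreover have "?U \<subseteq> complex_of_real ` {0..1}" by blast
  ultimately have "\<exists>w\<in>complex_of_real ` {0..1}. w islimpt ?U"
    by (rule Heine_Borel_imp_Bolzano_Weierstrass)
  then obtain w where w: "w \<in> complex_of_real ` {0..1}" "w islimpt ?U" ..
  show ?thesis
    by (rule analytic_continuation[OF F _ _ _ _ w(2) _ z]) (use L w(1) in auto)
qed

lemma fact_in_Reals [simp]: "(fact n :: complex) \<in> \<real>"
  by (metis Reals_of_nat of_nat_fact)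

text \<open>Reflection: \<open>cnj (F (cnj z))\<close> is holomorphic with conjugated Taylor
  coefficients and agrees with \<open>F\<close> on \<open>{0..1}\<close>, hence on the whole disk.
  This is what makes truncations of \<open>\<mu>\<close> and \<open>\<Lambda>\<close> real at real
  arguments.\<close>

lemma higher_deriv_real:
  assumes F: "F holomorphic_on ball 0 L" and L: "1 < L"
    and real: "\<And>t. t \<in> {0..1} \<Longrightarrow> F (complex_of_real t) \<in> \<real>"
  shows "(deriv ^^ n) F 0 \<in> \<real>"
proof -
  define a where "a n = (deriv ^^ n) F 0 / fact n" for n
  have a: "(\<lambda>n. a n * z ^ n) sums F z" if "z \<in> ball 0 L" for z
    using holomorphic_power_series[OF F that] by (simp add: a_def)
  have cnj: "(\<lambda>n. cnj (a n) * z ^ n) sums cnj (F (cnj z))" if "z \<in> ball 0 L" for z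
  proof -
    have "(\<lambda>n. a n * cnj z ^ n) sums F (cnj z)" using that by (intro a) simp
    then show ?thesis by (subst (asm) sums_cnj[symmetric]) simp
  qed
  have "(\<lambda>z. cnj (F (cnj z))) holomorphic_on ball 0 L"
    by (rule power_series_holomorphic) (use cnj in simp)
  then have hol: "(\<lambda>z. F z - cnj (F (cnj z))) holomorphic_on ball 0 L"
    using F by (intro holomorphic_intros)
  have "{t \<in> {0..1}. F (complex_of_real t) - cnj (F (cnj (complex_of_real t))) = 0} = {0..1}"
    using real by (auto simp: Reals_cnj_iff)
  then have eq: "F z - cnj (F (cnj z)) = 0" if "z \<in> ball 0 L" for z
    by (intro holomorphic_zero_on_reals[OF hol L _ that]) simp
  have "(\<lambda>n. cnj (a n) * z ^ n) sums F z" if "z \<in> ball 0 L" for z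
    using cnj[OF that] eq[OF that] by simp
  with L have "(deriv ^^ n) F 0 = fact n * cnj (a n)"
    by (intro higher_deriv_power_sums[where r = L]) (simp, blast)
  then have "a n = cnj (a n)" by (simp add: a_def)
  then have "a n \<in> \<real>" by (simp add: Reals_cnj_iff)
  then have "fact n * a n \<in> \<real>" by (intro Reals_mult) auto
  then show ?thesis by (simp add: a_def)
qed

lemma taylor2_real:
  assumes f: "analytic2_on f (ball 0 L \<times> ball 0 L)" and L: "1 < L"
    and real: "\<And>s t. s \<in> {0..1} \<Longrightarrow> t \<in> {0..1} \<Longrightarrow> f (complex_of_real s) (complex_of_real t) \<in> \<real>"
  shows "taylor2 f m n \<in> \<real>"
proof -
  have "(deriv ^^ n) (f (complex_of_real s)) 0 \<in> \<real>" if "s \<in> {0..1}" for s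
    using that L by (intro higher_deriv_real[OF analytic2_on_holomorphic[OF f] L real]) auto
  then have "(deriv ^^ m) (\<lambda>x. (deriv ^^ n) (f x) 0) 0 \<in> \<real>"
    using L by (intro higher_deriv_real[OF analytic2_on_holomorphic_higher_deriv[OF f] L]) auto
  then show ?thesis
    unfolding taylor2_def by (intro Reals_divide Reals_mult) auto
qed

lemma taylor1_real:
  assumes "f holomorphic_on ball 0 L" "1 < L" "\<And>t. t \<in> {0..1} \<Longrightarrow> f (complex_of_real t) \<in> \<real>"
  shows "taylor1 f m \<in> \<real>"
  unfolding taylor1_def by (intro Reals_divide higher_deriv_real[OF assms(1,2)] assms(3)) auto

section \<open>Truncation errors of power series\<close>

lemma has_sum_tail_bound:
  fixes t :: "'q \<Rightarrow> complex" and r R :: real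
  assumes r: "0 < r" "r < R" and F: "(t has_sum F) I"
    and c: "(\<lambda>q. c q * R ^ deg q) summable_on I"
    and t: "\<And>q. q \<in> I \<Longrightarrow> cmod (t q) \<le> c q * r ^ deg q"
    and fin: "finite {q \<in> I. deg q \<le> N}"
  shows "cmod ((\<Sum>q\<in>{q \<in> I. deg q \<le> N}. t q) - F) \<le> (\<Sum>\<^sub>\<infinity>q\<in>I. c q * R ^ deg q) * (r / R) ^ N"
proof -
  let ?J = "{q \<in> I. deg q \<le> N}"
  \<comment> \<open>The partial sum is extended by zero to all of \<open>I\<close>, so that the full
    family can be subtracted termwise.\<close>
  let ?u = "\<lambda>q. if q \<in> ?J then t q else 0"
  have "(?u has_sum sum t ?J) I"
    using has_sum_finite[OF fin, of t] by (subst has_sum_cong_neutral[where T = ?J and g = t]) auto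
  moreover have "((\<lambda>q. - t q) has_sum - F) I"
    using F by (simp add: has_sum_uminus)
  ultimately have "((\<lambda>q. ?u q + - t q) has_sum (sum t ?J + - F)) I"
    by (rule has_sum_add)
  then have "((\<lambda>q. ?u q - t q) has_sum (sum t ?J - F)) I" by simp
  moreover have "(\<lambda>q. (c q * R ^ deg q) * (r / R) ^ N) summable_on I"
    by (rule summable_on_cmult_left[OF c])
  moreover have "cmod (?u q - t q) \<le> (c q * R ^ deg q) * (r / R) ^ N" if q: "q \<in> I" for q
  proof -
    have c0: "0 \<le> c q"
      using order_trans[OF norm_ge_zero t[OF q]] zero_less_power[OF r(1), of "deg q"] by (auto simp: zero_le_mult_iff)
    show ?thesis
    proof (cases "deg q \<le> N")
      case False
      \<comment> \<open>Discarded terms have degree above \<open>N\<close>, and passing from radius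
        \<open>R\<close> down to \<open>r\<close> gains \<open>(r / R) ^ deg q\<close>, which is at
        most \<open>(r / R) ^ N\<close>.\<close>
      have "cmod (?u q - t q) \<le> c q * r ^ deg q"
        using t[OF q] False by simp
      also have "\<dots> = (c q * R ^ deg q) * (r / R) ^ deg q"
        using r by (simp add: power_divide)
      also have "\<dots> \<le> (c q * R ^ deg q) * (r / R) ^ N"
        using False r c0 by (intro mult_left_mono power_decreasing) auto
      finally show ?thesis .
    qed (use q r c0 in auto)
  qed
  ultimately have "cmod (sum t ?J - F) \<le> (\<Sum>\<^sub>\<infinity>q\<in>I. (c q * R ^ deg q) * (r / R) ^ N)"
    by (rule has_sum_norm_le)
  also have "\<dots> = (\<Sum>\<^sub>\<infinity>q\<in>I. c q * R ^ deg q) * (r / R) ^ N"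
    by (rule infsum_cmult_left) (rule c)
  finally show ?thesis .
qed

lemma poly3_tpoly3: "poly3 (1 * Suc N) (tpoly3 N K)"
proof -
  have "poly3 N (\<lambda>x y z. \<Sum>l\<le>N. \<Sum>i\<le>N - l. \<Sum>j\<le>i. K i j l * x ^ (i - j) * y ^ j * z ^ l)"
    by (intro poly3_sum poly3_monom) auto
  then show ?thesis
    unfolding tpoly3_def by (rule poly3_mono) simp
qed

lemma poly3_tpoly2: "poly3 (1 * Suc N) (\<lambda>x y z. tpoly2 N C x y)"
proof -
  have "poly3 N (\<lambda>x y z. \<Sum>i\<le>N. \<Sum>j\<le>i. C i j * x ^ (i - j) * y ^ j * z ^ 0)"
    by (intro poly3_sum poly3_monom) auto
  then have "poly3 N (\<lambda>x y z. tpoly2 N C x y)" by (simp add: tpoly2_def)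
  then show ?thesis by (rule poly3_mono) simp
qed

lemma poly3_tpoly1: "poly3 (1 * Suc N) (\<lambda>x y z. tpoly1 N C x)"
proof -
  have "poly3 N (\<lambda>x y z. \<Sum>i\<le>N. C i * x ^ i * y ^ 0 * z ^ 0)"
    by (intro poly3_sum poly3_monom) auto
  then have "poly3 N (\<lambda>x y z. tpoly1 N C x)" by (simp add: tpoly1_def)
  then show ?thesis by (rule poly3_mono) simp
qed

text \<open>The monomial of index \<open>(l, i, j)\<close> has total degree \<open>l + i\<close>,
  and \<open>tpoly3\<close> keeps exactly the total degrees up to \<open>N\<close>. The summable
  weights of the tail bound come from absolute convergence at the point
  \<open>(R, R, R)\<close>.\<close>

lemma geo_approx_tpoly3:
  assumes k: "\<And>x \<xi> y. x \<in> ball 0 L \<Longrightarrow> \<xi> \<in> ball 0 L \<Longrightarrow> y \<in> ball 0 L \<Longrightarrow>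
    ((\<lambda>(l, i, j). K i j l * x ^ (i - j) * \<xi> ^ j * y ^ l) has_sum k x \<xi> y) {(l, i, j). j \<le> i}"
  shows "geo_approx L (\<lambda>N. tpoly3 N K) k"
proof (rule geo_approxI)
  show "poly3_seq (\<lambda>N. tpoly3 N K)"
    by (rule poly3_seqI, rule poly3_tpoly3)
  fix r :: real assume r: "0 < r" "r < L"
  then obtain R where R: "r < R" "R < L" using dense by blast
  have R0: "complex_of_real R \<in> ball 0 L" using r R by simp
  let ?I = "{(l, i, j). j \<le> (i::nat)} :: (nat \<times> nat \<times> nat) set"
  let ?deg = "\<lambda>(l, i, j :: nat). l + i :: nat"
  let ?c = "\<lambda>(l, i, j). cmod (K i j l)"
  have "(\<lambda>q. cmod (case q of (l, i, j) \<Rightarrow> K i j l * of_real R ^ (i - j) * of_real R ^ j * of_real R ^ l)) summable_on ?I"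
    by (rule has_sum_imp_norm_summable[OF k[OF R0 R0 R0]])
  also have "?this \<longleftrightarrow> (\<lambda>q. ?c q * R ^ ?deg q) summable_on ?I"
    using r R by (intro summable_on_cong)
      (auto simp: norm_mult norm_power mult.assoc power_add[symmetric] add.commute)
  finally have c: "(\<lambda>q. ?c q * R ^ ?deg q) summable_on ?I" .
  have sum: "tpoly3 N K x y z = (\<Sum>q\<in>{q \<in> ?I. ?deg q \<le> N}. case q of (l, i, j) \<Rightarrow> K i j l * x ^ (i - j) * y ^ j * z ^ l)" for N x y z
  proof -
    have "{q \<in> ?I. ?deg q \<le> N} = (SIGMA l:{..N}. SIGMA i:{..N - l}. {..i})" by auto
    then show ?thesis by (simp add: tpoly3_def sum.Sigma)
  qed
  have "cmod (tpoly3 N K x y z - k x y z) \<le> (\<Sum>\<^sub>\<infinity>q\<in>?I. ?c q * R ^ ?deg q) * (r / R) ^ N"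
    if xyz: "x \<in> cball 0 r" "y \<in> cball 0 r" "z \<in> cball 0 r" for N x y z
    unfolding sum
  proof (rule has_sum_tail_bound[OF r(1) R(1) _ c])
    show "((\<lambda>(l, i, j). K i j l * x ^ (i - j) * y ^ j * z ^ l) has_sum k x y z) ?I"
      using xyz r by (intro k) auto
    show "finite {q \<in> ?I. ?deg q \<le> N}"
      by (rule finite_subset[of _ "{..N} \<times> {..N} \<times> {..N}"]) auto
    fix q assume "q \<in> ?I"
    then obtain l i j where q: "q = (l, i, j)" "j \<le> i" by auto
    have "cmod (K i j l * x ^ (i - j) * y ^ j * z ^ l) \<le> cmod (K i j l) * r ^ (i - j) * r ^ j * r ^ l"
      unfolding norm_mult norm_power using xyz r by (intro mult_mono power_mono order_refl) auto
    also have "\<dots> = cmod (K i j l) * r ^ (l + i)"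
      using q(2) by (simp add: mult.assoc power_add[symmetric] add.commute)
    finally show "cmod (case q of (l, i, j) \<Rightarrow> K i j l * x ^ (i - j) * y ^ j * z ^ l) \<le> ?c q * r ^ ?deg q"
      by (simp add: q)
  qed
  then show "\<exists>C \<rho>. 0 < \<rho> \<and> \<rho> < 1 \<and> (\<forall>N. \<forall>x\<in>cball 0 r. \<forall>y\<in>cball 0 r. \<forall>z\<in>cball 0 r.
      cmod (tpoly3 N K x y z - k x y z) \<le> C * \<rho> ^ N)"
    using r R by (intro exI[of _ "\<Sum>\<^sub>\<infinity>q\<in>?I. ?c q * R ^ ?deg q"] exI[of _ "r / R"]) auto
qed

text \<open>Embedding the array with zeros for \<open>l \<noteq> 0\<close> makes this an instance of
  the case of three variables.\<close>

lemma geo_approx_tpoly2: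
  assumes f: "\<And>x \<xi>. x \<in> ball 0 L \<Longrightarrow> \<xi> \<in> ball 0 L \<Longrightarrow>
    ((\<lambda>(i, j). C i j * x ^ (i - j) * \<xi> ^ j) has_sum f x \<xi>) {(i, j). j \<le> i}"
  shows "geo_approx L (\<lambda>N x y z. tpoly2 N C x y) (\<lambda>x y z. f x y)"
proof -
  let ?K = "\<lambda>i j l. if l = 0 then C i j else 0"
  have "((\<lambda>(l, i, j). ?K i j l * x ^ (i - j) * y ^ j * z ^ l) has_sum f x y) {(l, i, j). j \<le> i}"
    if "x \<in> ball 0 L" "y \<in> ball 0 L" for x y z
  proof -
    have "((\<lambda>(l :: nat, i, j). C i j * x ^ (i - j) * y ^ j) has_sum f x y) {(l, i, j). l = 0 \<and> j \<le> i}"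
      using f[OF that] by (subst has_sum_reindex_bij_witness[where i = "\<lambda>(i, j). (0, i, j)" and j = snd
          and T = "{(i, j). j \<le> i}" and h = "\<lambda>(i, j). C i j * x ^ (i - j) * y ^ j"]) auto
    then show ?thesis
      by (subst has_sum_cong_neutral[where T = "{(l, i, j). l = 0 \<and> j \<le> i}"
            and g = "\<lambda>(l, i, j). C i j * x ^ (i - j) * y ^ j"]) (auto split: if_splits)
  qed
  then have "geo_approx L (\<lambda>N. tpoly3 N ?K) (\<lambda>x y z. f x y)"
    by (intro geo_approx_tpoly3)
  moreover have "tpoly3 N ?K x y z = tpoly2 N C x y" for N x y z
  proof -
    have "tpoly3 N ?K x y z = (\<Sum>l\<le>N. if l = 0 then tpoly2 N C x y else 0)"
      unfolding tpoly3_def tpoly2_def by (intro sum.cong) auto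
    then show ?thesis by simp
  qed
  then have "(\<lambda>N. tpoly3 N ?K) = (\<lambda>N x y z. tpoly2 N C x y)" by (intro ext)
  ultimately show ?thesis by simp
qed

lemma geo_approx_tpoly1:
  assumes f: "\<And>x. x \<in> ball 0 L \<Longrightarrow> ((\<lambda>i. C i * x ^ i) has_sum f x) UNIV"
  shows "geo_approx L (\<lambda>N x y z. tpoly1 N C x) (\<lambda>x y z. f x)"
proof -
  let ?K = "\<lambda>i j. if j = 0 then C i else 0"
  have "((\<lambda>(i, j). ?K i j * x ^ (i - j) * y ^ j) has_sum f x) {(i, j). j \<le> i}"
    if "x \<in> ball 0 L" for x y
  proof -
    have "((\<lambda>(i, j :: nat). C i * x ^ i) has_sum f x) {(i, j). j = 0}"
      using f[OF that] by (subst has_sum_reindex_bij_witness[where i = "\<lambda>i. (i, 0)" and j = fst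
          and T = UNIV and h = "\<lambda>i. C i * x ^ i"]) auto
    then show ?thesis
      by (subst has_sum_cong_neutral[where T = "{(i, j). j = 0}" and g = "\<lambda>(i, j). C i * x ^ i"]) (auto split: if_splits)
  qed
  then have "geo_approx L (\<lambda>N x y z. tpoly2 N ?K x y) (\<lambda>x y z. f x)"
    by (intro geo_approx_tpoly2)
  moreover have "tpoly2 N ?K x y = tpoly1 N C x" for N x y
  proof -
    have "(\<Sum>j\<le>i. ?K i j * x ^ (i - j) * y ^ j) = C i * x ^ i" for i
    proof -
      have "(\<Sum>j\<le>i. ?K i j * x ^ (i - j) * y ^ j) = (\<Sum>j\<le>i. if j = 0 then C i * x ^ i else 0)"
        by (intro sum.cong) auto
      then show ?thesis by simp
    qed
    then show ?thesis unfolding tpoly2_def tpoly1_def by simp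
  qed
  ultimately show ?thesis by simp
qed

lemma geo_approx_trunc1:
  assumes f: "f holomorphic_on ball 0 L"
  shows "geo_approx L (\<lambda>N x y z. trunc1 N f x) (\<lambda>x y z. f x)"
  unfolding trunc1_def
proof (rule geo_approx_tpoly1)
  have sums: "(\<lambda>i. taylor1 f i * x ^ i) sums f x" if "x \<in> ball 0 L" for x
    using holomorphic_power_series[OF f that] by (simp add: taylor1_def)
  fix x :: complex assume x: "x \<in> ball 0 L"
  then obtain r where r: "cmod x < r" "r < L" using dense by auto
  have "0 < r" using r(1) by (meson le_less_trans norm_ge_zero)
  then have r': "complex_of_real r \<in> ball 0 L" using r(2) by simp
  then have "summable (\<lambda>i. cmod (taylor1 f i * x ^ i))"
    using \<open>0 < r\<close> r(1) by (intro powser_insidea[OF sums_summable[OF sums[OF r']]]) auto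
  then show "((\<lambda>i. taylor1 f i * x ^ i) has_sum f x) UNIV"
    using sums[OF x] by (rule norm_summable_imp_has_sum)
qed

lemma geo_approx_trunc2:
  assumes f: "analytic2_on f (ball 0 L \<times> ball 0 L)"
  shows "geo_approx L (\<lambda>N x y z. trunc2 N f x y) (\<lambda>x y z. f x y)"
  unfolding trunc2_def
proof (rule geo_approx_tpoly2)
  fix x y :: complex assume xy: "x \<in> ball 0 L" "y \<in> ball 0 L"
  show "((\<lambda>(i, j). taylor2 f (i - j) j * x ^ (i - j) * y ^ j) has_sum f x y) {(i, j). j \<le> i}"
    using taylor2_has_sum[OF f xy]
    by (subst has_sum_reindex_bij_witness[where i = "\<lambda>(m, n). (m + n, n)" and j = "\<lambda>(i, j). (i - j, j)"
        and T = UNIV and h = "\<lambda>(m, n). taylor2 f m n * x ^ m * y ^ n"]) auto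
qed

lemma geo_approx_trunc3:
  assumes f: "analytic3_on f (ball 0 L \<times> ball 0 L \<times> ball 0 L)"
  shows "geo_approx L (\<lambda>N. trunc3 N f) f"
  unfolding trunc3_def
proof (rule geo_approx_tpoly3)
  fix x y z :: complex assume xyz: "x \<in> ball 0 L" "y \<in> ball 0 L" "z \<in> ball 0 L"
  show "((\<lambda>(l, i, j). taylor3 f (i - j) j l * x ^ (i - j) * y ^ j * z ^ l) has_sum f x y z) {(l, i, j). j \<le> i}"
    using taylor3_has_sum[OF f xyz]
    by (subst has_sum_reindex_bij_witness[where i = "\<lambda>(l, m, n). (l, m + n, n)" and j = "\<lambda>(l, i, j). (l, i - j, j)"
        and T = UNIV and h = "\<lambda>(l, m, n). taylor3 f m n l * x ^ m * y ^ n * z ^ l"]) auto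
qed

lemma trunc1_real: "(\<And>m. taylor1 f m \<in> \<real>) \<Longrightarrow> x \<in> \<real> \<Longrightarrow> trunc1 N f x \<in> \<real>"
  unfolding trunc1_def tpoly1_def by (intro sum_in_Reals Reals_mult Reals_power) auto

lemma trunc2_real: "(\<And>m n. taylor2 f m n \<in> \<real>) \<Longrightarrow> x \<in> \<real> \<Longrightarrow> y \<in> \<real> \<Longrightarrow> trunc2 N f x y \<in> \<real>"
  unfolding trunc2_def tpoly2_def by (intro sum_in_Reals Reals_mult Reals_power) auto

section \<open>Coefficient norms\<close>

lemma polyfun_coeff_bound:
  assumes r: "0 < r" and S: "\<And>x. x \<in> cball 0 r \<Longrightarrow> cmod (\<Sum>a\<le>n. p a * x ^ a) \<le> S" and "a \<le> n"
  shows "cmod (p a) \<le> S / r ^ a"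
proof -
  let ?F = "\<lambda>x. \<Sum>a\<le>n. p a * x ^ a"
  have "(\<lambda>i. (if i \<le> n then p i else 0) * x ^ i) sums ?F x" for x
    using sums_finite[of "{..n}" "\<lambda>i. (if i \<le> n then p i else 0) * x ^ i"] by simp
  then have "(deriv ^^ a) ?F 0 = fact a * (if a \<le> n then p a else 0)"
    by (rule higher_deriv_power_sums[OF r])
  moreover have "cmod ((deriv ^^ a) ?F 0) \<le> fact a * S / r ^ a"
    using r by (intro higher_deriv_bound[of _ "r + 1"] S) (auto intro!: holomorphic_intros)
  ultimately have "fact a * cmod (p a) \<le> fact a * (S / r ^ a)"
    using \<open>a \<le> n\<close> by (simp add: norm_mult)
  then show ?thesis by (subst (asm) mult_le_cancel_left_pos) auto
qed

text \<open>One variable is peeled off at a time: the coefficient of \<open>x ^ a\<close> is a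
  polynomial in \<open>y\<close> and \<open>z\<close> that inherits the bound divided by
  \<open>r ^ a\<close>, and likewise inwards.\<close>

lemma poly3_coeff_bound:
  assumes F: "poly3 n F" and r: "0 < r"
    and S: "\<And>x y z. x \<in> cball 0 r \<Longrightarrow> y \<in> cball 0 r \<Longrightarrow> z \<in> cball 0 r \<Longrightarrow> cmod (F x y z) \<le> S"
  shows "cmod (poly_coeffs F (a, b, d)) \<le> S / r ^ (a + b + d)"
proof (cases "(a, b, d) \<in> {..n} \<times> {..n} \<times> {..n}")
  case False
  then have "poly_coeffs F (a, b, d) = 0" using poly3_coeffs(1)[OF F] by blast
  moreover have "0 \<le> S" using order_trans[OF norm_ge_zero S[of 0 0 0]] r by simp
  ultimately show ?thesis using r by simp
next
  case True
  let ?c = "poly_coeffs F"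
  have F': "F x y z = (\<Sum>a\<le>n. (\<Sum>b\<le>n. (\<Sum>d\<le>n. ?c (a, b, d) * z ^ d) * y ^ b) * x ^ a)" for x y z
  proof -
    have "F x y z = (\<Sum>(a, b, d)\<in>{..n} \<times> {..n} \<times> {..n}. ?c (a, b, d) * x ^ a * y ^ b * z ^ d)"
      by (rule poly3_coeffs(2)[OF F])
    also have "\<dots> = (\<Sum>a\<le>n. \<Sum>b\<le>n. \<Sum>d\<le>n. ?c (a, b, d) * x ^ a * y ^ b * z ^ d)"
      by (simp only: sum.cartesian_product)
    also have "\<dots> = (\<Sum>a\<le>n. (\<Sum>b\<le>n. (\<Sum>d\<le>n. ?c (a, b, d) * z ^ d) * y ^ b) * x ^ a)"
      unfolding sum_distrib_right by (simp add: mult_ac)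
    finally show ?thesis .
  qed
  have 1: "cmod (\<Sum>b\<le>n. (\<Sum>d\<le>n. ?c (a, b, d) * z ^ d) * y ^ b) \<le> S / r ^ a"
    if "y \<in> cball 0 r" "z \<in> cball 0 r" for y z
  proof (rule polyfun_coeff_bound[OF r])
    show "cmod (\<Sum>a\<le>n. (\<Sum>b\<le>n. (\<Sum>d\<le>n. ?c (a, b, d) * z ^ d) * y ^ b) * x ^ a) \<le> S"
      if "x \<in> cball 0 r" for x
      by (subst F'[symmetric]) (intro S that \<open>y \<in> cball 0 r\<close> \<open>z \<in> cball 0 r\<close>)
  qed (use True in auto)
  have 2: "cmod (\<Sum>d\<le>n. ?c (a, b, d) * z ^ d) \<le> S / r ^ a / r ^ b" if "z \<in> cball 0 r" for z
    by (rule polyfun_coeff_bound[OF r], erule 1[OF _ that]) (use True in auto)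
  have "cmod (?c (a, b, d)) \<le> S / r ^ a / r ^ b / r ^ d"
    by (rule polyfun_coeff_bound[OF r], erule 2) (use True in auto)
  then show ?thesis by (simp add: power_add)
qed

lemma coeff_norm_sq_nonneg: "0 \<le> coeff_norm_sq F"
  unfolding coeff_norm_sq_def by (intro sum_nonneg) auto

lemma coeff_norm_sq_box:
  assumes "poly3 n F"
  shows "coeff_norm_sq F = (\<Sum>m\<in>{..n} \<times> {..n} \<times> {..n}. (cmod (poly_coeffs F m))\<^sup>2)"
  unfolding coeff_norm_sq_def using poly3_coeffs(1)[OF assms]
  by (intro sum.mono_neutral_left) auto

lemma geometric_partial_sum_le:
  fixes q :: real
  assumes "0 \<le> q" "q < 1"
  shows "(\<Sum>a\<le>n. q ^ a) \<le> 1 / (1 - q)"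
  using sum_le_suminf[OF summable_geometric, of q "{..n}"] suminf_geometric[of q] assms by simp

text \<open>The sum of squares is dominated by a triple geometric series of ratio
  \<open>1 / r\<^sup>2\<close>, which converges because \<open>1 < r\<close>. The bound is free of
  the degree \<open>n\<close>, so small values on a polydisk of radius above one give small
  coefficient norms at every order.\<close>

lemma coeff_norm_sq_le:
  assumes F: "poly3 n F" and r: "1 < r"
    and S: "\<And>x y z. x \<in> cball 0 r \<Longrightarrow> y \<in> cball 0 r \<Longrightarrow> z \<in> cball 0 r \<Longrightarrow> cmod (F x y z) \<le> S"
  shows "coeff_norm_sq F \<le> S\<^sup>2 * (1 / (1 - 1 / r\<^sup>2)) ^ 3"
proof -
  define q where "q = 1 / r\<^sup>2"
  have q: "0 \<le> q" "q < 1" using r by (auto simp: q_def power_less_one_iff one_less_power)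
  let ?s = "\<Sum>a\<le>n. q ^ a"
  have s: "0 \<le> ?s" "?s \<le> 1 / (1 - q)"
    using q geometric_partial_sum_le by (auto intro: sum_nonneg)
  have "coeff_norm_sq F \<le> (\<Sum>(a, b, d)\<in>{..n} \<times> {..n} \<times> {..n}. S\<^sup>2 * (q ^ a * (q ^ b * q ^ d)))"
    unfolding coeff_norm_sq_box[OF F]
  proof (rule sum_mono)
    fix m assume "m \<in> {..n} \<times> {..n} \<times> {..n}"
    obtain a b d where m: "m = (a, b, d)" by (cases m)
    have "(cmod (poly_coeffs F (a, b, d)))\<^sup>2 \<le> (S / r ^ (a + b + d))\<^sup>2"
      using r by (intro power_mono poly3_coeff_bound[OF F _ S]) auto
    also have "\<dots> = S\<^sup>2 * (q ^ a * (q ^ b * q ^ d))"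
      by (simp add: q_def power_divide power_add power_mult_distrib power_mult[symmetric] mult.commute)
    finally show "(cmod (poly_coeffs F m))\<^sup>2 \<le> (case m of (a, b, d) \<Rightarrow> S\<^sup>2 * (q ^ a * (q ^ b * q ^ d)))"
      by (simp add: m)
  qed
  also have "\<dots> = S\<^sup>2 * ?s ^ 3"
  proof -
    have "S\<^sup>2 * ?s ^ 3 = S\<^sup>2 * (?s * (?s * ?s))"
      by (simp add: power3_eq_cube)
    also have "\<dots> = (\<Sum>a\<le>n. \<Sum>b\<le>n. \<Sum>d\<le>n. S\<^sup>2 * (q ^ a * (q ^ b * q ^ d)))"
      unfolding sum_distrib_left sum_distrib_right
      by (subst sum.swap, subst (2) sum.swap, subst sum.swap) (simp add: mult_ac)
    also have "\<dots> = (\<Sum>(a, b, d)\<in>{..n} \<times> {..n} \<times> {..n}. S\<^sup>2 * (q ^ a * (q ^ b * q ^ d)))"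
      by (simp add: sum.cartesian_product)
    finally show ?thesis ..
  qed
  also have "\<dots> \<le> S\<^sup>2 * (1 / (1 - q)) ^ 3"
    using s by (intro mult_left_mono power_mono) auto
  finally show ?thesis by (simp add: q_def)
qed

text \<open>On the unit polydisk every monomial has modulus at most one, each coefficient is at most
  the Euclidean norm, and the box holds \<open>Suc n ^ 3\<close> of them.\<close>

lemma poly3_le_coeff_norm:
  assumes F: "poly3 n F" and xyz: "cmod x \<le> 1" "cmod y \<le> 1" "cmod z \<le> 1"
  shows "cmod (F x y z) \<le> real (Suc n) ^ 3 * sqrt (coeff_norm_sq F)"
proof -
  let ?B = "{..n} \<times> {..n} \<times> {..n}"
  have "cmod (case m of (a, b, d) \<Rightarrow> poly_coeffs F (a, b, d) * x ^ a * y ^ b * z ^ d) \<le> sqrt (coeff_norm_sq F)"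
    if m: "m \<in> ?B" for m
  proof -
    obtain a b d where m': "m = (a, b, d)" by (cases m)
    have "cmod (poly_coeffs F (a, b, d) * x ^ a * y ^ b * z ^ d) \<le> cmod (poly_coeffs F (a, b, d)) * 1 * 1 * 1"
      unfolding norm_mult norm_power using xyz by (intro mult_mono power_le_one) auto
    also have "\<dots> \<le> sqrt (coeff_norm_sq F)"
      using member_le_sum[of m ?B "\<lambda>m. (cmod (poly_coeffs F m))\<^sup>2"] m unfolding coeff_norm_sq_box[OF F]
      by (intro real_le_rsqrt) (simp add: m')
    finally show ?thesis by (simp add: m')
  qed
  then have "cmod (F x y z) \<le> of_nat (card ?B) * sqrt (coeff_norm_sq F)"
    by (subst poly3_coeffs(2)[OF F]) (rule sum_norm_bound)
  also have "real (card ?B) = real (Suc n) ^ 3"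
    by (simp add: card_cartesian_product power3_eq_cube algebra_simps)
  finally show ?thesis .
qed

section \<open>Maximum principle\<close>

text \<open>The modulus of a complex function need not be differentiable, so the argument passes to
  the limit in difference quotients: the drop of \<open>cmod (h s)\<close> below
  \<open>cmod (h 0)\<close> is at most \<open>cmod (h s - h 0)\<close>, and
  \<open>(exp (- a * s) - 1) / s\<close> tends to \<open>- a\<close>. Only real \<open>s > 0\<close>
  are tested, which allows \<open>h 0\<close> to be a value at a boundary point of the
  triangle.\<close>

lemma decay_rate_le_derivative:
  fixes h :: "complex \<Rightarrow> complex"
  assumes h: "(h has_field_derivative D) (at 0)" and s0: "0 < s0"
    and decay: "\<And>s. 0 < s \<Longrightarrow> s < s0 \<Longrightarrow> cmod (h (of_real s)) \<le> exp (- a * s) * cmod (h 0)"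
  shows "a * cmod (h 0) \<le> cmod D"
proof (rule tendsto_le[OF trivial_limit_at_right_real[of 0]])
  have "((\<lambda>t. (h t - h 0) / t) \<longlongrightarrow> D) (at 0)"
    using h by (simp add: has_field_derivative_iff)
  moreover have "filterlim complex_of_real (at 0) (at_right 0)"
    unfolding filterlim_at by (auto intro!: tendsto_eq_intros simp: eventually_at_filter)
  ultimately have "((\<lambda>s. (h (of_real s) - h 0) / of_real s) \<longlongrightarrow> D) (at_right 0)"
    by (rule filterlim_compose)
  then show "((\<lambda>s. cmod ((h (of_real s) - h 0) / of_real s)) \<longlongrightarrow> cmod D) (at_right 0)"
    by (rule tendsto_norm)
  have "((\<lambda>s. exp (- a * s)) has_field_derivative - a) (at_right 0)"
    by (auto intro!: derivative_eq_intros)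
  then have "((\<lambda>s. (exp (- a * s) - 1) / s) \<longlongrightarrow> - a) (at_right 0)"
    by (simp add: has_field_derivative_iff)
  then have "((\<lambda>s. - ((exp (- a * s) - 1) / s) * cmod (h 0)) \<longlongrightarrow> - (- a) * cmod (h 0)) (at_right 0)"
    by (intro tendsto_intros)
  then show "((\<lambda>s. - ((exp (- a * s) - 1) / s) * cmod (h 0)) \<longlongrightarrow> a * cmod (h 0)) (at_right 0)"
    by simp
  have "- ((exp (- a * s) - 1) / s) * cmod (h 0) \<le> cmod ((h (of_real s) - h 0) / of_real s)"
    if s: "0 < s" "s < s0" for s
  proof -
    have "- (exp (- a * s) - 1) * cmod (h 0) \<le> cmod (h 0) - cmod (h (of_real s))"
      using decay[OF s] by (simp add: algebra_simps)
    also have "\<dots> \<le> cmod (h (of_real s) - h 0)"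
      using norm_triangle_ineq2[of "h 0" "h (of_real s)"] by (simp add: norm_minus_commute)
    finally have "- (exp (- a * s) - 1) * cmod (h 0) / s \<le> cmod (h (of_real s) - h 0) / s"
      using s by (intro divide_right_mono) auto
    moreover have "cmod ((h (of_real s) - h 0) / of_real s) = cmod (h (of_real s) - h 0) / s"
      using s by (simp add: norm_divide)
    ultimately show ?thesis by (simp add: left_diff_distrib diff_divide_distrib)
  qed
  then show "\<forall>\<^sub>F s in at_right 0. - ((exp (- a * s) - 1) / s) * cmod (h 0) \<le> cmod ((h (of_real s) - h 0) / of_real s)"
    unfolding eventually_at_right[OF s0] using s0 by blast
qed

text \<open>If \<open>f\<close> is not integrable, \<open>integral\<close> defaults to
  \<open>0\<close>; the bound survives because the hypothesis at \<open>t = 0\<close> makes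
  \<open>B\<close> nonnegative.\<close>

lemma norm_integral_le:
  fixes f :: "real \<Rightarrow> complex"
  assumes "\<And>t. t \<in> {0..1} \<Longrightarrow> cmod (f t) \<le> B"
  shows "cmod (integral {0..1} f) \<le> B"
proof -
  have B: "0 \<le> B" using order_trans[OF norm_ge_zero assms[of 0]] by simp
  show ?thesis
  proof (cases "f integrable_on {0..1}")
    case True
    then show ?thesis
      using has_integral_bound_real[OF B finite.emptyI integrable_integral[OF True]] assms by simp
  qed (use B in \<open>simp add: not_integrable_integral\<close>)
qed

lemma compact_domT: "compact domT"
proof -
  have "domT = ({0..1} \<times> {0..1}) \<inter> {p. snd p \<le> fst p}"
    by (auto simp: domT_def)
  moreover have "compact (({0..1} \<times> {0..1}) \<inter> {p :: real \<times> real. snd p \<le> fst p})"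
    by (intro compact_Int_closed compact_Times compact_Icc closed_Collect_le continuous_intros)
  ultimately show ?thesis by simp
qed

lemma compact_domP: "compact domP"
proof -
  have "domP = (\<lambda>((x, \<xi>), y). (x, \<xi>, y)) ` (domT \<times> {0..1})"
    by (force simp: domP_def)
  moreover have "compact ((\<lambda>((x, \<xi>), y). (x, \<xi>, y)) ` (domT \<times> {0..1::real}))"
    by (intro compact_continuous_image compact_Times compact_domT)
      (auto simp: case_prod_beta intro!: continuous_intros)
  ultimately show ?thesis by simp
qed

lemma domT_D: "(x, \<xi>) \<in> domT \<Longrightarrow> x \<in> {0..1} \<and> \<xi> \<in> {0..1} \<and> \<xi> \<le> x"
  by (auto simp: domT_def)

lemma domP_D: "(x, \<xi>, y) \<in> domP \<Longrightarrow> (x, \<xi>) \<in> domT \<and> y \<in> {0..1}"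
  by (auto simp: domP_def)

lemma domP_I: "(x, \<xi>) \<in> domT \<Longrightarrow> y \<in> {0..1} \<Longrightarrow> (x, \<xi>, y) \<in> domP"
  by (auto simp: domP_def)

text \<open>
  A maximum principle for the weighted unknowns \<open>A * exp (- M * x) * cmod e\<close> and
  \<open>exp (- M * x) * cmod eb\<close>.  Both characteristic directions, followed backwards, decrease \<open>x\<close> and
  do not leave the triangle until they reach the side carrying the boundary condition.  At a maximum
  point off that side the derivative along the characteristic is therefore at least
  \<open>M * \<mu> x\<close> times the unknown, which for large \<open>M\<close> exceeds all terms of order zero.  The
  weight \<open>A\<close> makes the coupling through the second boundary condition a contraction.
\<close>

lemma kernel_stability:
  fixes C m0 A M B \<delta> :: real
  assumes C: "0 \<le> C" and m0: "0 < m0"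
    and A: "1 \<le> A" "2 * C\<^sup>2 \<le> A * m0" and M: "3 * C * A + 1 \<le> M * m0"
    and B: "A \<le> B" "A \<le> B * m0" "2 \<le> B * m0"
    and e: "poly3 n e" and eb: "poly3 n (\<lambda>x y z. eb x y)"
    and mu: "\<And>x. x \<in> {0..1} \<Longrightarrow> \<mu> (complex_of_real x) \<in> \<real> \<and> m0 \<le> Re (\<mu> (complex_of_real x))"
    and lam: "\<And>x y. x \<in> {0..1} \<Longrightarrow> y \<in> {0..1} \<Longrightarrow>
      \<Lambda> (complex_of_real x) (complex_of_real y) \<in> \<real> \<and> 0 \<le> Re (\<Lambda> (complex_of_real x) (complex_of_real y))"
    and bd_mu: "\<And>x. x \<in> {0..1} \<Longrightarrow> cmod (deriv \<mu> (complex_of_real x)) \<le> C"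
    and bd_lam: "\<And>x y. x \<in> {0..1} \<Longrightarrow> y \<in> {0..1} \<Longrightarrow> cmod (\<Lambda> (complex_of_real x) (complex_of_real y)) \<le> C"
    and bd_lam': "\<And>x y. x \<in> {0..1} \<Longrightarrow> y \<in> {0..1} \<Longrightarrow>
      cmod (deriv (\<lambda>s. \<Lambda> s (complex_of_real y)) (complex_of_real x)) \<le> C"
    and bd_theta: "\<And>x y. x \<in> {0..1} \<Longrightarrow> y \<in> {0..1} \<Longrightarrow> cmod (\<theta> (complex_of_real x) (complex_of_real y)) \<le> C"
    and bd_W: "\<And>x y. x \<in> {0..1} \<Longrightarrow> y \<in> {0..1} \<Longrightarrow> cmod (W (complex_of_real x) (complex_of_real y)) \<le> C"
    and bd_q: "\<And>x. x \<in> {0..1} \<Longrightarrow> cmod (q (complex_of_real x)) \<le> C"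
    and bd_sigma: "\<And>x y z. x \<in> {0..1} \<Longrightarrow> y \<in> {0..1} \<Longrightarrow> z \<in> {0..1} \<Longrightarrow>
      cmod (\<sigma> (complex_of_real x) (complex_of_real y) (complex_of_real z)) \<le> C"
    and K1: "\<And>x \<xi> y. (x, \<xi>, y) \<in> domP \<Longrightarrow>
      cmod (K1_defect \<mu> \<Lambda> \<sigma> \<theta> e eb (complex_of_real x) (complex_of_real \<xi>) (complex_of_real y)) \<le> \<delta>"
    and K2: "\<And>x \<xi>. (x, \<xi>) \<in> domT \<Longrightarrow> cmod (K2_defect \<mu> W e eb (complex_of_real x) (complex_of_real \<xi>)) \<le> \<delta>"
    and B1: "\<And>x y. x \<in> {0..1} \<Longrightarrow> y \<in> {0..1} \<Longrightarrow>
      cmod ((\<Lambda> (complex_of_real x) (complex_of_real y) + \<mu> (complex_of_real x)) *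
        e (complex_of_real x) (complex_of_real x) (complex_of_real y)) \<le> \<delta>"
    and B2: "\<And>x. x \<in> {0..1} \<Longrightarrow> cmod (B2_defect \<mu> \<Lambda> q e eb (complex_of_real x)) \<le> \<delta>"
  shows "(x, \<xi>, y) \<in> domP \<Longrightarrow> cmod (e (complex_of_real x) (complex_of_real \<xi>) (complex_of_real y)) \<le> exp M * (B * \<delta>)"
    and "(x, \<xi>) \<in> domT \<Longrightarrow> cmod (eb (complex_of_real x) (complex_of_real \<xi>)) \<le> exp M * (B * \<delta>)"
proof -
  define E where "E x \<xi> y = cmod (e (complex_of_real x) (complex_of_real \<xi>) (complex_of_real y))" for x \<xi> y
  define F where "F x \<xi> = cmod (eb (complex_of_real x) (complex_of_real \<xi>))" for x \<xi>
  have M0: "0 \<le> M"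
  proof (rule ccontr)
    assume "\<not> 0 \<le> M"
    then have "M * m0 \<le> 0" using m0 by (simp add: mult_le_0_iff)
    moreover have "0 \<le> 3 * C * A" using C A(1) by simp
    ultimately show False using M by linarith
  qed
  have d0: "0 \<le> \<delta>" using order_trans[OF norm_ge_zero B2[of 0]] by simp
  have ne: "domT \<noteq> {}" "domP \<noteq> {}"
  proof -
    have "(0, 0) \<in> domT" "(0, 0, 0) \<in> domP" by (auto simp: domT_def domP_def)
    then show "domT \<noteq> {}" "domP \<noteq> {}" by blast+
  qed
  have cont1: "continuous_on domP (\<lambda>(x, \<xi>, y). A * exp (- M * x) * E x \<xi> y)"
    unfolding case_prod_beta E_def
    by (intro continuous_intros poly3_continuous'[OF e])
  have cont2: "continuous_on domT (\<lambda>(x, \<xi>). exp (- M * x) * F x \<xi>)"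
    unfolding case_prod_beta F_def
    by (intro continuous_intros poly3_continuous'[OF eb, of _ _ _ "\<lambda>_. 0"])
  obtain x1 \<xi>1 y1 where p1: "(x1, \<xi>1, y1) \<in> domP" and max1: "\<And>x \<xi> y. (x, \<xi>, y) \<in> domP \<Longrightarrow>
      A * exp (- M * x) * E x \<xi> y \<le> A * exp (- M * x1) * E x1 \<xi>1 y1"
    using continuous_attains_sup[OF compact_domP ne(2) cont1] by fast
  obtain x2 \<xi>2 where p2: "(x2, \<xi>2) \<in> domT" and max2: "\<And>x \<xi>. (x, \<xi>) \<in> domT \<Longrightarrow>
      exp (- M * x) * F x \<xi> \<le> exp (- M * x2) * F x2 \<xi>2"
    using continuous_attains_sup[OF compact_domT ne(1) cont2] by fast
  \<comment> \<open>The larger of the two weighted maxima; both unknowns are controlled once it is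
    bounded. The weight \<open>A\<close> makes the resulting bound on \<open>E\<close> smaller than
    that on \<open>F\<close> by the factor \<open>1 / A\<close>, as \<open>\<Phi>3\<close>
    records.\<close>
  define \<Phi> where "\<Phi> = max (A * exp (- M * x1) * E x1 \<xi>1 y1) (exp (- M * x2) * F x2 \<xi>2)"
  have \<Phi>1: "A * E x \<xi> y \<le> exp (M * x) * \<Phi>" if "(x, \<xi>, y) \<in> domP" for x \<xi> y
  proof -
    have "A * exp (- M * x) * E x \<xi> y \<le> \<Phi>" using max1[OF that] by (simp add: \<Phi>_def)
    then have "exp (M * x) * (A * exp (- M * x) * E x \<xi> y) \<le> exp (M * x) * \<Phi>" by simp
    then show ?thesis by (simp add: exp_minus field_simps)
  qed
  have \<Phi>2: "F x \<xi> \<le> exp (M * x) * \<Phi>" if "(x, \<xi>) \<in> domT" for x \<xi>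
  proof -
    have "exp (- M * x) * F x \<xi> \<le> \<Phi>" using max2[OF that] by (simp add: \<Phi>_def)
    then have "exp (M * x) * (exp (- M * x) * F x \<xi>) \<le> exp (M * x) * \<Phi>" by simp
    then show ?thesis by (simp add: exp_minus field_simps)
  qed
  have \<Phi>0: "0 \<le> \<Phi>"
    using A(1) by (simp add: \<Phi>_def E_def le_max_iff_disj)
  have \<Phi>3: "E x \<xi> y \<le> exp (M * x) * \<Phi> / A" if "(x, \<xi>, y) \<in> domP" for x \<xi> y
    using \<Phi>1[OF that] A(1) by (simp add: field_simps)
  have \<Phi>4: "E x \<xi> y \<le> exp (M * x) * \<Phi>" if "(x, \<xi>, y) \<in> domP" for x \<xi> y
  proof -
    have "1 * E x \<xi> y \<le> A * E x \<xi> y" using A(1) by (intro mult_right_mono) (auto simp: E_def)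
    then show ?thesis using \<Phi>1[OF that] by simp
  qed
  have reduce: "\<Phi> \<le> B * \<delta>" if "exp (M * x) * \<Phi> \<le> B * \<delta>" "0 \<le> x" for x
  proof -
    have "1 * \<Phi> \<le> exp (M * x) * \<Phi>" using M0 \<Phi>0 that(2) by (intro mult_right_mono) auto
    then show ?thesis using that(1) by simp
  qed
  \<comment> \<open>Four cases by the location of the maximum: for \<open>e\<close> on and off the
    diagonal, for \<open>eb\<close> on and off the side \<open>\<xi> = 0\<close>. They bound
    \<open>exp (M * x) * \<Phi>\<close> by \<open>A * \<delta> / m0\<close>,
    \<open>A * \<delta>\<close>, \<open>2 * \<delta> / m0\<close> and \<open>\<delta>\<close>, which
    is the origin of the conditions on \<open>B\<close>.\<close>
  have "\<Phi> \<le> B * \<delta>"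
  proof (cases "\<Phi> = A * exp (- M * x1) * E x1 \<xi>1 y1")
    case True
    let ?E = "exp (M * x1) * \<Phi>"
    let ?x = "complex_of_real x1" and ?\<xi> = "complex_of_real \<xi>1" and ?y = "complex_of_real y1"
    have d: "(x1, \<xi>1) \<in> domT" "x1 \<in> {0..1}" "\<xi>1 \<in> {0..1}" "\<xi>1 \<le> x1" "y1 \<in> {0..1}"
      using domP_D[OF p1] domT_D by blast+
    have eq: "?E = A * E x1 \<xi>1 y1"
      by (simp add: True exp_minus field_simps)
    have E0: "0 \<le> ?E" using \<Phi>0 by simp
    define m where "m = Re (\<mu> ?x)"
    define l where "l = Re (\<Lambda> ?\<xi> ?y)"
    have m: "\<mu> ?x = of_real m" "m0 \<le> m" using mu[OF d(2)] by (auto simp: m_def)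
    have l: "\<Lambda> ?\<xi> ?y = of_real l" "0 \<le> l" using lam[OF d(3,5)] by (auto simp: l_def)
    show ?thesis
    proof (cases "\<xi>1 = x1")
      case diag: True
      have "m0 * E x1 \<xi>1 y1 \<le> cmod (\<Lambda> ?x ?y + \<mu> ?x) * E x1 \<xi>1 y1"
      proof (rule mult_right_mono)
        show "m0 \<le> cmod (\<Lambda> ?x ?y + \<mu> ?x)"
          using complex_Re_le_cmod[of "\<Lambda> ?x ?y + \<mu> ?x"] m l diag by simp
      qed (simp add: E_def)
      also have "\<dots> \<le> \<delta>"
        using B1[OF d(2,5)] diag by (simp add: E_def norm_mult)
      finally have "m0 * E x1 \<xi>1 y1 \<le> \<delta>" .
      then have "A * (m0 * E x1 \<xi>1 y1) \<le> A * \<delta>" using A(1) by (intro mult_left_mono) auto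
      then have "m0 * ?E \<le> A * \<delta>" unfolding eq by (simp add: mult_ac)
      also have "\<dots> \<le> B * m0 * \<delta>" using B(2) d0 by (rule mult_right_mono)
      finally have "?E \<le> B * \<delta>" using m0 by simp
      then show ?thesis using reduce d(2) by auto
    next
      case False
      then have lt: "\<xi>1 < x1" using d(4) by simp
      \<comment> \<open>The characteristic is replaced by its tangent line, with the speeds frozen
        at the maximum point; going backwards lowers \<open>x\<close> and raises
        \<open>\<xi>\<close>. The derivative of \<open>h\<close> at \<open>0\<close> is minus the
        transport part of (K1).\<close>
      define h where "h t = e (?x + t * - of_real m) (?\<xi> + t * of_real l) (?y + t * 0)" for t
      let ?De = "of_real m * deriv (\<lambda>s. e s ?\<xi> ?y) ?x - of_real l * deriv (\<lambda>s. e ?x s ?y) ?\<xi>"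
      have "(M * m) * cmod (h 0) \<le> cmod (- ?De)"
      proof (rule decay_rate_le_derivative)
        show "(h has_field_derivative - ?De) (at 0)"
          using poly3_has_derivative(1)[OF e, of ?x "- of_real m" ?\<xi> "of_real l" ?y 0]
          by (simp add: h_def[abs_def])
        show "0 < (x1 - \<xi>1) / (m + l)" using lt m l m0 by auto
        fix s assume s: "0 < s" "s < (x1 - \<xi>1) / (m + l)"
        \<comment> \<open>Such short steps do not cross the diagonal, so maximality applies at the
          displaced point.\<close>
        have "s * (m + l) < x1 - \<xi>1" using s(2) m l m0 by (simp add: field_simps)
        moreover have "0 \<le> s * l" "0 \<le> s * m" using s m l m0 by auto
        ultimately have "(x1 - s * m, \<xi>1 + s * l) \<in> domT"
          using d by (auto simp: domT_def algebra_simps)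
        from max1[OF domP_I[OF this d(5)]]
        have "exp (- M * (x1 - s * m)) * E (x1 - s * m) (\<xi>1 + s * l) y1 \<le> exp (- M * x1) * E x1 \<xi>1 y1"
          using A(1) by (simp add: mult.assoc)
        moreover have "exp (- M * (x1 - s * m)) = exp (- M * x1) * exp (M * m * s)"
          by (simp add: exp_add[symmetric] algebra_simps)
        ultimately have "exp (M * m * s) * E (x1 - s * m) (\<xi>1 + s * l) y1 \<le> E x1 \<xi>1 y1"
          by (simp add: mult.assoc)
        then have "E (x1 - s * m) (\<xi>1 + s * l) y1 \<le> exp (- (M * m) * s) * E x1 \<xi>1 y1"
          by (simp add: exp_minus field_simps)
        then show "cmod (h (of_real s)) \<le> exp (- (M * m) * s) * cmod (h 0)"
          by (simp add: h_def E_def)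
      qed
      also have "\<dots> = cmod ?De" by (rule norm_minus_cancel)
      also have "?De = K1_defect \<mu> \<Lambda> \<sigma> \<theta> e eb ?x ?\<xi> ?y + \<theta> ?\<xi> ?y * eb ?x ?\<xi> +
          e ?x ?\<xi> ?y * deriv (\<lambda>s. \<Lambda> s ?y) ?\<xi> +
          integral {0..1} (\<lambda>\<eta>. \<sigma> ?\<xi> (complex_of_real \<eta>) ?y * e ?x ?\<xi> (complex_of_real \<eta>))"
        by (simp add: K1_defect_def m l)
      \<comment> \<open>The two terms in \<open>e\<close> profit from the factor
        \<open>1 / A\<close>; the coupling through \<open>\<theta>\<close> does not, since
        \<open>eb\<close> carries weight one.\<close>
      also have "cmod \<dots> \<le> \<delta> + C * ?E + ?E / A * C + C * (?E / A)"
      proof (intro norm_triangle_le add_mono K1[OF p1])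
        show "cmod (\<theta> ?\<xi> ?y * eb ?x ?\<xi>) \<le> C * ?E"
          unfolding norm_mult using bd_theta[OF d(3,5)] \<Phi>2[OF d(1)] C by (intro mult_mono) (auto simp: F_def)
        show "cmod (e ?x ?\<xi> ?y * deriv (\<lambda>s. \<Lambda> s ?y) ?\<xi>) \<le> ?E / A * C"
          unfolding norm_mult using bd_lam'[OF d(3,5)] \<Phi>3[OF p1] C E0 A(1)
          by (intro mult_mono) (auto simp: E_def)
        show "cmod (integral {0..1} (\<lambda>\<eta>. \<sigma> ?\<xi> (complex_of_real \<eta>) ?y * e ?x ?\<xi> (complex_of_real \<eta>))) \<le> C * (?E / A)"
        proof (rule norm_integral_le)
          fix t :: real assume t: "t \<in> {0..1}"
          show "cmod (\<sigma> ?\<xi> (complex_of_real t) ?y * e ?x ?\<xi> (complex_of_real t)) \<le> C * (?E / A)"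
            unfolding norm_mult using bd_sigma[OF d(3) t d(5)] \<Phi>3[OF domP_I[OF d(1) t]] C
            by (intro mult_mono) (auto simp: E_def)
        qed
      qed
      finally have "M * m * E x1 \<xi>1 y1 \<le> \<delta> + C * ?E + ?E / A * C + C * (?E / A)"
        by (simp add: h_def E_def)
      moreover have "M * m0 * E x1 \<xi>1 y1 \<le> M * m * E x1 \<xi>1 y1"
        using M0 m(2) by (intro mult_right_mono mult_left_mono) (auto simp: E_def)
      ultimately have "A * (M * m0 * E x1 \<xi>1 y1) \<le> A * (\<delta> + C * ?E + ?E / A * C + C * (?E / A))"
        using A(1) by (intro mult_left_mono) auto
      \<comment> \<open>After multiplication by \<open>A\<close> the terms of order zero amount to
        at most \<open>3 * C * A\<close> times \<open>?E\<close>. The summand \<open>1\<close> in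
        \<open>3 * C * A + 1\<close> is what survives on the left.\<close>
      then have *: "M * m0 * ?E \<le> A * \<delta> + C * A * ?E + 2 * C * ?E"
        unfolding eq using A(1) by (simp add: algebra_simps)
      have "(3 * C * A + 1) * ?E \<le> M * m0 * ?E"
        using M E0 by (rule mult_right_mono)
      moreover have "2 * C * ?E \<le> 2 * C * A * ?E"
        using A(1) C E0 by (intro mult_right_mono) (auto simp: mult_le_cancel_left1)
      ultimately have "?E \<le> A * \<delta>" using * by (simp add: algebra_simps)
      also have "\<dots> \<le> B * \<delta>" using B(1) d0 by (rule mult_right_mono)
      finally show ?thesis using reduce d(2) by auto
    qed
  next
    case False
    then have \<Phi>: "\<Phi> = exp (- M * x2) * F x2 \<xi>2" by (auto simp: \<Phi>_def max_def split: if_splits)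
    let ?E = "exp (M * x2) * \<Phi>"
    let ?x = "complex_of_real x2" and ?\<xi> = "complex_of_real \<xi>2"
    have d: "x2 \<in> {0..1}" "\<xi>2 \<in> {0..1}" "\<xi>2 \<le> x2"
      using domT_D[OF p2] by blast+
    have eq: "?E = F x2 \<xi>2" by (simp add: \<Phi> exp_minus field_simps)
    have E0: "0 \<le> ?E" using \<Phi>0 by simp
    show ?thesis
    proof (cases "\<xi>2 = 0")
      \<comment> \<open>(B2) contains no derivative, so a large \<open>M\<close> gives nothing here.
        By \<open>2 * C\<^sup>2 \<le> A * m0\<close> the factor \<open>1 / A\<close> makes the
        integral at most half of \<open>m0 * ?E\<close>, which is then absorbed.\<close>
      case zero: True
      have "\<mu> 0 * eb ?x 0 = B2_defect \<mu> \<Lambda> q e eb ?x + integral {0..1} (\<lambda>y. q (complex_of_real y) *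
          \<Lambda> 0 (complex_of_real y) * e ?x 0 (complex_of_real y))"
        by (simp add: B2_defect_def)
      also have "cmod \<dots> \<le> \<delta> + C * C * (?E / A)"
      proof (intro norm_triangle_le add_mono B2[OF d(1)] norm_integral_le)
        fix t :: real assume t: "t \<in> {0..1}"
        show "cmod (q (complex_of_real t) * \<Lambda> 0 (complex_of_real t) * e ?x 0 (complex_of_real t)) \<le> C * C * (?E / A)"
          unfolding norm_mult using bd_q[OF t] bd_lam[of 0 t] t C \<Phi>3[OF domP_I[OF p2 t]] zero
          by (intro mult_mono) (auto simp: E_def)
      qed
      finally have 1: "cmod (\<mu> 0 * eb ?x 0) \<le> \<delta> + C * C * (?E / A)" .
      have "m0 * ?E \<le> cmod (\<mu> 0) * F x2 \<xi>2"
        unfolding eq using mu[of 0] complex_Re_le_cmod[of "\<mu> 0"]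
        by (intro mult_right_mono) (auto simp: F_def)
      also have "\<dots> \<le> \<delta> + C * C * (?E / A)"
        using 1 zero by (simp add: F_def norm_mult)
      finally have "A * (m0 * ?E) \<le> A * (\<delta> + C * C * (?E / A))"
        using A(1) by (intro mult_left_mono) auto
      then have "A * m0 * ?E \<le> A * \<delta> + C\<^sup>2 * ?E"
        using A(1) by (simp add: algebra_simps power2_eq_square)
      moreover have "2 * C\<^sup>2 * ?E \<le> A * m0 * ?E"
        using A(2) E0 by (rule mult_right_mono)
      ultimately have "A * (m0 * ?E) \<le> A * (2 * \<delta>)" by (simp add: algebra_simps)
      then have "m0 * ?E \<le> 2 * \<delta>" using A(1) by (subst (asm) mult_le_cancel_left_pos) auto
      also have "\<dots> \<le> B * m0 * \<delta>" using B(3) d0 by (rule mult_right_mono)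
      finally have "?E \<le> B * \<delta>" using m0 by simp
      then show ?thesis using reduce d(1) by auto
    next
      case False
      then have pos: "0 < \<xi>2" using d(2) by simp
      define m where "m = Re (\<mu> ?x)"
      define l where "l = Re (\<mu> ?\<xi>)"
      have m: "\<mu> ?x = of_real m" "m0 \<le> m" using mu[OF d(1)] by (auto simp: m_def)
      have l: "\<mu> ?\<xi> = of_real l" "m0 \<le> l" using mu[OF d(2)] by (auto simp: l_def)
      define h where "h t = eb (?x + t * - of_real m) (?\<xi> + t * - of_real l)" for t
      let ?De = "of_real m * deriv (\<lambda>s. eb s ?\<xi>) ?x + of_real l * deriv (\<lambda>s. eb ?x s) ?\<xi>"
      \<comment> \<open>The first bound keeps \<open>\<xi>\<close> nonnegative. Off the diagonal the
        second keeps \<open>x\<close> above the old \<open>\<xi>2\<close>. On the diagonal both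
        speeds coincide, the backward line stays on it, and \<open>1\<close> is an arbitrary
        positive value.\<close>
      define s0 where "s0 = min (\<xi>2 / l) (if \<xi>2 = x2 then 1 else (x2 - \<xi>2) / m)"
      have "(M * m) * cmod (h 0) \<le> cmod (- ?De)"
      proof (rule decay_rate_le_derivative)
        show "(h has_field_derivative - ?De) (at 0)"
          using poly3_has_derivative(1)[OF eb, of ?x "- of_real m" ?\<xi> "- of_real l" 0 0]
          by (simp add: h_def[abs_def])
        show "0 < s0" using pos d m l m0 by (auto simp: s0_def)
        fix s assume s: "0 < s" "s < s0"
        have "s * l \<le> \<xi>2" using s l m0 by (auto simp: s0_def field_simps)
        moreover have "0 \<le> s * m" "0 \<le> s * l" using s m l m0 by auto
        moreover have "\<xi>2 - s * l \<le> x2 - s * m"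
        proof (cases "\<xi>2 = x2")
          case True
          then have "l = m" by (simp add: l_def m_def)
          then show ?thesis using True by simp
        next
          case False
          then have "s * m < x2 - \<xi>2" using s m m0 by (auto simp: s0_def field_simps)
          then show ?thesis using \<open>0 \<le> s * l\<close> by linarith
        qed
        ultimately have "(x2 - s * m, \<xi>2 - s * l) \<in> domT"
          using d by (auto simp: domT_def)
        from max2[OF this]
        have "exp (- M * (x2 - s * m)) * F (x2 - s * m) (\<xi>2 - s * l) \<le> exp (- M * x2) * F x2 \<xi>2" .
        moreover have "exp (- M * (x2 - s * m)) = exp (- M * x2) * exp (M * m * s)"
          by (simp add: exp_add[symmetric] algebra_simps)
        ultimately have "exp (M * m * s) * F (x2 - s * m) (\<xi>2 - s * l) \<le> F x2 \<xi>2"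
          by (simp add: mult.assoc)
        then have "F (x2 - s * m) (\<xi>2 - s * l) \<le> exp (- (M * m) * s) * F x2 \<xi>2"
          by (simp add: exp_minus field_simps)
        then show "cmod (h (of_real s)) \<le> exp (- (M * m) * s) * cmod (h 0)"
          by (simp add: h_def F_def)
      qed
      also have "\<dots> = cmod ?De" by (rule norm_minus_cancel)
      also have "?De = K2_defect \<mu> W e eb ?x ?\<xi> + - deriv \<mu> ?\<xi> * eb ?x ?\<xi> +
          integral {0..1} (\<lambda>y. W ?\<xi> (complex_of_real y) * e ?x ?\<xi> (complex_of_real y))"
        by (simp add: K2_defect_def m l)
      also have "cmod \<dots> \<le> \<delta> + C * ?E + C * ?E"
      proof (intro norm_triangle_le add_mono K2[OF p2])
        show "cmod (- deriv \<mu> ?\<xi> * eb ?x ?\<xi>) \<le> C * ?E"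
          unfolding norm_mult norm_minus_cancel using bd_mu[OF d(2)] \<Phi>2[OF p2] C
          by (intro mult_mono) (auto simp: F_def)
        show "cmod (integral {0..1} (\<lambda>y. W ?\<xi> (complex_of_real y) * e ?x ?\<xi> (complex_of_real y))) \<le> C * ?E"
        proof (rule norm_integral_le)
          fix t :: real assume t: "t \<in> {0..1}"
          show "cmod (W ?\<xi> (complex_of_real t) * e ?x ?\<xi> (complex_of_real t)) \<le> C * ?E"
            unfolding norm_mult using bd_W[OF d(2) t] \<Phi>4[OF domP_I[OF p2 t]] C
            by (intro mult_mono) (auto simp: E_def)
        qed
      qed
      finally have "M * m * ?E \<le> \<delta> + C * ?E + C * ?E"
        unfolding eq by (simp add: h_def F_def)
      moreover have "(3 * C * A + 1) * ?E \<le> M * m * ?E"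
        using M m(2) M0 E0 by (intro mult_right_mono) (auto intro: order_trans mult_left_mono)
      moreover have "C * 1 * ?E \<le> C * A * ?E" "0 \<le> C * A * ?E"
        using mult_right_mono[OF mult_left_mono[OF A(1) C] E0] A(1) C E0 by auto
      ultimately have "?E \<le> \<delta>" by (simp add: algebra_simps)
      also have "\<dots> \<le> B * \<delta>" using A(1) B(1) mult_right_mono[OF _ d0, of 1 B] by simp
      finally show ?thesis using reduce d(1) by auto
    qed
  qed
  \<comment> \<open>Removing the weight costs at most its value \<open>exp M\<close> at the right
    end of the interval.\<close>
  then have le: "exp (M * x) * \<Phi> \<le> exp M * (B * \<delta>)" if "x \<in> {0..1}" for x
    using that M0 \<Phi>0 by (intro mult_mono) (auto simp: mult_left_le)
  show "cmod (e (complex_of_real x) (complex_of_real \<xi>) (complex_of_real y)) \<le> exp M * (B * \<delta>)" if "(x, \<xi>, y) \<in> domP"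
    using \<Phi>4[OF that] le[of x] domP_D[OF that] domT_D by (fastforce simp: E_def)
  show "cmod (eb (complex_of_real x) (complex_of_real \<xi>)) \<le> exp M * (B * \<delta>)" if "(x, \<xi>) \<in> domT"
    using \<Phi>2[OF that] le[of x] domT_D[OF that] by (auto simp: F_def)
qed

section \<open>Defects and residuals\<close>

text \<open>The nested rules mirror the term structure of the equation. The two alternatives for
  \<open>L\<close> correspond to two uses: \<open>1 < L\<close> for convergence, and
  \<open>L \<le> 0\<close> for extracting the linear degree bound alone.\<close>

lemma geo_approx_K1_defect:
  assumes L: "L \<le> 0 \<or> 1 < L"
    and m: "geo_approx L (\<lambda>N x y z. mN N x) (\<lambda>x y z. \<mu> x)"
    and l: "geo_approx L (\<lambda>N x y z. lN N x y) (\<lambda>x y z. \<Lambda> x y)"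
    and s: "geo_approx L sN \<sigma>"
    and t: "geo_approx L (\<lambda>N x y z. tN N x y) (\<lambda>x y z. \<theta> x y)"
    and k: "geo_approx L kN k" and kb: "geo_approx L (\<lambda>N x y z. kbN N x y) (\<lambda>x y z. kb x y)"
  shows "geo_approx L (\<lambda>N. K1_defect (mN N) (lN N) (sN N) (tN N) (kN N) (kbN N)) (K1_defect \<mu> \<Lambda> \<sigma> \<theta> k kb)"
  unfolding K1_defect_def
  by (rule geo_approx_diff[OF geo_approx_diff[OF geo_approx_diff[OF
        geo_approx_mult[OF m geo_approx_deriv[OF k]]
        geo_approx_mult[OF geo_approx_shift(1)[OF l] geo_approx_deriv2[OF k]]]
        geo_approx_mult[OF geo_approx_shift(1)[OF t] kb]]
        geo_approx_add[OF geo_approx_mult[OF k geo_approx_shift(1)[OF geo_approx_deriv[OF l]]]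
        geo_approx_integral[OF s k L]]])

lemma geo_approx_K2_defect:
  assumes L: "L \<le> 0 \<or> 1 < L"
    and m: "geo_approx L (\<lambda>N x y z. mN N x) (\<lambda>x y z. \<mu> x)"
    and w: "geo_approx L (\<lambda>N x y z. wN N x y) (\<lambda>x y z. W x y)"
    and k: "geo_approx L kN k" and kb: "geo_approx L (\<lambda>N x y z. kbN N x y) (\<lambda>x y z. kb x y)"
  shows "geo_approx L (\<lambda>N x \<xi> y. K2_defect (mN N) (wN N) (kN N) (kbN N) x \<xi>) (\<lambda>x \<xi> y. K2_defect \<mu> W k kb x \<xi>)"
  unfolding K2_defect_def
  by (rule geo_approx_diff[OF geo_approx_add[OF
        geo_approx_mult[OF m geo_approx_deriv[OF kb]]
        geo_approx_mult[OF geo_approx_shift(3)[OF m] geo_approx_deriv2[OF kb]]]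
        geo_approx_add[OF geo_approx_mult[OF geo_approx_uminus[OF geo_approx_shift(3)[OF geo_approx_deriv[OF m]]] kb]
        geo_approx_integral[OF w k L]]])

lemma geo_approx_B1_defect:
  assumes m: "geo_approx L (\<lambda>N x y z. mN N x) (\<lambda>x y z. \<mu> x)"
    and l: "geo_approx L (\<lambda>N x y z. lN N x y) (\<lambda>x y z. \<Lambda> x y)"
    and t: "geo_approx L (\<lambda>N x y z. tN N x y) (\<lambda>x y z. \<theta> x y)"
    and k: "geo_approx L kN k"
  shows "geo_approx L (\<lambda>N x \<xi> y. B1_defect (mN N) (lN N) (tN N) (kN N) x y) (\<lambda>x \<xi> y. B1_defect \<mu> \<Lambda> \<theta> k x y)"
  unfolding B1_defect_def
  by (rule geo_approx_diff[OF geo_approx_mult[OF geo_approx_add[OF geo_approx_shift(2)[OF l] m]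
        geo_approx_shift(5)[OF k]] geo_approx_uminus[OF geo_approx_shift(2)[OF t]]])

lemma geo_approx_B2_defect:
  assumes L: "L \<le> 0 \<or> 1 < L"
    and m: "geo_approx L (\<lambda>N x y z. mN N x) (\<lambda>x y z. \<mu> x)"
    and l: "geo_approx L (\<lambda>N x y z. lN N x y) (\<lambda>x y z. \<Lambda> x y)"
    and q: "geo_approx L (\<lambda>N x y z. qN N x) (\<lambda>x y z. q x)"
    and k: "geo_approx L kN k" and kb: "geo_approx L (\<lambda>N x y z. kbN N x y) (\<lambda>x y z. kb x y)"
  shows "geo_approx L (\<lambda>N x \<xi> y. B2_defect (mN N) (lN N) (qN N) (kN N) (kbN N) x) (\<lambda>x \<xi> y. B2_defect \<mu> \<Lambda> q k kb x)"
  unfolding B2_defect_def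
  by (rule geo_approx_diff[OF geo_approx_mult[OF geo_approx_shift(7)[OF m] geo_approx_shift(6)[OF kb]]
        geo_approx_integral[OF geo_approx_mult[OF geo_approx_shift(3)[OF q] geo_approx_shift(7)[OF l]]
          geo_approx_shift(6)[OF k] L]])

text \<open>The identity theorem is applied to one variable at a time, in the order
  \<open>y\<close>, \<open>x\<close>, \<open>\<xi>\<close>. The triangle is not a product, but it
  contains the rectangle \<open>{1/2..1} \<times> {0..1/2}\<close>, and this carries the steps in
  \<open>x\<close> and \<open>\<xi>\<close>.\<close>

lemma geo_approx_zero_on_domT:
  assumes P: "geo_approx L P F" and L: "1 < L"
    and zero: "\<And>x \<xi>. (x, \<xi>) \<in> domT \<Longrightarrow> infinite {y \<in> {0..1}. F (complex_of_real x) (complex_of_real \<xi>) (complex_of_real y) = 0}"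
    and xyz: "x \<in> ball 0 L" "\<xi> \<in> ball 0 L" "y \<in> ball 0 L"
  shows "F x \<xi> y = 0"
proof -
  have real: "complex_of_real t \<in> ball 0 L" if "t \<in> {0..1}" for t using that L by auto
  have 1: "F (complex_of_real x) (complex_of_real \<xi>) y = 0" if d: "(x, \<xi>) \<in> domT" for x \<xi>
  proof (rule holomorphic_zero_on_reals[OF _ L zero[OF d] xyz(3)])
    show "F (complex_of_real x) (complex_of_real \<xi>) holomorphic_on ball 0 L"
      using geo_approx_holomorphic[OF geo_approx_shift(4)[OF P]] real d by (auto simp: domT_def)
  qed
  have 2: "F x (complex_of_real \<xi>) y = 0" if d: "\<xi> \<in> {0..1/2}" for \<xi>
  proof (rule holomorphic_zero_on_reals[OF _ L _ xyz(1)])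
    show "(\<lambda>x. F x (complex_of_real \<xi>) y) holomorphic_on ball 0 L"
      using d by (intro geo_approx_holomorphic[OF P _ xyz(3)] real) auto
    have "{1/2..1} \<subseteq> {t \<in> {0..1}. F (complex_of_real t) (complex_of_real \<xi>) y = 0}"
      using 1 d by (auto simp: domT_def)
    then show "infinite {t \<in> {0..1}. F (complex_of_real t) (complex_of_real \<xi>) y = 0}"
      by (rule infinite_super) simp
  qed
  show ?thesis
  proof (rule holomorphic_zero_on_reals[OF _ L _ xyz(2)])
    show "(\<lambda>\<xi>. F x \<xi> y) holomorphic_on ball 0 L"
      by (rule geo_approx_holomorphic[OF geo_approx_shift(3)[OF P] xyz(1,3)])
    have "{0..1/2} \<subseteq> {t \<in> {0..1}. F x (complex_of_real t) y = 0}"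
      using 2 by auto
    then show "infinite {t \<in> {0..1}. F x (complex_of_real t) y = 0}"
      by (rule infinite_super) simp
  qed
qed

section \<open>Geometric decay of coefficient norms against polynomial growth\<close>

definition geo_decay :: "(nat \<Rightarrow> real) \<Rightarrow> bool" where
  "geo_decay f \<longleftrightarrow> (\<exists>C \<rho>. 0 \<le> C \<and> 0 < \<rho> \<and> \<rho> < 1 \<and> (\<forall>N. f N \<le> C * \<rho> ^ N))"

lemma geo_decay_add:
  assumes "geo_decay f" "geo_decay g"
  shows "geo_decay (\<lambda>N. f N + g N)"
proof -
  obtain C \<rho> where f: "0 \<le> C" "0 < \<rho>" "\<rho> < 1" "\<forall>N. f N \<le> C * \<rho> ^ N"
    using assms(1) unfolding geo_decay_def by blast
  obtain D \<tau> where g: "0 \<le> D" "0 < \<tau>" "\<tau> < 1" "\<forall>N. g N \<le> D * \<tau> ^ N"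
    using assms(2) unfolding geo_decay_def by blast
  have "f N + g N \<le> (C + D) * max \<rho> \<tau> ^ N" for N
    using f(4)[rule_format, of N] g(4)[rule_format, of N] geo_sum_bound[OF f(1) g(1) f(2) g(2), of N]
    by linarith
  then show ?thesis
    unfolding geo_decay_def using f g by (intro exI[of _ "C + D"] exI[of _ "max \<rho> \<tau>"]) auto
qed

lemma geo_decay_mono: "geo_decay f \<Longrightarrow> (\<And>N. g N \<le> f N) \<Longrightarrow> geo_decay g"
  unfolding geo_decay_def by (meson order_trans)

lemma geo_decay_times_cubic:
  assumes f: "geo_decay f" "\<And>N. 0 \<le> f N"
  shows "(\<lambda>N. real (Suc (c * Suc N)) ^ 3 * f N) \<longlonglongrightarrow> 0"
proof -
  obtain C \<rho> where C: "0 \<le> C" "0 < \<rho>" "\<rho> < 1" "\<And>N. f N \<le> C * \<rho> ^ N"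
    using assms(1) unfolding geo_decay_def by blast
  \<comment> \<open>With the cube root, \<open>real (Suc N) ^ 3 * \<rho> ^ Suc N\<close> is the cube
    of \<open>real (Suc N) * \<tau> ^ Suc N\<close>, whose limit is \<open>0\<close>. The factor
    \<open>1 / \<rho>\<close> below pays for the shift from \<open>N\<close> to
    \<open>Suc N\<close>.\<close>
  define \<tau> where "\<tau> = root 3 \<rho>"
  have \<tau>: "\<tau> ^ 3 = \<rho>" "norm \<tau> < 1"
    using C(2,3) by (auto simp: \<tau>_def)
  have "(\<lambda>N. (real c + 1) ^ 3 * (C / \<rho>) * (of_nat (Suc N) * \<tau> ^ Suc N) ^ 3) \<longlonglongrightarrow> (real c + 1) ^ 3 * (C / \<rho>) * 0 ^ 3"
    by (intro tendsto_intros LIMSEQ_Suc[OF powser_times_n_limit_0] \<tau>(2))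
  then have lim: "(\<lambda>N. (real c + 1) ^ 3 * (C / \<rho>) * (of_nat (Suc N) * \<tau> ^ Suc N) ^ 3) \<longlonglongrightarrow> 0"
    by simp
  have bound: "real (Suc (c * Suc N)) ^ 3 * f N \<le> (real c + 1) ^ 3 * (C / \<rho>) * (of_nat (Suc N) * \<tau> ^ Suc N) ^ 3" for N
  proof -
    have "real (Suc (c * Suc N)) ^ 3 * f N \<le> ((real c + 1) * real (Suc N)) ^ 3 * (C * \<rho> ^ N)"
      by (intro mult_mono power_mono C f) (auto simp: algebra_simps)
    also have "\<dots> = (real c + 1) ^ 3 * (C / \<rho>) * (of_nat (Suc N) ^ 3 * \<rho> ^ Suc N)"
      using C(2) by (simp add: power_mult_distrib)
    also have "\<rho> ^ Suc N = (\<tau> ^ Suc N) ^ 3"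
      unfolding \<tau>(1)[symmetric] power_mult[symmetric] by (simp add: mult.commute)
    finally show ?thesis by (simp only: power_mult_distrib)
  qed
  show ?thesis
  proof (rule Lim_null_comparison[OF always_eventually lim], rule allI)
    fix N
    have "0 \<le> real (Suc (c * Suc N)) ^ 3 * f N" by (intro mult_nonneg_nonneg f) simp
    then show "norm (real (Suc (c * Suc N)) ^ 3 * f N) \<le> (real c + 1) ^ 3 * (C / \<rho>) * (of_nat (Suc N) * \<tau> ^ Suc N) ^ 3"
      using bound[of N] by (simp only: real_norm_def abs_of_nonneg)
  qed
qed

text \<open>Because the limit vanishes, the approximation error is \<open>P N\<close> itself. Its
  coefficients are estimated on a radius between \<open>1\<close> and \<open>L\<close>, where the
  factor \<open>D\<close> does not depend on \<open>N\<close>.\<close>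

lemma geo_decay_coeff_norm:
  assumes P: "geo_approx L P F" and L: "1 < L"
    and zero: "\<And>x y z. x \<in> ball 0 L \<Longrightarrow> y \<in> ball 0 L \<Longrightarrow> z \<in> ball 0 L \<Longrightarrow> F x y z = 0"
  shows "geo_decay (\<lambda>N. sqrt (coeff_norm_sq (P N)))"
proof -
  obtain r where r: "1 < r" "r < L" using L dense by blast
  have "0 < r" using r by simp
  then obtain C \<rho> B where "geo_bound r P F C \<rho> B"
    using r(2) by (rule geo_approxE[OF P])
  note b = geo_boundD[OF this]
  define D where "D = sqrt ((1 / (1 - 1 / r\<^sup>2)) ^ 3)"
  have "sqrt (coeff_norm_sq (P N)) \<le> (C * D) * \<rho> ^ N" for N
  proof -
    obtain n where n: "poly3 n (P N)" using geo_approx_poly3[OF P] by blast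
    have "cmod (P N x y z) \<le> C * \<rho> ^ N" if "x \<in> cball 0 r" "y \<in> cball 0 r" "z \<in> cball 0 r" for x y z
      using b(5)[OF that, of N] zero[of x y z] that r by simp
    then have "sqrt (coeff_norm_sq (P N)) \<le> sqrt ((C * \<rho> ^ N)\<^sup>2 * (1 / (1 - 1 / r\<^sup>2)) ^ 3)"
      by (intro real_sqrt_le_mono coeff_norm_sq_le[OF n r(1)])
    also have "\<dots> = (C * D) * \<rho> ^ N"
      using b(1,2) by (simp add: real_sqrt_mult D_def)
    finally show ?thesis .
  qed
  moreover have "0 \<le> C * D"
  proof -
    have "1 / r\<^sup>2 \<le> 1" using r by simp
    then show ?thesis using b(1) by (simp add: D_def)
  qed
  ultimately show ?thesis
    unfolding geo_decay_def using b(2,3) by blast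
qed

section \<open>Linearity of the defects and comparison with the residual\<close>

lemma K1_defect_diff:
  assumes s: "poly3 n \<sigma>" and k: "poly3 n k" "poly3 n k'"
  shows "K1_defect \<mu> \<Lambda> \<sigma> \<theta> (\<lambda>x y z. k x y z - k' x y z) (\<lambda>x y. kb x y - kb' x y) x \<xi> y =
    K1_defect \<mu> \<Lambda> \<sigma> \<theta> k kb x \<xi> y - K1_defect \<mu> \<Lambda> \<sigma> \<theta> k' kb' x \<xi> y"
proof -
  \<comment> \<open>Splitting \<open>integral\<close> and \<open>deriv\<close> over a difference
    requires integrability and differentiability; polynomials provide both.\<close>
  have "integral {0..1} (\<lambda>\<eta>. \<sigma> \<xi> (complex_of_real \<eta>) y * (k x \<xi> (complex_of_real \<eta>) - k' x \<xi> (complex_of_real \<eta>))) =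
    integral {0..1} (\<lambda>\<eta>. \<sigma> \<xi> (complex_of_real \<eta>) y * k x \<xi> (complex_of_real \<eta>)) -
    integral {0..1} (\<lambda>\<eta>. \<sigma> \<xi> (complex_of_real \<eta>) y * k' x \<xi> (complex_of_real \<eta>))"
    unfolding right_diff_distrib
    by (intro integral_diff integrable_continuous_real continuous_intros
        poly3_continuous'[OF s] poly3_continuous'[OF k(1)] poly3_continuous'[OF k(2)])
  then show ?thesis
    using k unfolding K1_defect_def
    by (simp add: deriv_diff poly3_differentiable1 poly3_differentiable2 algebra_simps)
qed

lemma K2_defect_diff:
  assumes w: "poly3 n (\<lambda>x y z. W x y)" and k: "poly3 n k" "poly3 n k'"
    and kb: "poly3 n (\<lambda>x y z. kb x y)" "poly3 n (\<lambda>x y z. kb' x y)"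
  shows "K2_defect \<mu> W (\<lambda>x y z. k x y z - k' x y z) (\<lambda>x y. kb x y - kb' x y) x \<xi> =
    K2_defect \<mu> W k kb x \<xi> - K2_defect \<mu> W k' kb' x \<xi>"
proof -
  have "integral {0..1} (\<lambda>y. W \<xi> (complex_of_real y) * (k x \<xi> (complex_of_real y) - k' x \<xi> (complex_of_real y))) =
    integral {0..1} (\<lambda>y. W \<xi> (complex_of_real y) * k x \<xi> (complex_of_real y)) -
    integral {0..1} (\<lambda>y. W \<xi> (complex_of_real y) * k' x \<xi> (complex_of_real y))"
    unfolding right_diff_distrib
    by (intro integral_diff integrable_continuous_real continuous_intros
        poly3_continuous'[OF w, of _ _ _ "\<lambda>_. 0"] poly3_continuous'[OF k(1)] poly3_continuous'[OF k(2)])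
  then show ?thesis
    using poly3_differentiable1[OF kb(1)] poly3_differentiable1[OF kb(2)]
      poly3_differentiable2[OF kb(1)] poly3_differentiable2[OF kb(2)]
    unfolding K2_defect_def by (simp add: deriv_diff algebra_simps)
qed

text \<open>(B1) is affine in \<open>k\<close>, and its inhomogeneity \<open>\<theta>\<close>
  cancels in a difference. This is why the stability estimate takes (B1) in homogeneous
  form.\<close>

lemma B1_defect_diff:
  "B1_defect \<mu> \<Lambda> \<theta> k x y - B1_defect \<mu> \<Lambda> \<theta> k' x y = (\<Lambda> x y + \<mu> x) * (k x x y - k' x x y)"
  unfolding B1_defect_def by (simp add: algebra_simps)

lemma B2_defect_diff:
  assumes q: "poly3 n (\<lambda>x y z. q x)" and l: "poly3 n (\<lambda>x y z. \<Lambda> x y)" and k: "poly3 n k" "poly3 n k'"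
  shows "B2_defect \<mu> \<Lambda> q (\<lambda>x y z. k x y z - k' x y z) (\<lambda>x y. kb x y - kb' x y) x =
    B2_defect \<mu> \<Lambda> q k kb x - B2_defect \<mu> \<Lambda> q k' kb' x"
proof -
  have "integral {0..1} (\<lambda>y. q (complex_of_real y) * \<Lambda> 0 (complex_of_real y) * (k x 0 (complex_of_real y) - k' x 0 (complex_of_real y))) =
    integral {0..1} (\<lambda>y. q (complex_of_real y) * \<Lambda> 0 (complex_of_real y) * k x 0 (complex_of_real y)) -
    integral {0..1} (\<lambda>y. q (complex_of_real y) * \<Lambda> 0 (complex_of_real y) * k' x 0 (complex_of_real y))"
    unfolding right_diff_distrib
    by (intro integral_diff integrable_continuous_real continuous_intros
        poly3_continuous'[OF q, of _ _ "\<lambda>_. 0" "\<lambda>_. 0"] poly3_continuous'[OF l, of _ _ _ "\<lambda>_. 0"]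
        poly3_continuous'[OF k(1)] poly3_continuous'[OF k(2)])
  then show ?thesis
    unfolding B2_defect_def by (simp add: algebra_simps)
qed

lemma coeff_norms_le_ls_residual:
  shows "sqrt (coeff_norm_sq (K1_defect (trunc1 N \<mu>) (trunc2 N \<Lambda>) (trunc3 N \<sigma>) (trunc2 N \<theta>) (tpoly3 N K) (tpoly2 N Kb)))
      \<le> ls_residual N \<mu> \<Lambda> \<sigma> \<theta> W q K Kb"
    and "sqrt (coeff_norm_sq (\<lambda>x \<xi> y. K2_defect (trunc1 N \<mu>) (trunc2 N W) (tpoly3 N K) (tpoly2 N Kb) x \<xi>))
      \<le> ls_residual N \<mu> \<Lambda> \<sigma> \<theta> W q K Kb"
    and "sqrt (coeff_norm_sq (\<lambda>x \<xi> y. B1_defect (trunc1 N \<mu>) (trunc2 N \<Lambda>) (trunc2 N \<theta>) (tpoly3 N K) x y))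
      \<le> ls_residual N \<mu> \<Lambda> \<sigma> \<theta> W q K Kb"
    and "sqrt (coeff_norm_sq (\<lambda>x \<xi> y. B2_defect (trunc1 N \<mu>) (trunc2 N \<Lambda>) (trunc1 N q) (tpoly3 N K) (tpoly2 N Kb) x))
      \<le> ls_residual N \<mu> \<Lambda> \<sigma> \<theta> W q K Kb"
  unfolding ls_residual_def Let_def
  by (rule real_sqrt_le_mono, simp add: coeff_norm_sq_nonneg add_nonneg_nonneg add_increasing add_increasing2)+

lemma ls_residual_le_coeff_norms:
  "ls_residual N \<mu> \<Lambda> \<sigma> \<theta> W q K Kb \<le>
    sqrt (coeff_norm_sq (K1_defect (trunc1 N \<mu>) (trunc2 N \<Lambda>) (trunc3 N \<sigma>) (trunc2 N \<theta>) (tpoly3 N K) (tpoly2 N Kb))) +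
    sqrt (coeff_norm_sq (\<lambda>x \<xi> y. K2_defect (trunc1 N \<mu>) (trunc2 N W) (tpoly3 N K) (tpoly2 N Kb) x \<xi>)) +
    sqrt (coeff_norm_sq (\<lambda>x \<xi> y. B1_defect (trunc1 N \<mu>) (trunc2 N \<Lambda>) (trunc2 N \<theta>) (tpoly3 N K) x y)) +
    sqrt (coeff_norm_sq (\<lambda>x \<xi> y. B2_defect (trunc1 N \<mu>) (trunc2 N \<Lambda>) (trunc1 N q) (tpoly3 N K) (tpoly2 N Kb) x))"
  unfolding ls_residual_def Let_def
  by (intro order_trans[OF sqrt_add_le_add_sqrt] add_right_mono add_nonneg_nonneg coeff_norm_sq_nonneg order_refl)

lemma ls_residual_nonneg: "0 \<le> ls_residual N \<mu> \<Lambda> \<sigma> \<theta> W q K Kb"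
  unfolding ls_residual_def Let_def by (simp add: coeff_norm_sq_nonneg)

text \<open>
  With radius \<open>0\<close> the error bound in \<open>geo_approx\<close> is vacuous; this transfers its closure
  properties to polynomial sequences that need not converge.
\<close>

lemma geo_approx_zero_radius: "poly3_seq P \<Longrightarrow> geo_approx 0 P F"
  by (simp add: geo_approx_def)

text \<open>The degrees depend only on the shape of the ansatz, so nothing has to be known about the
  coefficient families: the estimate serves the minimizers as well as the truncated exact
  series.\<close>

lemma defects_le_ls_residual:
  "\<exists>c. \<forall>N x \<xi> y. cmod x \<le> 1 \<longrightarrow> cmod \<xi> \<le> 1 \<longrightarrow> cmod y \<le> 1 \<longrightarrow>
    cmod (K1_defect (trunc1 N \<mu>) (trunc2 N \<Lambda>) (trunc3 N \<sigma>) (trunc2 N \<theta>) (tpoly3 N (K N)) (tpoly2 N (Kb N)) x \<xi> y)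
      \<le> real (Suc (c * Suc N)) ^ 3 * ls_residual N \<mu> \<Lambda> \<sigma> \<theta> W q (K N) (Kb N) \<and>
    cmod (K2_defect (trunc1 N \<mu>) (trunc2 N W) (tpoly3 N (K N)) (tpoly2 N (Kb N)) x \<xi>)
      \<le> real (Suc (c * Suc N)) ^ 3 * ls_residual N \<mu> \<Lambda> \<sigma> \<theta> W q (K N) (Kb N) \<and>
    cmod (B1_defect (trunc1 N \<mu>) (trunc2 N \<Lambda>) (trunc2 N \<theta>) (tpoly3 N (K N)) x y)
      \<le> real (Suc (c * Suc N)) ^ 3 * ls_residual N \<mu> \<Lambda> \<sigma> \<theta> W q (K N) (Kb N) \<and>
    cmod (B2_defect (trunc1 N \<mu>) (trunc2 N \<Lambda>) (trunc1 N q) (tpoly3 N (K N)) (tpoly2 N (Kb N)) x)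
      \<le> real (Suc (c * Suc N)) ^ 3 * ls_residual N \<mu> \<Lambda> \<sigma> \<theta> W q (K N) (Kb N)"
proof -
  have t1: "geo_approx 0 (\<lambda>N x y z. trunc1 N f x) (\<lambda>x y z. 0)" for f
    unfolding trunc1_def by (rule geo_approx_zero_radius[OF poly3_seqI[of 1]], rule poly3_tpoly1)
  have t2: "geo_approx 0 (\<lambda>N x y z. trunc2 N f x y) (\<lambda>x y z. 0)" for f
    unfolding trunc2_def by (rule geo_approx_zero_radius[OF poly3_seqI[of 1]], rule poly3_tpoly2)
  have t3: "geo_approx 0 (\<lambda>N. trunc3 N f) (\<lambda>x y z. 0)" for f
    unfolding trunc3_def by (rule geo_approx_zero_radius[OF poly3_seqI[of 1]], rule poly3_tpoly3)
  have k: "geo_approx 0 (\<lambda>N. tpoly3 N (K N)) (\<lambda>x y z. 0)"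
    by (rule geo_approx_zero_radius[OF poly3_seqI[of 1]], rule poly3_tpoly3)
  have kb: "geo_approx 0 (\<lambda>N x y z. tpoly2 N (Kb N) x y) (\<lambda>x y z. 0)"
    by (rule geo_approx_zero_radius[OF poly3_seqI[of 1]], rule poly3_tpoly2)
  have L: "(0::real) \<le> 0 \<or> 1 < (0::real)" by simp
  obtain c1 where c1: "\<And>N. poly3 (c1 * Suc N) (K1_defect (trunc1 N \<mu>) (trunc2 N \<Lambda>) (trunc3 N \<sigma>) (trunc2 N \<theta>) (tpoly3 N (K N)) (tpoly2 N (Kb N)))"
    using geo_approx_poly3_seq[OF geo_approx_K1_defect[OF L t1 t2 t3 t2 k kb]] unfolding poly3_seq_def by blast
  obtain c2 where c2: "\<And>N. poly3 (c2 * Suc N) (\<lambda>x \<xi> y. K2_defect (trunc1 N \<mu>) (trunc2 N W) (tpoly3 N (K N)) (tpoly2 N (Kb N)) x \<xi>)"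
    using geo_approx_poly3_seq[OF geo_approx_K2_defect[OF L t1 t2 k kb]] unfolding poly3_seq_def by blast
  obtain c3 where c3: "\<And>N. poly3 (c3 * Suc N) (\<lambda>x \<xi> y. B1_defect (trunc1 N \<mu>) (trunc2 N \<Lambda>) (trunc2 N \<theta>) (tpoly3 N (K N)) x y)"
    using geo_approx_poly3_seq[OF geo_approx_B1_defect[OF t1 t2 t2 k]] unfolding poly3_seq_def by blast
  obtain c4 where c4: "\<And>N. poly3 (c4 * Suc N) (\<lambda>x \<xi> y. B2_defect (trunc1 N \<mu>) (trunc2 N \<Lambda>) (trunc1 N q) (tpoly3 N (K N)) (tpoly2 N (Kb N)) x)"
    using geo_approx_poly3_seq[OF geo_approx_B2_defect[OF L t1 t2 t1 k kb]] unfolding poly3_seq_def by blast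
  define c where "c = c1 + c2 + c3 + c4"
  have le: "c1 * Suc N \<le> c * Suc N" "c2 * Suc N \<le> c * Suc N" "c3 * Suc N \<le> c * Suc N" "c4 * Suc N \<le> c * Suc N" for N
    by (rule mult_le_mono1, simp add: c_def)+
  have bound: "cmod (F x y z) \<le> real (Suc n) ^ 3 * \<rho>"
    if "poly3 n F" "cmod x \<le> 1" "cmod y \<le> 1" "cmod z \<le> 1" "sqrt (coeff_norm_sq F) \<le> \<rho>" for n F x y z \<rho>
    by (rule order_trans[OF poly3_le_coeff_norm[OF that(1-4)]]) (intro mult_left_mono that, simp)
  show ?thesis
  proof (intro exI[of _ c] allI impI conjI, goal_cases)
    case (1 N x \<xi> y)
    then show ?case by (rule bound[OF poly3_mono[OF c1 le(1)]]) (rule coeff_norms_le_ls_residual)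
  next
    case (2 N x \<xi> y)
    then show ?case by (rule bound[OF poly3_mono[OF c2 le(2)]]) (rule coeff_norms_le_ls_residual)
  next
    case (3 N x \<xi> y)
    then show ?case by (rule bound[OF poly3_mono[OF c3 le(3)]]) (rule coeff_norms_le_ls_residual)
  next
    case (4 N x \<xi> y)
    then show ?case by (rule bound[OF poly3_mono[OF c4 le(4)]]) (rule coeff_norms_le_ls_residual)
  qed
qed

lemma geo_approx_eventually_close:
  assumes P: "geo_approx L P F" and L: "1 < L" and "0 < (\<epsilon>::real)"
  shows "\<forall>\<^sub>F N in sequentially. \<forall>x\<in>cball 0 1. \<forall>y\<in>cball 0 1. \<forall>z\<in>cball 0 1. cmod (P N x y z - F x y z) < \<epsilon>"
proof -
  obtain C \<rho> B where "geo_bound 1 P F C \<rho> B"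
    by (rule geo_approxE[OF P _ L]) simp
  note b = geo_boundD[OF this]
  have "uniform_limit (cball 0 1 \<times> cball 0 1 \<times> cball 0 1) (\<lambda>N (x, y, z). P N x y z) (\<lambda>(x, y, z). F x y z) sequentially"
    by (rule geo_uniform_limit[OF b(2,3)]) (use b(5) in auto)
  from uniform_limitD[OF this \<open>0 < \<epsilon>\<close>] show ?thesis
    by (rule eventually_mono) (auto simp: dist_norm)
qed

lemma geo_approx_tendsto:
  assumes P: "geo_approx L P F" and L: "1 < L" and "x \<in> cball 0 1" "y \<in> cball 0 1" "z \<in> cball 0 1"
  shows "(\<lambda>N. P N x y z) \<longlonglongrightarrow> F x y z"
  unfolding tendsto_iff dist_norm
proof (intro allI impI)
  fix e :: real assume "0 < e"
  from geo_approx_eventually_close[OF P L this]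
  show "\<forall>\<^sub>F N in sequentially. cmod (P N x y z - F x y z) < e"
    by (rule eventually_mono) (use assms(3-) in blast)
qed

lemma geo_approx_bounded:
  assumes P: "geo_approx L P F" and L: "1 < L"
  shows "\<exists>B. 0 \<le> B \<and> (\<forall>N. \<forall>x\<in>cball 0 1. \<forall>y\<in>cball 0 1. \<forall>z\<in>cball 0 1. cmod (P N x y z) \<le> B)"
proof -
  obtain C \<rho> B where "geo_bound 1 P F C \<rho> B"
    by (rule geo_approxE[OF P _ L]) simp
  from geo_boundD(4,6)[OF this] show ?thesis by (intro exI[of _ B]) blast
qed

lemma of_real_cball: "t \<in> {0..1} \<Longrightarrow> complex_of_real t \<in> cball 0 1"
  by simp

lemma ls_residual_decay:
  assumes L: "1 < L"
    and m: "geo_approx L (\<lambda>N x y z. trunc1 N \<mu> x) (\<lambda>x y z. \<mu> x)"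
    and l: "geo_approx L (\<lambda>N x y z. trunc2 N \<Lambda> x y) (\<lambda>x y z. \<Lambda> x y)"
    and s: "geo_approx L (\<lambda>N. trunc3 N \<sigma>) \<sigma>"
    and t: "geo_approx L (\<lambda>N x y z. trunc2 N \<theta> x y) (\<lambda>x y z. \<theta> x y)"
    and w: "geo_approx L (\<lambda>N x y z. trunc2 N W x y) (\<lambda>x y z. W x y)"
    and q: "geo_approx L (\<lambda>N x y z. trunc1 N q x) (\<lambda>x y z. q x)"
    and k: "geo_approx L (\<lambda>N. tpoly3 N K) k"
    and kb: "geo_approx L (\<lambda>N x y z. tpoly2 N Kb x y) (\<lambda>x y z. kb x y)"
    and nz: "\<And>x y. x \<in> {0..1} \<Longrightarrow> y \<in> {0..1} \<Longrightarrow>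
      \<Lambda> (complex_of_real x) (complex_of_real y) + \<mu> (complex_of_real x) \<noteq> 0"
    and exact: "kernel_solution \<mu> \<Lambda> \<sigma> \<theta> W q k kb"
  shows "geo_decay (\<lambda>N. ls_residual N \<mu> \<Lambda> \<sigma> \<theta> W q K Kb)"
proof -
  have L': "L \<le> 0 \<or> 1 < L" using L by simp
  have inf: "infinite {y \<in> {0..1::real}. Q y}" if "\<And>y. y \<in> {0..1} \<Longrightarrow> Q y" for Q
  proof -
    have "{y \<in> {0..1::real}. Q y} = {0..1}" using that by auto
    then show ?thesis by simp
  qed
  note zero = geo_approx_zero_on_domT[OF _ L]
  have 1: "geo_decay (\<lambda>N. sqrt (coeff_norm_sq (K1_defect (trunc1 N \<mu>) (trunc2 N \<Lambda>) (trunc3 N \<sigma>) (trunc2 N \<theta>) (tpoly3 N K) (tpoly2 N Kb))))"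
  proof (rule geo_decay_coeff_norm[OF geo_approx_K1_defect[OF L' m l s t k kb] L])
    show "K1_defect \<mu> \<Lambda> \<sigma> \<theta> k kb x \<xi> y = 0" if "x \<in> ball 0 L" "\<xi> \<in> ball 0 L" "y \<in> ball 0 L" for x \<xi> y
      by (rule zero[OF geo_approx_K1_defect[OF L' m l s t k kb] inf that])
        (use exact in \<open>auto simp: kernel_solution_def domP_def\<close>)
  qed
  have 2: "geo_decay (\<lambda>N. sqrt (coeff_norm_sq (\<lambda>x \<xi> y. K2_defect (trunc1 N \<mu>) (trunc2 N W) (tpoly3 N K) (tpoly2 N Kb) x \<xi>)))"
  proof (rule geo_decay_coeff_norm[OF geo_approx_K2_defect[OF L' m w k kb] L])
    show "K2_defect \<mu> W k kb x \<xi> = 0" if "x \<in> ball 0 L" "\<xi> \<in> ball 0 L" "y \<in> ball 0 L" for x \<xi> y :: complex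
      by (rule zero[OF geo_approx_K2_defect[OF L' m w k kb] inf that])
        (use exact in \<open>auto simp: kernel_solution_def\<close>)
  qed
  have 3: "geo_decay (\<lambda>N. sqrt (coeff_norm_sq (\<lambda>x \<xi> y. B1_defect (trunc1 N \<mu>) (trunc2 N \<Lambda>) (trunc2 N \<theta>) (tpoly3 N K) x y)))"
  proof (rule geo_decay_coeff_norm[OF geo_approx_B1_defect[OF m l t k] L])
    show "B1_defect \<mu> \<Lambda> \<theta> k x y = 0" if "x \<in> ball 0 L" "\<xi> \<in> ball 0 L" "y \<in> ball 0 L" for x \<xi> y :: complex
    proof (rule zero[OF geo_approx_B1_defect[OF m l t k] _ that])
      fix x \<xi> :: real assume "(x, \<xi>) \<in> domT"
      then have x: "x \<in> {0..1}" by (auto simp: domT_def)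
      let ?Z = "{y \<in> {0..1}. B1_defect \<mu> \<Lambda> \<theta> k (complex_of_real x) (complex_of_real y) = 0}"
      have "AE y in lborel. y \<in> {0..1} \<longrightarrow> k (complex_of_real x) (complex_of_real x) (complex_of_real y) =
          - (\<theta> (complex_of_real x) (complex_of_real y) /
             (\<Lambda> (complex_of_real x) (complex_of_real y) + \<mu> (complex_of_real x)))"
        using exact x by (auto simp: kernel_solution_def)
      \<comment> \<open>Multiplying by the nonzero denominator turns the original form of (B1) into
        a zero of the defect. So \<open>?Z\<close> has full measure in \<open>{0..1}\<close>, and
        being non-null it cannot be finite; the identity theorem then removes the exceptional
        points.\<close>
      then have ae: "AE y in lborel. y \<in> {0..1} \<longrightarrow> y \<in> ?Z"
        by (rule AE_mp) (use nz[OF x] in \<open>auto simp: B1_defect_def\<close>)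
      show "infinite ?Z"
      proof
        assume "finite ?Z"
        then have "AE y in lborel. y \<notin> ?Z"
          by (intro AE_not_in finite_imp_null_set_lborel)
        with ae have "AE y in lborel. y \<notin> {0..1::real}"
          by eventually_elim auto
        then have "emeasure lborel {0..1::real} = 0"
          by (subst (asm) AE_iff_measurable[of "{0..1}"]) auto
        then show False by simp
      qed
    qed
  qed
  have 4: "geo_decay (\<lambda>N. sqrt (coeff_norm_sq (\<lambda>x \<xi> y. B2_defect (trunc1 N \<mu>) (trunc2 N \<Lambda>) (trunc1 N q) (tpoly3 N K) (tpoly2 N Kb) x)))"
  proof (rule geo_decay_coeff_norm[OF geo_approx_B2_defect[OF L' m l q k kb] L])
    show "B2_defect \<mu> \<Lambda> q k kb x = 0" if "x \<in> ball 0 L" "\<xi> \<in> ball 0 L" "y \<in> ball 0 L" for x \<xi> y :: complex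
      by (rule zero[OF geo_approx_B2_defect[OF L' m l q k kb] inf that])
        (use exact in \<open>auto simp: kernel_solution_def domT_def\<close>)
  qed
  show ?thesis
    by (rule geo_decay_mono[OF geo_decay_add[OF geo_decay_add[OF geo_decay_add[OF 1 2] 3] 4] ls_residual_le_coeff_norms])
qed

section \<open>Convergence\<close>

theorem proposition1:
  fixes \<mu> q :: "complex \<Rightarrow> complex"
    and \<Lambda> \<theta> W kb :: "complex \<Rightarrow> complex \<Rightarrow> complex"
    and \<sigma> k :: "complex \<Rightarrow> complex \<Rightarrow> complex \<Rightarrow> complex"
    and K :: "nat \<Rightarrow> nat \<Rightarrow> nat \<Rightarrow> complex" and Kb :: "nat \<Rightarrow> nat \<Rightarrow> complex"
    and Ka :: "nat \<Rightarrow> nat \<Rightarrow> nat \<Rightarrow> nat \<Rightarrow> complex" and Kba :: "nat \<Rightarrow> nat \<Rightarrow> nat \<Rightarrow> complex"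
    and R Rb :: real
  assumes mu_analytic: "\<exists>L>1. \<mu> analytic_on ball 0 L"
    and lambda_analytic: "\<exists>L>1. analytic2_on \<Lambda> (ball 0 L \<times> ball 0 L)"
    and sigma_analytic: "\<exists>L>1. analytic3_on \<sigma> (ball 0 L \<times> ball 0 L \<times> ball 0 L)"
    and theta_analytic: "\<exists>L>1. analytic2_on \<theta> (ball 0 L \<times> ball 0 L)"
    and W_analytic: "\<exists>L>1. analytic2_on W (ball 0 L \<times> ball 0 L)"
    and q_analytic: "\<exists>L>1. q analytic_on ball 0 L"
    and mu_pos: "\<forall>x\<in>{0..1}. \<mu> (complex_of_real x) \<in> \<real> \<and> 0 < Re (\<mu> (complex_of_real x))"
    and lambda_pos: "\<forall>x\<in>{0..1}. \<forall>y\<in>{0..1}.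
      \<Lambda> (complex_of_real x) (complex_of_real y) \<in> \<real> \<and>
      0 < Re (\<Lambda> (complex_of_real x) (complex_of_real y))"
    and lambda_nonzero: "\<forall>x\<in>{0..1}. \<forall>y\<in>{0..1}.
      0 < cmod (\<Lambda> (complex_of_real x) (complex_of_real y))"
    and mu_nonzero: "\<forall>x\<in>{0..1}. 0 < cmod (\<mu> (complex_of_real x))"
    and radii: "1 < R" "1 < Rb"
    and k_series: "\<forall>x\<in>ball 0 R. \<forall>\<xi>\<in>ball 0 R. \<forall>y\<in>ball 0 R.
      ((\<lambda>(l, i, j). K i j l * x ^ (i - j) * \<xi> ^ j * y ^ l) has_sum k x \<xi> y) {(l, i, j). j \<le> i}"
    and kb_series: "\<forall>x\<in>ball 0 Rb. \<forall>\<xi>\<in>ball 0 Rb.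
      ((\<lambda>(i, j). Kb i j * x ^ (i - j) * \<xi> ^ j) has_sum kb x \<xi>) {(i, j). j \<le> i}"
    and exact: "kernel_solution \<mu> \<Lambda> \<sigma> \<theta> W q k kb"
    and approx: "\<forall>N. ls_solution N \<mu> \<Lambda> \<sigma> \<theta> W q (Ka N) (Kba N)"
  shows "(\<forall>(x, \<xi>, y)\<in>domP.
            (\<lambda>N. tpoly3 N (Ka N) (complex_of_real x) (complex_of_real \<xi>) (complex_of_real y))
              \<longlonglongrightarrow> k (complex_of_real x) (complex_of_real \<xi>) (complex_of_real y)) \<and>
         (\<forall>(x, \<xi>)\<in>domT.
            (\<lambda>N. tpoly2 N (Kba N) (complex_of_real x) (complex_of_real \<xi>))
              \<longlonglongrightarrow> kb (complex_of_real x) (complex_of_real \<xi>))"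
proof -
  obtain L1 where L1: "1 < L1" "\<mu> holomorphic_on ball 0 L1"
    using mu_analytic analytic_imp_holomorphic by blast
  obtain L2 where L2: "1 < L2" "analytic2_on \<Lambda> (ball 0 L2 \<times> ball 0 L2)"
    using lambda_analytic by blast
  obtain L3 where L3: "1 < L3" "analytic3_on \<sigma> (ball 0 L3 \<times> ball 0 L3 \<times> ball 0 L3)"
    using sigma_analytic by blast
  obtain L4 where L4: "1 < L4" "analytic2_on \<theta> (ball 0 L4 \<times> ball 0 L4)"
    using theta_analytic by blast
  obtain L5 where L5: "1 < L5" "analytic2_on W (ball 0 L5 \<times> ball 0 L5)"
    using W_analytic by blast
  obtain L6 where L6: "1 < L6" "q holomorphic_on ball 0 L6"
    using q_analytic analytic_imp_holomorphic by blast
  \<comment> \<open>Each hypothesis comes with its own radius; the smallest one serves for all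
    parameters and both kernels.\<close>
  define L where "L = Min {L1, L2, L3, L4, L5, L6, R, Rb}"
  have L: "1 < L"
    unfolding L_def using L1(1) L2(1) L3(1) L4(1) L5(1) L6(1) radii by (subst Min_gr_iff) simp_all
  have le: "L \<le> L1" "L \<le> L2" "L \<le> L3" "L \<le> L4" "L \<le> L5" "L \<le> L6" "L \<le> R" "L \<le> Rb"
    unfolding L_def by (rule Min_le; simp)+
  note m = geo_approx_mono[OF geo_approx_trunc1[OF L1(2)] le(1)]
  note l = geo_approx_mono[OF geo_approx_trunc2[OF L2(2)] le(2)]
  note s = geo_approx_mono[OF geo_approx_trunc3[OF L3(2)] le(3)]
  note t = geo_approx_mono[OF geo_approx_trunc2[OF L4(2)] le(4)]
  note w = geo_approx_mono[OF geo_approx_trunc2[OF L5(2)] le(5)]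
  note q = geo_approx_mono[OF geo_approx_trunc1[OF L6(2)] le(6)]
  have k: "geo_approx L (\<lambda>N. tpoly3 N K) k"
    by (rule geo_approx_mono[OF geo_approx_tpoly3 le(7)]) (use k_series in blast)
  have kb: "geo_approx L (\<lambda>N x y z. tpoly2 N Kb x y) (\<lambda>x y z. kb x y)"
    by (rule geo_approx_mono[OF geo_approx_tpoly2 le(8)]) (use kb_series in blast)

  \<comment> \<open>Residuals of the minimizer and of the truncated exact series\<close>
  define res where "res N = ls_residual N \<mu> \<Lambda> \<sigma> \<theta> W q K Kb" for N
  have nz: "\<Lambda> (complex_of_real x) (complex_of_real y) + \<mu> (complex_of_real x) \<noteq> 0"
    if "x \<in> {0..1}" "y \<in> {0..1}" for x y
  proof -
    have "0 < Re (\<Lambda> (complex_of_real x) (complex_of_real y) + \<mu> (complex_of_real x))"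
      using mu_pos lambda_pos that by (simp add: add_pos_pos)
    then show ?thesis by (metis less_irrefl zero_complex.simps(1))
  qed
  have res: "geo_decay res"
    unfolding res_def[abs_def] by (rule ls_residual_decay[OF L m l s t w q k kb nz exact])
  have res0: "0 \<le> res N" for N
    unfolding res_def by (rule ls_residual_nonneg)
  \<comment> \<open>The truncated exact series has the form of the ansatz and is therefore an
    admissible competitor in the minimization.\<close>
  have min: "ls_residual N \<mu> \<Lambda> \<sigma> \<theta> W q (Ka N) (Kba N) \<le> res N" for N
    using approx unfolding ls_solution_def res_def by blast
  obtain c where c: "\<forall>N x \<xi> y. cmod x \<le> 1 \<longrightarrow> cmod \<xi> \<le> 1 \<longrightarrow> cmod y \<le> 1 \<longrightarrow>
    cmod (K1_defect (trunc1 N \<mu>) (trunc2 N \<Lambda>) (trunc3 N \<sigma>) (trunc2 N \<theta>) (tpoly3 N (Ka N)) (tpoly2 N (Kba N)) x \<xi> y)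
      \<le> real (Suc (c * Suc N)) ^ 3 * ls_residual N \<mu> \<Lambda> \<sigma> \<theta> W q (Ka N) (Kba N) \<and>
    cmod (K2_defect (trunc1 N \<mu>) (trunc2 N W) (tpoly3 N (Ka N)) (tpoly2 N (Kba N)) x \<xi>)
      \<le> real (Suc (c * Suc N)) ^ 3 * ls_residual N \<mu> \<Lambda> \<sigma> \<theta> W q (Ka N) (Kba N) \<and>
    cmod (B1_defect (trunc1 N \<mu>) (trunc2 N \<Lambda>) (trunc2 N \<theta>) (tpoly3 N (Ka N)) x y)
      \<le> real (Suc (c * Suc N)) ^ 3 * ls_residual N \<mu> \<Lambda> \<sigma> \<theta> W q (Ka N) (Kba N) \<and>
    cmod (B2_defect (trunc1 N \<mu>) (trunc2 N \<Lambda>) (trunc1 N q) (tpoly3 N (Ka N)) (tpoly2 N (Kba N)) x)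
      \<le> real (Suc (c * Suc N)) ^ 3 * ls_residual N \<mu> \<Lambda> \<sigma> \<theta> W q (Ka N) (Kba N)"
    by (rule exE[OF defects_le_ls_residual[where K = "Ka" and Kb = "Kba"]])
  \<comment> \<open>The same estimate for the truncated exact series, viewed as a coefficient family
    constant in \<open>N\<close>.\<close>
  obtain d where d: "\<forall>N x \<xi> y. cmod x \<le> 1 \<longrightarrow> cmod \<xi> \<le> 1 \<longrightarrow> cmod y \<le> 1 \<longrightarrow>
    cmod (K1_defect (trunc1 N \<mu>) (trunc2 N \<Lambda>) (trunc3 N \<sigma>) (trunc2 N \<theta>) (tpoly3 N (K)) (tpoly2 N (Kb)) x \<xi> y)
      \<le> real (Suc (d * Suc N)) ^ 3 * ls_residual N \<mu> \<Lambda> \<sigma> \<theta> W q (K) (Kb) \<and>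
    cmod (K2_defect (trunc1 N \<mu>) (trunc2 N W) (tpoly3 N (K)) (tpoly2 N (Kb)) x \<xi>)
      \<le> real (Suc (d * Suc N)) ^ 3 * ls_residual N \<mu> \<Lambda> \<sigma> \<theta> W q (K) (Kb) \<and>
    cmod (B1_defect (trunc1 N \<mu>) (trunc2 N \<Lambda>) (trunc2 N \<theta>) (tpoly3 N (K)) x y)
      \<le> real (Suc (d * Suc N)) ^ 3 * ls_residual N \<mu> \<Lambda> \<sigma> \<theta> W q (K) (Kb) \<and>
    cmod (B2_defect (trunc1 N \<mu>) (trunc2 N \<Lambda>) (trunc1 N q) (tpoly3 N (K)) (tpoly2 N (Kb)) x)
      \<le> real (Suc (d * Suc N)) ^ 3 * ls_residual N \<mu> \<Lambda> \<sigma> \<theta> W q (K) (Kb)"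
    by (rule exE[OF defects_le_ls_residual[where K = "\<lambda>N. K" and Kb = "\<lambda>N. Kb"]])
  note c = c[rule_format, THEN conjunct1] c[rule_format, THEN conjunct2, THEN conjunct1]
    c[rule_format, THEN conjunct2, THEN conjunct2, THEN conjunct1]
    c[rule_format, THEN conjunct2, THEN conjunct2, THEN conjunct2]
  note d = d[rule_format, THEN conjunct1] d[rule_format, THEN conjunct2, THEN conjunct1]
    d[rule_format, THEN conjunct2, THEN conjunct2, THEN conjunct1]
    d[rule_format, THEN conjunct2, THEN conjunct2, THEN conjunct2]
  \<comment> \<open>The sum of the sup bounds for the two sets of defects, hence a bound for the
    defects of the difference.\<close>
  define \<delta> where "\<delta> N = real (Suc (c * Suc N)) ^ 3 * res N + real (Suc (d * Suc N)) ^ 3 * res N" for N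
  have \<delta>: "\<delta> \<longlonglongrightarrow> 0"
    using tendsto_add[OF geo_decay_times_cubic[OF res res0, of c] geo_decay_times_cubic[OF res res0, of d]]
    by (simp add: \<delta>_def[abs_def])
  have diff_le: "cmod (a - b) \<le> \<delta> N"
    if "cmod a \<le> real (Suc (c * Suc N)) ^ 3 * ls_residual N \<mu> \<Lambda> \<sigma> \<theta> W q (Ka N) (Kba N)"
      "cmod b \<le> real (Suc (d * Suc N)) ^ 3 * ls_residual N \<mu> \<Lambda> \<sigma> \<theta> W q K Kb" for a b N
  proof -
    have "real (Suc (c * Suc N)) ^ 3 * ls_residual N \<mu> \<Lambda> \<sigma> \<theta> W q (Ka N) (Kba N) \<le> real (Suc (c * Suc N)) ^ 3 * res N"
      by (intro mult_left_mono min) simp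
    then show ?thesis
      using norm_triangle_ineq4[of a b] that unfolding \<delta>_def res_def by linarith
  qed

  \<comment> \<open>Lower bounds for the truncated speeds\<close>
  have unit: "complex_of_real x \<in> ball 0 L" if "x \<in> {0..1}" for x using that L by auto
  have "continuous_on {0..1} (\<lambda>x. Re (\<mu> (complex_of_real x)))"
    using unit le(1)
    by (intro continuous_intros continuous_on_compose2[OF holomorphic_on_imp_continuous_on[OF L1(2)]]) force+
  then have "\<exists>x0\<in>{0..1}. \<forall>x\<in>{0..1}. Re (\<mu> (complex_of_real x0)) \<le> Re (\<mu> (complex_of_real x))"
    by (intro continuous_attains_inf compact_Icc) auto
  then obtain x0 where x0: "x0 \<in> {0..1}" "\<forall>x\<in>{0..1}. Re (\<mu> (complex_of_real x0)) \<le> Re (\<mu> (complex_of_real x))" ..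
  \<comment> \<open>Half of the minimum: a truncation closer than \<open>m0\<close> to
    \<open>\<mu>\<close> still has real part at least \<open>m0\<close>.\<close>
  define m0 where "m0 = Re (\<mu> (complex_of_real x0)) / 2"
  have m0: "0 < m0" using mu_pos x0(1) by (simp add: m0_def)
  have "continuous_on ({0..1} \<times> {0..1}) (\<lambda>p. \<Lambda> (complex_of_real (fst p)) (complex_of_real (snd p)))"
    by (rule geo_approx_continuous'[OF l _ L, where h = "\<lambda>_. 0"]) (auto intro!: continuous_intros)
  then have "\<exists>p0\<in>{0..1} \<times> {0..1}. \<forall>p\<in>{0..1} \<times> {0..1}.
      Re (\<Lambda> (complex_of_real (fst p0)) (complex_of_real (snd p0))) \<le> Re (\<Lambda> (complex_of_real (fst p)) (complex_of_real (snd p)))"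
    by (intro continuous_attains_inf compact_Times compact_Icc continuous_intros) auto
  then obtain p0 where p0: "p0 \<in> {0..1} \<times> {0..1}" "\<forall>p\<in>{0..1} \<times> {0..1}.
      Re (\<Lambda> (complex_of_real (fst p0)) (complex_of_real (snd p0))) \<le> Re (\<Lambda> (complex_of_real (fst p)) (complex_of_real (snd p)))" ..
  \<comment> \<open>The stability estimate asks of \<open>\<Lambda>\<close> only a nonnegative real
    part, so here the full minimum may serve as the tolerance.\<close>
  define l0 where "l0 = Re (\<Lambda> (complex_of_real (fst p0)) (complex_of_real (snd p0)))"
  have l0: "0 < l0" using lambda_pos p0(1) by (auto simp: l0_def)

  have mu_real: "trunc1 N \<mu> (complex_of_real x) \<in> \<real>" for N x
    using mu_pos by (intro trunc1_real taylor1_real[OF L1(2,1)]) auto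
  have lam_real: "trunc2 N \<Lambda> (complex_of_real x) (complex_of_real y) \<in> \<real>" for N x y
    using lambda_pos by (intro trunc2_real taylor2_real[OF L2(2,1)]) auto
  have ev_mu: "\<forall>\<^sub>F N in sequentially. \<forall>x\<in>{0..1}. m0 \<le> Re (trunc1 N \<mu> (complex_of_real x))"
    using geo_approx_eventually_close[OF m L m0]
  proof eventually_elim
    case (elim N)
    show ?case
    proof
      fix x :: real assume x: "x \<in> {0..1}"
      have "cmod (trunc1 N \<mu> (complex_of_real x) - \<mu> (complex_of_real x)) < m0"
        using elim of_real_cball[OF x] by blast
      then have "\<bar>Re (trunc1 N \<mu> (complex_of_real x)) - Re (\<mu> (complex_of_real x))\<bar> < m0"
        using abs_Re_le_cmod[of "trunc1 N \<mu> (complex_of_real x) - \<mu> (complex_of_real x)"] by simp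
      then show "m0 \<le> Re (trunc1 N \<mu> (complex_of_real x))"
        using x0(2)[rule_format, OF x] unfolding m0_def by linarith
    qed
  qed
  have ev_lam: "\<forall>\<^sub>F N in sequentially. \<forall>x\<in>{0..1}. \<forall>y\<in>{0..1}. 0 \<le> Re (trunc2 N \<Lambda> (complex_of_real x) (complex_of_real y))"
    using geo_approx_eventually_close[OF l L l0]
  proof eventually_elim
    case (elim N)
    show ?case
    proof (intro ballI)
      fix x y :: real assume xy: "x \<in> {0..1}" "y \<in> {0..1}"
      have "cmod (trunc2 N \<Lambda> (complex_of_real x) (complex_of_real y) - \<Lambda> (complex_of_real x) (complex_of_real y)) < l0"
        using elim of_real_cball[OF xy(1)] of_real_cball[OF xy(2)] by blast
      then have "\<bar>Re (trunc2 N \<Lambda> (complex_of_real x) (complex_of_real y)) - Re (\<Lambda> (complex_of_real x) (complex_of_real y))\<bar> < l0"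
        using abs_Re_le_cmod[of "trunc2 N \<Lambda> (complex_of_real x) (complex_of_real y) - \<Lambda> (complex_of_real x) (complex_of_real y)"]
        by simp
      then show "0 \<le> Re (trunc2 N \<Lambda> (complex_of_real x) (complex_of_real y))"
        using p0(2)[rule_format, of "(x, y)"] xy unfolding l0_def by simp
    qed
  qed

  \<comment> \<open>Constants of the stability estimate, uniform in the order\<close>
  obtain b1 where b1: "0 \<le> b1" "\<forall>N. \<forall>x\<in>cball 0 1. \<forall>y\<in>cball (0::complex) 1. \<forall>z\<in>cball (0::complex) 1. cmod (deriv (trunc1 N \<mu>) x) \<le> b1"
    using geo_approx_bounded[OF geo_approx_deriv[OF m] L] by (elim exE conjE) (rule that)
  obtain b2 where b2: "0 \<le> b2" "\<forall>N. \<forall>x\<in>cball 0 1. \<forall>y\<in>cball (0::complex) 1. \<forall>z\<in>cball (0::complex) 1. cmod (trunc2 N \<Lambda> x y) \<le> b2"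
    using geo_approx_bounded[OF l L] by (elim exE conjE) (rule that)
  obtain b3 where b3: "0 \<le> b3" "\<forall>N. \<forall>x\<in>cball 0 1. \<forall>y\<in>cball (0::complex) 1. \<forall>z\<in>cball (0::complex) 1. cmod (deriv (\<lambda>s. trunc2 N \<Lambda> s y) x) \<le> b3"
    using geo_approx_bounded[OF geo_approx_deriv[OF l] L] by (elim exE conjE) (rule that)
  obtain b4 where b4: "0 \<le> b4" "\<forall>N. \<forall>x\<in>cball 0 1. \<forall>y\<in>cball (0::complex) 1. \<forall>z\<in>cball (0::complex) 1. cmod (trunc2 N \<theta> x y) \<le> b4"
    using geo_approx_bounded[OF t L] by (elim exE conjE) (rule that)
  obtain b5 where b5: "0 \<le> b5" "\<forall>N. \<forall>x\<in>cball 0 1. \<forall>y\<in>cball (0::complex) 1. \<forall>z\<in>cball (0::complex) 1. cmod (trunc2 N W x y) \<le> b5"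
    using geo_approx_bounded[OF w L] by (elim exE conjE) (rule that)
  obtain b6 where b6: "0 \<le> b6" "\<forall>N. \<forall>x\<in>cball 0 1. \<forall>y\<in>cball (0::complex) 1. \<forall>z\<in>cball (0::complex) 1. cmod (trunc1 N q x) \<le> b6"
    using geo_approx_bounded[OF q L] by (elim exE conjE) (rule that)
  obtain b7 where b7: "0 \<le> b7" "\<forall>N. \<forall>x\<in>cball 0 1. \<forall>y\<in>cball (0::complex) 1. \<forall>z\<in>cball (0::complex) 1. cmod (trunc3 N \<sigma> x y z) \<le> b7"
    using geo_approx_bounded[OF s L] by (elim exE conjE) (rule that)
  define C where "C = b1 + b2 + b3 + b4 + b5 + b6 + b7"
  have C: "0 \<le> C" "b1 \<le> C" "b2 \<le> C" "b3 \<le> C" "b4 \<le> C" "b5 \<le> C" "b6 \<le> C" "b7 \<le> C"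
    using b1(1) b2(1) b3(1) b4(1) b5(1) b6(1) b7(1) by (auto simp: C_def)
  \<comment> \<open>\<open>A\<close>, \<open>M\<close> and \<open>B\<close> are the smallest values
    that meet the conditions of \<open>kernel_stability\<close>, chosen in this order because
    \<open>M\<close> and \<open>B\<close> involve \<open>A\<close>.\<close>
  define A where "A = max 1 (2 * C\<^sup>2 / m0)"
  have A: "1 \<le> A" "2 * C\<^sup>2 \<le> A * m0"
    using m0 by (auto simp: A_def field_simps max_def)
  define M where "M = (3 * C * A + 1) / m0"
  have M: "3 * C * A + 1 \<le> M * m0" using m0 by (simp add: M_def)
  define B where "B = max A (max (A / m0) (2 / m0))"
  have "A / m0 \<le> B" "2 / m0 \<le> B" by (auto simp: B_def)
  then have B: "A \<le> B" "A \<le> B * m0" "2 \<le> B * m0"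
    using m0 by (auto simp: B_def field_simps)

  \<comment> \<open>Difference of the approximant and the truncated exact series\<close>
  define e where "e N x y z = tpoly3 N (Ka N) x y z - tpoly3 N K x y z" for N x y z
  define eb where "eb N x y = tpoly2 N (Kba N) x y - tpoly2 N Kb x y" for N x y
  have p3: "poly3 (1 * Suc N) (trunc3 N f)" for N f
    unfolding trunc3_def by (rule poly3_tpoly3)
  have p2: "poly3 (1 * Suc N) (\<lambda>x y z. trunc2 N f x y)" for N f
    unfolding trunc2_def by (rule poly3_tpoly2)
  have p1: "poly3 (1 * Suc N) (\<lambda>x y z. trunc1 N f x)" for N f
    unfolding trunc1_def by (rule poly3_tpoly1)
  have real01: "cmod (complex_of_real x) \<le> 1" if "x \<in> {0..1}" for x
    using of_real_cball[OF that] by simp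
  \<comment> \<open>The two lower bounds are hypotheses here because the truncated speeds satisfy
    them only from some order on; the limit argument supplies them through \<open>ev_mu\<close> and
    \<open>ev_lam\<close>.\<close>
  have stability:
    "((x, \<xi>, y) \<in> domP \<longrightarrow> cmod (e N (complex_of_real x) (complex_of_real \<xi>) (complex_of_real y)) \<le> exp M * (B * \<delta> N)) \<and>
     ((x, \<xi>) \<in> domT \<longrightarrow> cmod (eb N (complex_of_real x) (complex_of_real \<xi>)) \<le> exp M * (B * \<delta> N))"
    if mu_ge: "\<forall>x\<in>{0..1}. m0 \<le> Re (trunc1 N \<mu> (complex_of_real x))"
      and lam_ge: "\<forall>x\<in>{0..1}. \<forall>y\<in>{0..1}. 0 \<le> Re (trunc2 N \<Lambda> (complex_of_real x) (complex_of_real y))"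
    for N x \<xi> y
  proof -
    have pe: "poly3 (1 * Suc N) (e N)"
      unfolding e_def[abs_def] by (intro poly3_diff poly3_tpoly3)
    have peb: "poly3 (1 * Suc N) (\<lambda>x y z. eb N x y)"
      unfolding eb_def[abs_def] by (intro poly3_diff poly3_tpoly2)
    have K1: "cmod (K1_defect (trunc1 N \<mu>) (trunc2 N \<Lambda>) (trunc3 N \<sigma>) (trunc2 N \<theta>) (e N) (eb N)
        (complex_of_real x) (complex_of_real \<xi>) (complex_of_real y)) \<le> \<delta> N" if "(x, \<xi>, y) \<in> domP" for x \<xi> y
    proof -
      have "x \<in> {0..1}" "\<xi> \<in> {0..1}" "y \<in> {0..1}"
        using domP_D[OF that] domT_D by blast+
      note r = this[THEN real01]
      show ?thesis
        unfolding e_def[abs_def] eb_def[abs_def] K1_defect_diff[OF p3 poly3_tpoly3 poly3_tpoly3]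
        by (rule diff_le[OF c(1)[OF r] d(1)[OF r]])
    qed
    have K2: "cmod (K2_defect (trunc1 N \<mu>) (trunc2 N W) (e N) (eb N)
        (complex_of_real x) (complex_of_real \<xi>)) \<le> \<delta> N" if "(x, \<xi>) \<in> domT" for x \<xi>
    proof -
      have "x \<in> {0..1}" "\<xi> \<in> {0..1}" "x \<in> {0..1}"
        using domT_D[OF that] by blast+
      note r = this[THEN real01]
      show ?thesis
        unfolding e_def[abs_def] eb_def[abs_def] K2_defect_diff[OF p2 poly3_tpoly3 poly3_tpoly3 poly3_tpoly2 poly3_tpoly2]
        by (rule diff_le[OF c(2)[OF r] d(2)[OF r]])
    qed
    have B1: "cmod ((trunc2 N \<Lambda> (complex_of_real x) (complex_of_real y) + trunc1 N \<mu> (complex_of_real x)) *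
        e N (complex_of_real x) (complex_of_real x) (complex_of_real y)) \<le> \<delta> N" if "x \<in> {0..1}" "y \<in> {0..1}" for x y
    proof -
      note r = that(1,1,2)[THEN real01]
      show ?thesis
        unfolding e_def B1_defect_diff[symmetric, where \<theta> = "trunc2 N \<theta>"]
        by (rule diff_le[OF c(3)[OF r] d(3)[OF r]])
    qed
    have B2: "cmod (B2_defect (trunc1 N \<mu>) (trunc2 N \<Lambda>) (trunc1 N q) (e N) (eb N) (complex_of_real x)) \<le> \<delta> N"
      if "x \<in> {0..1}" for x
    proof -
      note r = that[THEN real01]
      show ?thesis
        unfolding e_def[abs_def] eb_def[abs_def] B2_defect_diff[OF p1 p2 poly3_tpoly3 poly3_tpoly3]
        by (rule diff_le[OF c(4)[OF r r r] d(4)[OF r r r]])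
    qed
    note r = of_real_cball
    have bounds:
      "\<And>x. x \<in> {0..1} \<Longrightarrow> cmod (deriv (trunc1 N \<mu>) (complex_of_real x)) \<le> C"
      "\<And>x y. x \<in> {0..1} \<Longrightarrow> y \<in> {0..1} \<Longrightarrow> cmod (trunc2 N \<Lambda> (complex_of_real x) (complex_of_real y)) \<le> C"
      "\<And>x y. x \<in> {0..1} \<Longrightarrow> y \<in> {0..1} \<Longrightarrow>
        cmod (deriv (\<lambda>s. trunc2 N \<Lambda> s (complex_of_real y)) (complex_of_real x)) \<le> C"
      "\<And>x y. x \<in> {0..1} \<Longrightarrow> y \<in> {0..1} \<Longrightarrow> cmod (trunc2 N \<theta> (complex_of_real x) (complex_of_real y)) \<le> C"
      "\<And>x y. x \<in> {0..1} \<Longrightarrow> y \<in> {0..1} \<Longrightarrow> cmod (trunc2 N W (complex_of_real x) (complex_of_real y)) \<le> C"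
      "\<And>x. x \<in> {0..1} \<Longrightarrow> cmod (trunc1 N q (complex_of_real x)) \<le> C"
      "\<And>x y z. x \<in> {0..1} \<Longrightarrow> y \<in> {0..1} \<Longrightarrow> z \<in> {0..1} \<Longrightarrow>
        cmod (trunc3 N \<sigma> (complex_of_real x) (complex_of_real y) (complex_of_real z)) \<le> C"
      by (rule order_trans[OF b1(2)[rule_format, OF r r r] C(2)], assumption+,
          rule order_trans[OF b2(2)[rule_format, OF r r r] C(3)], assumption+,
          rule order_trans[OF b3(2)[rule_format, OF r r r] C(4)], assumption+,
          rule order_trans[OF b4(2)[rule_format, OF r r r] C(5)], assumption+,
          rule order_trans[OF b5(2)[rule_format, OF r r r] C(6)], assumption+,
          rule order_trans[OF b6(2)[rule_format, OF r r r] C(7)], assumption+,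
          rule order_trans[OF b7(2)[rule_format, OF r r r] C(8)], assumption+)
    have mu': "\<And>x. x \<in> {0..1} \<Longrightarrow> trunc1 N \<mu> (complex_of_real x) \<in> \<real> \<and> m0 \<le> Re (trunc1 N \<mu> (complex_of_real x))"
      using mu_real mu_ge by blast
    have lam': "\<And>x y. x \<in> {0..1} \<Longrightarrow> y \<in> {0..1} \<Longrightarrow> trunc2 N \<Lambda> (complex_of_real x) (complex_of_real y) \<in> \<real> \<and>
        0 \<le> Re (trunc2 N \<Lambda> (complex_of_real x) (complex_of_real y))"
      using lam_real lam_ge by blast
    show ?thesis
      using kernel_stability[OF C(1) m0 A M B pe peb mu' lam' bounds K1 K2 B1 B2] by blast
  qed
  have bound0: "(\<lambda>N. exp M * (B * \<delta> N)) \<longlonglongrightarrow> 0"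
    using tendsto_mult[OF tendsto_const[of "exp M"] tendsto_mult[OF tendsto_const[of B] \<delta>]] by simp
  have "(\<lambda>N. tpoly3 N (Ka N) (complex_of_real x) (complex_of_real \<xi>) (complex_of_real y))
      \<longlonglongrightarrow> k (complex_of_real x) (complex_of_real \<xi>) (complex_of_real y)" if d: "(x, \<xi>, y) \<in> domP" for x \<xi> y
  proof -
    have "\<forall>\<^sub>F N in sequentially. norm (e N (complex_of_real x) (complex_of_real \<xi>) (complex_of_real y)) \<le> exp M * (B * \<delta> N)"
      using ev_mu ev_lam by eventually_elim (use stability d in blast)
    then have "(\<lambda>N. e N (complex_of_real x) (complex_of_real \<xi>) (complex_of_real y)) \<longlonglongrightarrow> 0"
      by (rule Lim_null_comparison[OF _ bound0])
    moreover have "(\<lambda>N. tpoly3 N K (complex_of_real x) (complex_of_real \<xi>) (complex_of_real y))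
        \<longlonglongrightarrow> k (complex_of_real x) (complex_of_real \<xi>) (complex_of_real y)"
      using domP_D[OF d] domT_D[of x \<xi>] by (intro geo_approx_tendsto[OF k L] of_real_cball) auto
    ultimately show ?thesis
      using tendsto_add by (fastforce simp: e_def)
  qed
  moreover have "(\<lambda>N. tpoly2 N (Kba N) (complex_of_real x) (complex_of_real \<xi>))
      \<longlonglongrightarrow> kb (complex_of_real x) (complex_of_real \<xi>)" if d: "(x, \<xi>) \<in> domT" for x \<xi>
  proof -
    have "\<forall>\<^sub>F N in sequentially. norm (eb N (complex_of_real x) (complex_of_real \<xi>)) \<le> exp M * (B * \<delta> N)"
      using ev_mu ev_lam by eventually_elim (use stability d in blast)
    then have "(\<lambda>N. eb N (complex_of_real x) (complex_of_real \<xi>)) \<longlonglongrightarrow> 0"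
      by (rule Lim_null_comparison[OF _ bound0])
    moreover have "(\<lambda>N. tpoly2 N Kb (complex_of_real x) (complex_of_real \<xi>))
        \<longlonglongrightarrow> kb (complex_of_real x) (complex_of_real \<xi>)"
      using domT_D[OF d] geo_approx_tendsto[OF kb L, of "complex_of_real x" "complex_of_real \<xi>" 0] by simp
    ultimately show ?thesis
      using tendsto_add by (fastforce simp: eb_def)
  qed
  ultimately show ?thesis by blast
qed

end
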